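(* Let $1<p<\infty$ and let $U_n:L^1(0,1)\to L^\infty(0,1)$, $n=1,2,\ldots$, be a sequence of bounded linear operators satisfying properties (A) and (B) (listed in the context), and let $\varepsilon>0$. Then there is an open set $G_\varepsilon\subset(0,1)$ with $|G_\varepsilon|<\varepsilon$ such that for every function $f\in L^1(0,1)$ one can find a function $g\in L^1(0,1)$ with $\{x: f(x)\neq g(x)\}\subset G_\varepsilon$ and $$\|U_n g-g\|_1\to 0\quad\text{as } n\to\infty .$$ If $(U_n)$ satisfies also properties (C) and (D) (listed in the context), then $G_\varepsilon$ and $g$ can be chosen so that additionally $$U_n g(x)\to g(x)\quad\text{for almost every } x .$$
   Context: $|E|$ denotes Lebesgue measure, $\mathbf 1_E$ the indicator function of $E$, $\|\cdot\|_p$ the norm of $L^p(0,1)$. Intervals are of the form $[a,b)\subset[0,1)$. A finite-interval set is a union of finitely many intervals. Weak convergence: $f_n\overset{w}{\to}f$ for $f_n,f\in L^1(0,1)$ means $\int_0^1 f_n g\to\int_0^1 fg$ for every $g\in L^\infty(0,1)$. A bounded linear operator $U:L^1(0,1)\to L^1(0,1)$ is called compact if $\|U(f_n)-U(f)\|_1\to0$ whenever $f_n\overset{w}{\to}f$. (An operator $L^1(0,1)\to L^\infty(0,1)$ is regarded as an operator into $L^1(0,1)$.) A countable family $\mathcal I$ of intervals is called a basis if 1) $[0,1)\in\mathcal I$; 2) for any $\Delta=[a,b)\in\mathcal I$ there are infinitely many integers $l>0$ such that $[a+|\Delta|(j-1)/l,\,a+|\Delta|j/l)\in\mathcal I$ for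 all $j=1,\ldots,l$. Put $U^*f(x)=\sup_n|U_nf(x)|$. The properties are: (A) each $U_n$ is a compact operator; (B) $\|U_n(f)-f\|_p\to0$ as $n\to\infty$ for every $f\in L^p(0,1)$; (C) $U_n(\mathbf 1_G)$ converges almost everywhere for any interval $G$; (D) there are constants $0<\alpha<1$, $\beta>0$ depending only on the sequence $(U_n)$ such that for any $0<\varepsilon<1$ there is a sequence of finite-interval sets $G_l=G_l(\varepsilon)\subset[0,1)$, $l=1,2,\ldots$, with $\alpha\varepsilon\le|G_l|\le\varepsilon$ for all $l$, and $|G_l|^{-1}\mathbf 1_{G_l}\overset{w}{\to}\mathbf 1_{[0,1)}$ as $l\to\infty$, and there is a basis $\mathcal I$ such that for any $\Delta\in\mathcal I$ and $\lambda>0$ $$\lambda\cdot|\{U^*(\mathbf 1_{G_l\cap\Delta})>\lambda\}|\le\beta\,|G_l\cap\Delta|,\quad l=1,2,\ldots.$$ *)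

theory Defs
  imports "HOL-Probability.Probability"
begin

text \<open>
  Elements of the spaces \<open>L\<^sup>p(0,1)\<close> are represented by real-valued functions on the real line, of
  which only the values on the open unit interval matter, and which are compared almost everywhere.
  An operator maps representatives to representatives and must respect almost everywhere equality.
\<close>

abbreviation unit_leb :: "real measure" where
  "unit_leb \<equiv> lebesgue_on {0<..<1}"

definition Lp_space :: "real \<Rightarrow> (real \<Rightarrow> real) set" where
  "Lp_space p = {f. f \<in> borel_measurable unit_leb \<and> integrable unit_leb (\<lambda>x. \<bar>f x\<bar> powr p)}"

definition Lp_norm :: "real \<Rightarrow> (real \<Rightarrow> real) \<Rightarrow> real" where
  "Lp_norm p f = (LINT x|unit_leb. \<bar>f x\<bar> powr p) powr (1 / p)"

definition Linf_norm :: "(real \<Rightarrow> real) \<Rightarrow> ereal" where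
  "Linf_norm f = esssup unit_leb (\<lambda>x. ereal \<bar>f x\<bar>)"

definition Linf_space :: "(real \<Rightarrow> real) set" where
  "Linf_space = {f. f \<in> borel_measurable unit_leb \<and> Linf_norm f < \<infinity>}"

lemma Lp_space_1: "f \<in> Lp_space 1 \<longleftrightarrow> integrable unit_leb f"
  unfolding Lp_space_def by (auto intro: integrable_abs integrable_abs_cancel)

lemma Lp_norm_1: "Lp_norm 1 f = (LINT x|unit_leb. \<bar>f x\<bar>)"
  unfolding Lp_norm_def by simp

definition weakly_converges :: "(nat \<Rightarrow> real \<Rightarrow> real) \<Rightarrow> (real \<Rightarrow> real) \<Rightarrow> bool" where
  "weakly_converges F f \<longleftrightarrow>
     (\<forall>n. F n \<in> Lp_space 1) \<and> f \<in> Lp_space 1 \<and>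
     (\<forall>g\<in>Linf_space. (\<lambda>n. LINT x|unit_leb. F n x * g x) \<longlonglongrightarrow> (LINT x|unit_leb. f x * g x))"

definition linear_on_L1 :: "((real \<Rightarrow> real) \<Rightarrow> real \<Rightarrow> real) \<Rightarrow> bool" where
  "linear_on_L1 U \<longleftrightarrow>
     (\<forall>f\<in>Lp_space 1. \<forall>g\<in>Lp_space 1.
        (AE x in unit_leb. f x = g x) \<longrightarrow> (AE x in unit_leb. U f x = U g x)) \<and>
     (\<forall>f\<in>Lp_space 1. \<forall>g\<in>Lp_space 1. AE x in unit_leb. U (\<lambda>t. f t + g t) x = U f x + U g x) \<and>
     (\<forall>f\<in>Lp_space 1. \<forall>c. AE x in unit_leb. U (\<lambda>t. c * f t) x = c * U f x)"

definition bounded_op_L1_Linf :: "((real \<Rightarrow> real) \<Rightarrow> real \<Rightarrow> real) \<Rightarrow> bool" where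
  "bounded_op_L1_Linf U \<longleftrightarrow>
     linear_on_L1 U \<and> (\<forall>f\<in>Lp_space 1. U f \<in> Linf_space) \<and>
     (\<exists>C. \<forall>f\<in>Lp_space 1. Linf_norm (U f) \<le> ereal (C * Lp_norm 1 f))"

definition bounded_op_L1_L1 :: "((real \<Rightarrow> real) \<Rightarrow> real \<Rightarrow> real) \<Rightarrow> bool" where
  "bounded_op_L1_L1 U \<longleftrightarrow>
     linear_on_L1 U \<and> (\<forall>f\<in>Lp_space 1. U f \<in> Lp_space 1) \<and>
     (\<exists>C. \<forall>f\<in>Lp_space 1. Lp_norm 1 (U f) \<le> C * Lp_norm 1 f)"

definition compact_op :: "((real \<Rightarrow> real) \<Rightarrow> real \<Rightarrow> real) \<Rightarrow> bool" where
  "compact_op U \<longleftrightarrow>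
     bounded_op_L1_L1 U \<and>
     (\<forall>F f. weakly_converges F f \<longrightarrow> (\<lambda>n. Lp_norm 1 (\<lambda>x. U (F n) x - U f x)) \<longlonglongrightarrow> 0)"

definition is_interval01 :: "real set \<Rightarrow> bool" where
  "is_interval01 D \<longleftrightarrow> (\<exists>a b. 0 \<le> a \<and> a < b \<and> b \<le> 1 \<and> D = {a..<b})"

definition finite_interval_set :: "real set \<Rightarrow> bool" where
  "finite_interval_set G \<longleftrightarrow> (\<exists>\<D>. finite \<D> \<and> (\<forall>D\<in>\<D>. is_interval01 D) \<and> G = \<Union>\<D>)"

definition interval_basis :: "real set set \<Rightarrow> bool" where
  "interval_basis \<I> \<longleftrightarrow>
     countable \<I> \<and> (\<forall>D\<in>\<I>. is_interval01 D) \<and> {0..<1} \<in> \<I> \<and>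
     (\<forall>a b. a < b \<and> {a..<b} \<in> \<I> \<longrightarrow>
        infinite {l::nat. l > 0 \<and>
          (\<forall>j\<in>{1..l}. {a + (b - a) * (real j - 1) / real l ..< a + (b - a) * real j / real l} \<in> \<I>)})"

definition maximal_op ::
    "(nat \<Rightarrow> (real \<Rightarrow> real) \<Rightarrow> real \<Rightarrow> real) \<Rightarrow> (real \<Rightarrow> real) \<Rightarrow> real \<Rightarrow> ereal" where
  "maximal_op U f x = (SUP n. ereal \<bar>U n f x\<bar>)"

definition prop_A :: "(nat \<Rightarrow> (real \<Rightarrow> real) \<Rightarrow> real \<Rightarrow> real) \<Rightarrow> bool" where
  "prop_A U \<longleftrightarrow> (\<forall>n. compact_op (U n))"

definition prop_B :: "real \<Rightarrow> (nat \<Rightarrow> (real \<Rightarrow> real) \<Rightarrow> real \<Rightarrow> real) \<Rightarrow> bool" where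
  "prop_B p U \<longleftrightarrow> (\<forall>f\<in>Lp_space p. (\<lambda>n. Lp_norm p (\<lambda>x. U n f x - f x)) \<longlonglongrightarrow> 0)"

definition prop_C :: "(nat \<Rightarrow> (real \<Rightarrow> real) \<Rightarrow> real \<Rightarrow> real) \<Rightarrow> bool" where
  "prop_C U \<longleftrightarrow>
     (\<forall>G. is_interval01 G \<longrightarrow> (AE x in unit_leb. convergent (\<lambda>n. U n (indicat_real G) x)))"

definition prop_D :: "(nat \<Rightarrow> (real \<Rightarrow> real) \<Rightarrow> real \<Rightarrow> real) \<Rightarrow> bool" where
  "prop_D U \<longleftrightarrow>
     (\<exists>\<alpha> \<beta>. 0 < \<alpha> \<and> \<alpha> < 1 \<and> 0 < \<beta> \<and>
       (\<forall>\<epsilon>. 0 < \<epsilon> \<and> \<epsilon> < 1 \<longrightarrow>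
         (\<exists>G :: nat \<Rightarrow> real set.
            (\<forall>l. finite_interval_set (G l)) \<and>
            (\<forall>l. \<alpha> * \<epsilon> \<le> measure lebesgue (G l) \<and> measure lebesgue (G l) \<le> \<epsilon>) \<and>
            weakly_converges (\<lambda>l x. indicat_real (G l) x / measure lebesgue (G l))
              (indicat_real {0..<1}) \<and>
            (\<exists>\<I>. interval_basis \<I> \<and>
               (\<forall>D\<in>\<I>. \<forall>t>0. \<forall>l.
                  t * measure lebesgue
                    {x \<in> {0<..<1}. maximal_op U (indicat_real (G l \<inter> D)) x > ereal t}
                  \<le> \<beta> * measure lebesgue (G l \<inter> D))))))"

end

theory Submission imports Defs
begin

text \<open>
  Let \<open>d\<close> be continuous and let \<open>a\<^sub>i\<close> be its values on a fine grid of cells \<open>\<Delta>\<^sub>i\<close>. Replacing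
  \<open>a\<^sub>i 1\<^bsub>\<Delta>\<^sub>i\<^esub>\<close> by \<open>p\<^sub>i = a\<^sub>i (1\<^bsub>\<Delta>\<^sub>i\<^esub> - 1\<^bsub>G\<^sub>l \<inter> \<Delta>\<^sub>i\<^esub> / |G\<^sub>l|)\<close> changes it only on a small set
  and makes it almost weakly null. Choosing \<open>l = l\<^sub>i\<close> and thresholds \<open>N\<^sub>0 \<le> N\<^sub>1 \<le> \<dots>\<close> successively,
  compactness gives \<open>U\<^sub>n p\<^sub>i \<approx> 0\<close> for \<open>n < N\<^sub>i\<close> and convergence gives \<open>U\<^sub>n p\<^sub>i \<approx> p\<^sub>i\<close> for
  \<open>n \<ge> N\<^sub>i\<^sub>+\<^sub>1\<close>, so for each \<open>n\<close> only one piece is uncontrolled; that piece is small in \<open>L\<^sup>1\<close>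
  uniformly in \<open>n\<close>, because its support is small, and it obeys the weak type estimate of (D).
  Hence \<open>g = \<Sum> p\<^sub>i\<close> satisfies \<open>sup\<^sub>n \<parallel>U\<^sub>n g\<parallel>\<^sub>1 \<le> 3 \<parallel>d\<parallel>\<^sub>1 + \<delta>\<close> and a weak type bound for
  \<open>U\<^sup>* g\<close> in terms of \<open>\<parallel>d\<parallel>\<^sub>1\<close>. Correcting in this way a sequence of functions \<open>d\<^sub>k\<close> dense in \<open>L\<^sup>1\<close>
  fixes the exceptional set once and for all; off it, every \<open>f\<close> in \<open>L\<^sup>1\<close> is a rapidly converging
  sum of corrected functions, and the series of the images under \<open>U\<^sub>n\<close> converges by Tannery's theorem
  and the Borel--Cantelli lemma.
\<close>

section \<open>The space of integrable functions on the unit interval\<close>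

text \<open>The obstacle is that the operators are not assumed to have a common bound on L1, while
  \<open>f\<close> is merely integrable. The correction must create such a bound at the price of a
  small set, so all estimates for a corrected function involve the L1 norm of \<open>d\<close>
  alone, plus an error as small as desired. About the one uncontrolled piece it is known only that
  it is bounded and lives on one cell; cells are refined until equiintegrability of the whole
  sequence makes its images small. This forces an order of choices: the bound for the pieces, then
  the mesh, then \<open>l\<close> and the threshold cell by cell.

  Pieces are step functions on intervals because (C) speaks of intervals. Weak L1 has no triangle
  inequality, but as one piece at a time is uncontrolled, the level need not be divided among the
  cells and a union bound suffices.

  To make the exceptional set independent of \<open>f\<close>, the k-th dense function gets a set of
  size of order 2^-k. The expansion of \<open>f\<close> uses larger and larger k, so that the errors
  sum, and its residuals are reset to zero on the exceptional set, where \<open>f\<close> may be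
  changed anyway.\<close>

interpretation unit_leb: prob_space unit_leb
  by standard (simp add: emeasure_restrict_space)

lemma space_unit_leb: "space unit_leb = {0<..<1}"
  by simp

lemma measure_unit_leb:
  assumes "A \<in> sets unit_leb"
  shows "measure unit_leb A = measure lebesgue A"
  using assms by (subst measure_restrict_space) (auto simp: sets_restrict_space)

lemma integrable_unit_leb_bounded:
  fixes f :: "real \<Rightarrow> real"
  assumes "f \<in> borel_measurable unit_leb" "\<And>x. x \<in> {0<..<1} \<Longrightarrow> \<bar>f x\<bar> \<le> A"
  shows "integrable unit_leb f"
  using assms by (intro unit_leb.integrable_const_bound[where B = A]) auto

lemma unit_leb_integral_abs_le_const:
  fixes f :: "real \<Rightarrow> real"
  assumes "integrable unit_leb f" "\<And>x. x \<in> {0<..<1} \<Longrightarrow> \<bar>f x\<bar> \<le> A"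
  shows "(LINT x|unit_leb. \<bar>f x\<bar>) \<le> A"
  using assms by (intro unit_leb.integral_le_const) auto

section \<open>Integral inequalities and series in L1\<close>

lemma integral_abs_triangle:
  fixes f g :: "real \<Rightarrow> real"
  assumes "integrable M f" "integrable M g"
  shows "(LINT x|M. \<bar>f x + g x\<bar>) \<le> (LINT x|M. \<bar>f x\<bar>) + (LINT x|M. \<bar>g x\<bar>)"
proof -
  have "(LINT x|M. \<bar>f x + g x\<bar>) \<le> (LINT x|M. \<bar>f x\<bar> + \<bar>g x\<bar>)"
    using assms by (intro integral_mono) auto
  then show ?thesis using assms by simp
qed

lemma integral_abs_sum_le:
  fixes f :: "'i \<Rightarrow> 'a \<Rightarrow> real"
  assumes "\<And>i. i \<in> I \<Longrightarrow> integrable M (f i)"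
  shows "(LINT x|M. \<bar>\<Sum>i\<in>I. f i x\<bar>) \<le> (\<Sum>i\<in>I. LINT x|M. \<bar>f i x\<bar>)"
proof -
  have "(LINT x|M. \<bar>\<Sum>i\<in>I. f i x\<bar>) \<le> (LINT x|M. (\<Sum>i\<in>I. \<bar>f i x\<bar>))"
    using assms by (intro integral_mono) auto
  then show ?thesis using assms by simp
qed

lemma Markov_abs:
  fixes f :: "real \<Rightarrow> real"
  assumes "integrable M f" "t > 0"
  shows "measure M {x \<in> space M. \<bar>f x\<bar> > t} \<le> (LINT x|M. \<bar>f x\<bar>) / t"
proof -
  have "emeasure M {x \<in> space M. \<bar>f x\<bar> \<ge> t} \<le> ennreal ((LINT x|M. \<bar>f x\<bar>) / t)"
    using assms integral_Markov_inequality[of M "\<lambda>x. \<bar>f x\<bar>" t] by (simp add: divide_inverse mult.commute)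
  then have fin: "emeasure M {x \<in> space M. \<bar>f x\<bar> \<ge> t} < \<infinity>"
    using order_le_less_trans[of _ "ennreal _" \<infinity>] by fastforce
  have [measurable]: "f \<in> borel_measurable M" using assms by auto
  have "measure M {x \<in> space M. \<bar>f x\<bar> > t} \<le> measure M {x \<in> space M. \<bar>f x\<bar> \<ge> t}"
    using fin by (intro measure_mono_fmeasurable) (auto simp: fmeasurable_def)
  also have "\<dots> \<le> (LINT x|M. \<bar>f x\<bar>) / t"
    using assms by (intro integral_Markov_inequality_measure[where A="{}"]) auto
  finally show ?thesis .
qed

text \<open>Monotone convergence makes the sum of the \<open>\<bar>h j x\<bar>\<close> integrable,
  and twice that sum dominates the remainders. The third claim is the form in which series enter
  \<open>U_sums_AE\<close> and \<open>L1_conv_series\<close>.\<close>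

lemma summable_integral_abs:
  fixes h :: "nat \<Rightarrow> 'a \<Rightarrow> real"
  assumes h: "\<And>j. integrable M (h j)" and s: "summable (\<lambda>j. LINT x|M. \<bar>h j x\<bar>)"
  shows "AE x in M. summable (\<lambda>j. \<bar>h j x\<bar>)"
    and "integrable M (\<lambda>x. \<Sum>j. h j x)"
    and "(\<lambda>J. LINT x|M. \<bar>(\<Sum>j. h j x) - (\<Sum>j<J. h j x)\<bar>) \<longlonglongrightarrow> 0"
proof -
  have [measurable]: "h j \<in> borel_measurable M" for j using h by auto
  have "(\<integral>\<^sup>+x. (\<Sum>j. ennreal \<bar>h j x\<bar>) \<partial>M) = (\<Sum>j. \<integral>\<^sup>+x. ennreal \<bar>h j x\<bar> \<partial>M)"
    by (intro nn_integral_suminf) auto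
  also have "\<dots> = (\<Sum>j. ennreal (LINT x|M. \<bar>h j x\<bar>))"
    using h by (subst nn_integral_eq_integral) auto
  also have "\<dots> \<noteq> \<infinity>"
    using s by (subst suminf_ennreal2) auto
  finally have "AE x in M. (\<Sum>j. ennreal \<bar>h j x\<bar>) \<noteq> \<infinity>"
    by (intro nn_integral_PInf_AE) auto
  then show ae: "AE x in M. summable (\<lambda>j. \<bar>h j x\<bar>)"
    by eventually_elim (intro summable_suminf_not_top, auto)
  then show int: "integrable M (\<lambda>x. \<Sum>j. h j x)"
    using h s by (intro integrable_suminf) auto
  have int': "integrable M (\<lambda>x. \<Sum>j. \<bar>h j x\<bar>)"
    using h s ae by (intro integrable_suminf) auto
  have "(\<lambda>J. LINT x|M. \<bar>(\<Sum>j. h j x) - (\<Sum>j<J. h j x)\<bar>) \<longlonglongrightarrow> (LINT x|M. 0)"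
  proof (rule integral_dominated_convergence[where w = "\<lambda>x. 2 * (\<Sum>j. \<bar>h j x\<bar>)"])
    show "AE x in M. (\<lambda>J. \<bar>(\<Sum>j. h j x) - (\<Sum>j<J. h j x)\<bar>) \<longlonglongrightarrow> 0"
      using ae
    proof eventually_elim
      case (elim x)
      then have "(\<lambda>J. \<Sum>j<J. h j x) \<longlonglongrightarrow> (\<Sum>j. h j x)"
        by (rule summable_LIMSEQ[OF summable_rabs_cancel])
      then have "(\<lambda>J. \<bar>(\<Sum>j. h j x) - (\<Sum>j<J. h j x)\<bar>) \<longlonglongrightarrow> \<bar>(\<Sum>j. h j x) - (\<Sum>j. h j x)\<bar>"
        by (intro tendsto_intros)
      then show ?case by simp
    qed
    show "AE x in M. norm \<bar>(\<Sum>j. h j x) - (\<Sum>j<J. h j x)\<bar> \<le> 2 * (\<Sum>j. \<bar>h j x\<bar>)" for J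
      using ae
    proof eventually_elim
      case (elim x)
      have "\<bar>\<Sum>j. h j x\<bar> \<le> (\<Sum>j. \<bar>h j x\<bar>)"
        using elim by (rule summable_rabs)
      moreover have "\<bar>\<Sum>j<J. h j x\<bar> \<le> (\<Sum>j<J. \<bar>h j x\<bar>)"
        by (rule sum_abs)
      moreover have "(\<Sum>j<J. \<bar>h j x\<bar>) \<le> (\<Sum>j. \<bar>h j x\<bar>)"
        using elim by (intro sum_le_suminf) auto
      ultimately show ?case unfolding real_norm_def by linarith
    qed
  qed (use int' int in auto)
  then show "(\<lambda>J. LINT x|M. \<bar>(\<Sum>j. h j x) - (\<Sum>j<J. h j x)\<bar>) \<longlonglongrightarrow> 0" by simp
qed

text \<open>Fatou's lemma for \<open>\<bar>F n x - f x\<bar>\<close> identifies the limit without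
  passing to a subsequence. This matters because (C) asserts only that a limit exists; (B) says
  which one.\<close>

lemma AE_limit_eq_L1_limit:
  fixes F :: "nat \<Rightarrow> 'a \<Rightarrow> real"
  assumes F: "\<And>n. integrable M (F n)" and f: "integrable M f"
    and ae: "AE x in M. convergent (\<lambda>n. F n x)"
    and L1: "(\<lambda>n. LINT x|M. \<bar>F n x - f x\<bar>) \<longlonglongrightarrow> 0"
  shows "AE x in M. (\<lambda>n. F n x) \<longlonglongrightarrow> f x"
proof -
  have [measurable]: "F n \<in> borel_measurable M" "f \<in> borel_measurable M" for n using F f by auto
  have "(\<integral>\<^sup>+x. liminf (\<lambda>n. ennreal \<bar>F n x - f x\<bar>) \<partial>M) \<le> liminf (\<lambda>n. \<integral>\<^sup>+x. ennreal \<bar>F n x - f x\<bar> \<partial>M)"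
    by (intro nn_integral_liminf) auto
  also have "(\<lambda>n. \<integral>\<^sup>+x. ennreal \<bar>F n x - f x\<bar> \<partial>M) = (\<lambda>n. ennreal (LINT x|M. \<bar>F n x - f x\<bar>))"
    using F f by (subst nn_integral_eq_integral) auto
  also have "liminf \<dots> = 0"
    using tendsto_ennrealI[OF L1] by (intro lim_imp_Liminf) auto
  finally have "(\<integral>\<^sup>+x. liminf (\<lambda>n. ennreal \<bar>F n x - f x\<bar>) \<partial>M) = 0" by simp
  then have "AE x in M. liminf (\<lambda>n. ennreal \<bar>F n x - f x\<bar>) = 0"
    by (subst (asm) nn_integral_0_iff_AE) auto
  with ae show ?thesis
  proof eventually_elim
    case (elim x)
    then obtain L where L: "(\<lambda>n. F n x) \<longlonglongrightarrow> L" by (auto simp: convergent_def)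
    then have "(\<lambda>n. ennreal \<bar>F n x - f x\<bar>) \<longlonglongrightarrow> ennreal \<bar>L - f x\<bar>"
      by (intro tendsto_ennrealI tendsto_intros)
    then have "ennreal \<bar>L - f x\<bar> = 0"
      using lim_imp_Liminf[of sequentially] elim by (metis trivial_limit_sequentially)
    then show ?case using L by simp
  qed
qed

section \<open>Dense families in L1(0,1)\<close>

lemma continuous_imp_measurable_unit_leb:
  assumes "continuous_on UNIV (c :: real \<Rightarrow> real)"
  shows "c \<in> borel_measurable unit_leb"
  using assms borel_measurable_continuous_onI[of c]
  by (intro measurable_restrict_space1) (simp add: borel_measurable_continuous_onI measurable_completion)

text \<open>Lebesgue measurability is the same as being an almost everywhere limit of continuous
  functions, and truncation turns such a limit into an \<open>L\<^sup>1\<close> limit.\<close>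

lemma L1_approx_continuous:
  fixes f :: "real \<Rightarrow> real"
  assumes f: "integrable unit_leb f" and e: "e > 0"
  obtains c where "continuous_on UNIV c" "(LINT x|unit_leb. \<bar>f x - c x\<bar>) < e"
proof -
  have fm [measurable]: "f \<in> borel_measurable unit_leb" using f by auto
  define T where "T n x = max (- real n) (min (real n) (f x))" for n x
  have [measurable]: "T n \<in> borel_measurable unit_leb" for n unfolding T_def by simp
  have Tb: "\<bar>T n x\<bar> \<le> real n" for n x unfolding T_def by auto
  have "(\<lambda>n. LINT x|unit_leb. \<bar>f x - T n x\<bar>) \<longlonglongrightarrow> (LINT x|unit_leb. 0)"
  proof (rule integral_dominated_convergence[where w = "\<lambda>x. \<bar>f x\<bar>"])
    show "AE x in unit_leb. (\<lambda>n. \<bar>f x - T n x\<bar>) \<longlonglongrightarrow> 0"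
    proof (rule AE_I2)
      fix x
      obtain N where N: "real N \<ge> \<bar>f x\<bar>" using real_arch_simple by blast
      have "eventually (\<lambda>n. \<bar>f x - T n x\<bar> = 0) sequentially"
        using eventually_ge_at_top[of N] by eventually_elim (use N in \<open>auto simp: T_def\<close>)
      then show "(\<lambda>n. \<bar>f x - T n x\<bar>) \<longlonglongrightarrow> 0" by (rule tendsto_eventually)
    qed
  qed (use f in \<open>auto simp: T_def\<close>)
  then have "eventually (\<lambda>n. (LINT x|unit_leb. \<bar>f x - T n x\<bar>) < e / 2) sequentially"
    using e by (intro order_tendstoD) auto
  then obtain n where n: "(LINT x|unit_leb. \<bar>f x - T n x\<bar>) < e / 2"
    by (auto simp: eventually_sequentially)
  have "T n measurable_on {0<..<1}"
    by (simp add: measurable_on_iff_borel_measurable)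
  then obtain N g where N: "negligible N" and g: "\<And>k. continuous_on UNIV (g k)"
    and lim: "\<And>x. x \<notin> N \<Longrightarrow> (\<lambda>k. g k x) \<longlonglongrightarrow> (if x \<in> {0<..<1} then T n x else 0)"
    unfolding measurable_on_def by metis
  define h where "h k x = max (- real n) (min (real n) (g k x))" for k x
  have hc: "continuous_on UNIV (h k)" for k
    unfolding h_def using g by (intro continuous_intros) auto
  have [measurable]: "h k \<in> borel_measurable unit_leb" for k using hc by (rule continuous_imp_measurable_unit_leb)
  have hb: "\<bar>h k x\<bar> \<le> real n" for k x unfolding h_def by auto
  have "AE x in lebesgue. x \<notin> N"
    using N by (simp add: negligible_iff_null_sets AE_not_in)
  then have ae: "AE x in unit_leb. x \<notin> N"
    by (subst AE_restrict_space_iff) auto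
  have "(\<lambda>k. LINT x|unit_leb. \<bar>T n x - h k x\<bar>) \<longlonglongrightarrow> (LINT x|unit_leb. 0)"
  proof (rule integral_dominated_convergence[where w = "\<lambda>x. 2 * real n"])
    show "AE x in unit_leb. (\<lambda>k. \<bar>T n x - h k x\<bar>) \<longlonglongrightarrow> 0"
      using ae AE_space
    proof eventually_elim
      case (elim x)
      then have "(\<lambda>k. g k x) \<longlonglongrightarrow> T n x" using lim[of x] by simp
      then have "(\<lambda>k. \<bar>T n x - h k x\<bar>) \<longlonglongrightarrow> \<bar>T n x - max (- real n) (min (real n) (T n x))\<bar>"
        unfolding h_def by (intro tendsto_intros)
      then show ?case using Tb[of n x] by (simp add: abs_le_iff max_def min_def split: if_splits)
    qed
    show "AE x in unit_leb. norm \<bar>T n x - h k x\<bar> \<le> 2 * real n" for k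
      using Tb[of n] hb[of k] by (intro AE_I2) (smt (verit) real_norm_def)
  qed auto
  then have "eventually (\<lambda>k. (LINT x|unit_leb. \<bar>T n x - h k x\<bar>) < e / 2) sequentially"
    using e by (intro order_tendstoD) auto
  then obtain k where k: "(LINT x|unit_leb. \<bar>T n x - h k x\<bar>) < e / 2"
    by (auto simp: eventually_sequentially)
  have iT: "integrable unit_leb (T n)" by (rule integrable_unit_leb_bounded[OF _ Tb]) auto
  have ih: "integrable unit_leb (h k)" by (rule integrable_unit_leb_bounded[OF _ hb]) auto
  have "(LINT x|unit_leb. \<bar>f x - h k x\<bar>) = (LINT x|unit_leb. \<bar>(f x - T n x) + (T n x - h k x)\<bar>)"
    by simp
  also have "\<dots> \<le> (LINT x|unit_leb. \<bar>f x - T n x\<bar>) + (LINT x|unit_leb. \<bar>T n x - h k x\<bar>)"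
    using f iT ih by (intro integral_abs_triangle) auto
  also have "\<dots> < e" using n k by simp
  finally show ?thesis using that hc by blast
qed

text \<open>The coefficients form a list, so that the family is indexed by a countable type and
  \<open>from_nat\<close> enumerates it. A list of length n + 1 gives coefficients in the Bernstein
  basis of degree n; the empty list gives some constant, which does no harm.\<close>

definition rat_Bernstein :: "rat list \<Rightarrow> real \<Rightarrow> real" where
  "rat_Bernstein q x = (\<Sum>k\<le>length q - 1. real_of_rat (q ! k) * Bernstein (length q - 1) k x)"

lemma continuous_on_rat_Bernstein: "continuous_on S (rat_Bernstein q)"
  unfolding rat_Bernstein_def Bernstein_def by (intro continuous_intros)

lemma continuous_imp_integrable_unit_leb:
  assumes "continuous_on UNIV (c :: real \<Rightarrow> real)"
  shows "integrable unit_leb c"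
proof -
  have "compact (c ` {0..1})"
    using assms by (intro compact_continuous_image continuous_on_subset[OF assms]) auto
  then obtain A where "\<And>x. x \<in> {0..1} \<Longrightarrow> \<bar>c x\<bar> \<le> A"
    unfolding compact_eq_bounded_closed bounded_iff by (auto simp del: atLeastAtMost_iff)
  then show ?thesis
    by (intro integrable_unit_leb_bounded[of c A] continuous_imp_measurable_unit_leb assms) auto
qed

lemma L1_approx_rat_Bernstein:
  assumes f: "integrable unit_leb f" and e: "e > 0"
  obtains q where "(LINT x|unit_leb. \<bar>f x - rat_Bernstein q x\<bar>) < e"
proof -
  obtain c where c: "continuous_on UNIV c" "(LINT x|unit_leb. \<bar>f x - c x\<bar>) < e / 2"
    using L1_approx_continuous[OF f, of "e / 2"] e by auto
  obtain n where n: "\<And>x. x \<in> {0..1} \<Longrightarrow> \<bar>c x - (\<Sum>k\<le>n. c (real k / real n) * Bernstein n k x)\<bar> < e / 4"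
  proof -
    have "\<exists>N. \<forall>n x. N \<le> n \<and> x \<in> {0..1} \<longrightarrow>
        \<bar>c x - (\<Sum>k\<le>n. c (real k / real n) * Bernstein n k x)\<bar> < e / 4"
      using e by (intro Bernstein_Weierstrass continuous_on_subset[OF c(1)]) auto
    then show ?thesis using that by blast
  qed
  have "\<exists>r. \<bar>c (real k / real n) - real_of_rat r\<bar> < e / 4" for k
  proof -
    obtain r where "c (real k / real n) - e / 4 < real_of_rat r" "real_of_rat r < c (real k / real n) + e / 4"
      using of_rat_dense[of "c (real k / real n) - e / 4" "c (real k / real n) + e / 4"] e by auto
    then show ?thesis by (intro exI[of _ r]) (unfold abs_less_iff, linarith)
  qed
  then obtain r where r: "\<And>k. \<bar>c (real k / real n) - real_of_rat (r k)\<bar> < e / 4" by metis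
  define q where "q = map r [0..<Suc n]"
  have lq: "length q - 1 = n" unfolding q_def by simp
  have b: "\<bar>c x - rat_Bernstein q x\<bar> \<le> e / 2" if x: "x \<in> {0<..<1}" for x
  proof -
    have B: "Bernstein n k x \<ge> 0" for k using x by (auto simp: Bernstein_def)
    have "rat_Bernstein q x = (\<Sum>k\<le>n. real_of_rat (r k) * Bernstein n k x)"
      unfolding rat_Bernstein_def lq
      by (intro sum.cong refl) (simp add: q_def nth_append del: upt_Suc)
    then have "\<bar>(\<Sum>k\<le>n. c (real k / real n) * Bernstein n k x) - rat_Bernstein q x\<bar>
       = \<bar>\<Sum>k\<le>n. (c (real k / real n) - real_of_rat (r k)) * Bernstein n k x\<bar>"
      by (simp add: sum_subtractf algebra_simps)
    also have "\<dots> \<le> (\<Sum>k\<le>n. \<bar>(c (real k / real n) - real_of_rat (r k)) * Bernstein n k x\<bar>)"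
      by (rule sum_abs)
    \<comment> \<open>The Bernstein basis is nonnegative and sums to one on the interval, so
      rounding every coefficient by less than e/4 moves the polynomial by at most e/4.\<close>
    also have "\<dots> \<le> (\<Sum>k\<le>n. e / 4 * Bernstein n k x)"
      by (intro sum_mono, unfold abs_mult abs_of_nonneg[OF B]) (intro mult_right_mono B less_imp_le[OF r])
    also have "\<dots> = e / 4" by (simp only: sum_distrib_left[symmetric] sum_Bernstein mult_1_right)
    finally have "\<bar>(\<Sum>k\<le>n. c (real k / real n) * Bernstein n k x) - rat_Bernstein q x\<bar> \<le> e / 4" .
    moreover have "\<bar>c x - (\<Sum>k\<le>n. c (real k / real n) * Bernstein n k x)\<bar> < e / 4"
      using x by (intro n) simp
    ultimately show ?thesis by linarith
  qed
  have iB: "integrable unit_leb (rat_Bernstein q)"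
    by (intro continuous_imp_integrable_unit_leb continuous_on_rat_Bernstein)
  have ic: "integrable unit_leb c"
    by (intro continuous_imp_integrable_unit_leb c)
  have "(LINT x|unit_leb. \<bar>f x - rat_Bernstein q x\<bar>)
      = (LINT x|unit_leb. \<bar>(f x - c x) + (c x - rat_Bernstein q x)\<bar>)" by simp
  also have "\<dots> \<le> (LINT x|unit_leb. \<bar>f x - c x\<bar>) + (LINT x|unit_leb. \<bar>c x - rat_Bernstein q x\<bar>)"
    using f iB ic by (intro integral_abs_triangle) auto
  also have "(LINT x|unit_leb. \<bar>c x - rat_Bernstein q x\<bar>) \<le> e / 2"
    using b iB ic by (intro unit_leb_integral_abs_le_const) auto
  finally have "(LINT x|unit_leb. \<bar>f x - rat_Bernstein q x\<bar>) < e" using c(2) by linarith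
  then show ?thesis by (rule that)
qed

section \<open>Uniform grids and evenly spread sets\<close>

lemma indicat_measurable_unit_leb:
  assumes "S \<in> sets lebesgue"
  shows "indicat_real S \<in> borel_measurable unit_leb"
  using assms by (intro measurable_restrict_space1) simp

lemma integrable_indicat_unit_leb:
  assumes "S \<in> sets lebesgue"
  shows "integrable unit_leb (indicat_real S)"
  using assms by (intro integrable_unit_leb_bounded[where A=1] indicat_measurable_unit_leb)
    (auto simp: indicator_def)

lemma integral_indicat_unit_leb:
  assumes S: "S \<in> sets lebesgue" "S \<subseteq> {0..<1}"
  shows "(LINT x|unit_leb. indicat_real S x) = measure lebesgue S"
proof -
  have "(LINT x|unit_leb. indicat_real S x) = (LINT x|lebesgue. indicat_real {0<..<1} x *\<^sub>R indicat_real S x)"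
    by (subst integral_restrict_space) auto
  also have "\<dots> = (LINT x|lebesgue. indicat_real S x)"
  proof (rule integral_cong_AE)
    \<comment> \<open>\<open>S\<close> may contain 0, which lies outside the open interval but is a
      null set.\<close>
    have "AE x in lebesgue. x \<notin> {0::real}"
      by (intro AE_not_in) (simp add: null_sets_completionI)
    then show "AE x in lebesgue. indicat_real {0<..<1} x *\<^sub>R indicat_real S x = indicat_real S x"
      using S by (auto elim!: eventually_mono simp: indicator_def)
  qed (use S in \<open>auto intro!: borel_measurable_scaleR borel_measurable_indicator simp del: real_scaleR_def\<close>)
  also have "\<dots> = measure lebesgue S" by simp
  finally show ?thesis .
qed

definition grid_cell :: "nat \<Rightarrow> nat \<Rightarrow> real set" where
  "grid_cell m j = {real j / real m ..< (real j + 1) / real m}"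

lemma grid_cell_iff:
  assumes "m > 0" "0 \<le> x"
  shows "x \<in> grid_cell m j \<longleftrightarrow> j = nat \<lfloor>x * real m\<rfloor>"
proof -
  have "x \<in> grid_cell m j \<longleftrightarrow> real j \<le> x * real m \<and> x * real m < real j + 1"
    using assms by (simp add: grid_cell_def divide_simps)
  also have "\<dots> \<longleftrightarrow> \<lfloor>x * real m\<rfloor> = int j"
    by (simp add: floor_eq_iff)
  also have "\<dots> \<longleftrightarrow> j = nat \<lfloor>x * real m\<rfloor>"
    using assms by auto
  finally show ?thesis .
qed

lemma grid_cell_subset:
  assumes "j < m"
  shows "grid_cell m j \<subseteq> {0..<1}"
proof -
  have "(real j + 1) / real m \<le> 1" using assms by (simp add: divide_simps)
  moreover have "real j / real m \<ge> 0" by simp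
  ultimately show ?thesis unfolding grid_cell_def by auto
qed

lemma is_interval01_grid_cell:
  assumes "j < m"
  shows "is_interval01 (grid_cell m j)"
  unfolding is_interval01_def grid_cell_def using assms
  by (intro exI[of _ "real j / real m"] exI[of _ "(real j + 1) / real m"]) (auto simp: divide_simps)

lemma sets_grid_cell [measurable]: "grid_cell m j \<in> sets lebesgue"
  unfolding grid_cell_def by simp

lemma measure_grid_cell:
  assumes "m > 0"
  shows "measure lebesgue (grid_cell m j) = 1 / real m"
  using assms unfolding grid_cell_def by (simp add: divide_simps)

lemma sum_grid_cell:
  fixes F :: "nat \<Rightarrow> real"
  assumes "m > 0" "0 \<le> x" "x < 1"
  shows "(\<Sum>j<m. F j * indicat_real (grid_cell m j) x) = F (nat \<lfloor>x * real m\<rfloor>)"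
    and "nat \<lfloor>x * real m\<rfloor> < m"
proof -
  have "x * real m < real m" using assms by simp
  then show lt: "nat \<lfloor>x * real m\<rfloor> < m" using assms by (simp add: nat_less_iff floor_less_iff)
  have "(\<Sum>j<m. F j * indicat_real (grid_cell m j) x)
      = (\<Sum>j<m. if j = nat \<lfloor>x * real m\<rfloor> then F j else 0)"
    using assms by (intro sum.cong refl) (simp add: indicator_def grid_cell_iff)
  then show "(\<Sum>j<m. F j * indicat_real (grid_cell m j) x) = F (nat \<lfloor>x * real m\<rfloor>)"
    using lt by simp
qed

lemma continuous_grid_approx:
  fixes c :: "real \<Rightarrow> real"
  assumes c: "continuous_on UNIV c" and "e > 0"
  shows "\<exists>m0>0. \<forall>m\<ge>m0. \<forall>x. 0 \<le> x \<longrightarrow> x < 1 \<longrightarrow>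
     \<bar>c x - (\<Sum>j<m. c (real j / real m) * indicat_real (grid_cell m j) x)\<bar> \<le> e"
proof -
  have "uniformly_continuous_on {0..1} c"
    by (intro compact_uniformly_continuous continuous_on_subset[OF c]) auto
  then obtain d where d: "d > 0"
    "\<And>x y. x \<in> {0..1} \<Longrightarrow> y \<in> {0..1} \<Longrightarrow> dist y x < d \<Longrightarrow> dist (c y) (c x) < e"
    using \<open>e > 0\<close> unfolding uniformly_continuous_on_def by metis
  obtain m0 where m0: "1 / d < real m0" using reals_Archimedean2 by blast
  have "0 < 1 / d" using d by simp
  then have m0p: "m0 > 0" using m0 by (metis less_trans of_nat_0_less_iff)
  have "\<bar>c x - (\<Sum>j<m. c (real j / real m) * indicat_real (grid_cell m j) x)\<bar> \<le> e"
    if m: "m \<ge> m0" and x: "0 \<le> x" "x < 1" for m x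
  proof -
    have mp: "m > 0" using m m0p by simp
    define j where "j = nat \<lfloor>x * real m\<rfloor>"
    have j: "j < m" unfolding j_def using sum_grid_cell(2)[OF mp x] .
    have cell: "x \<in> grid_cell m j" using grid_cell_iff[OF mp x(1)] j_def by simp
    have "1 / real m \<le> 1 / real m0" using m m0p by (simp add: frac_le)
    also have "\<dots> < d" using m0 d m0p by (simp add: field_simps)
    finally have md: "1 / real m < d" .
    have "real j / real m \<le> x" "x < real j / real m + 1 / real m"
      using cell unfolding grid_cell_def by (auto simp: add_divide_distrib)
    then have "dist x (real j / real m) < d" using md by (auto simp: dist_real_def)
    moreover have "real j / real m \<in> {0..1}" using j by (auto simp: divide_simps)
    ultimately have "dist (c x) (c (real j / real m)) < e" using x by (intro d) auto
    then show ?thesis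
      using sum_grid_cell(1)[OF mp x, of "\<lambda>j. c (real j / real m)"] j_def by (simp add: dist_real_def)
  qed
  then show ?thesis using m0p by blast
qed

text \<open>The left fraction \<open>e\<close> of every cell. In the half of the theorem without (D)
  these explicit sets stand in for the sets \<open>G l\<close>: they have density exactly
  \<open>e\<close> in each cell of their grid, hence spread out evenly as the grid is
  refined.\<close>

definition grid_set :: "real \<Rightarrow> nat \<Rightarrow> real set" where
  "grid_set e m = (\<Union>j<m. {real j / real m ..< (real j + e) / real m})"

lemma grid_set_cell:
  assumes "0 < e" "e < 1" "j < m"
  shows "grid_set e m \<inter> grid_cell m j = {real j / real m ..< (real j + e) / real m}"
proof -
  have mp: "m > 0" using assms by simp
  have sub: "{real i / real m ..< (real i + e) / real m} \<subseteq> grid_cell m i" for i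
  proof -
    have "(real i + e) / real m \<le> (real i + 1) / real m"
      using assms by (intro divide_right_mono) auto
    then show ?thesis unfolding grid_cell_def by auto
  qed
  have "i = j" if "x \<in> {real i / real m ..< (real i + e) / real m}" "x \<in> grid_cell m j" for i x
  proof -
    have "0 \<le> x" using that(1) by (auto intro: order_trans[of 0 "real i / real m"])
    moreover have "x \<in> grid_cell m i" using that(1) sub by blast
    ultimately show ?thesis using that(2) grid_cell_iff[OF mp, of x] by simp
  qed
  then show ?thesis using sub assms unfolding grid_set_def by blast
qed

lemma finite_interval_set_sets:
  assumes "finite_interval_set S"
  shows "S \<in> sets lebesgue" "S \<subseteq> {0..<1}"
proof -
  obtain \<D> where D: "finite \<D>" "\<And>I. I \<in> \<D> \<Longrightarrow> is_interval01 I" "S = \<Union>\<D>"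
    using assms unfolding finite_interval_set_def by blast
  have "I \<in> sets lebesgue \<and> I \<subseteq> {0..<1}" if "I \<in> \<D>" for I
    using D(2)[OF that] unfolding is_interval01_def by auto
  then show "S \<in> sets lebesgue" "S \<subseteq> {0..<1}" using D by auto
qed

lemma finite_interval_set_grid_set:
  assumes "0 < e" "e < 1"
  shows "finite_interval_set (grid_set e m)"
  unfolding finite_interval_set_def grid_set_def
proof (intro exI conjI ballI)
  fix D assume "D \<in> (\<lambda>j. {real j / real m ..< (real j + e) / real m}) ` {..<m}"
  then obtain j where j: "j < m" "D = {real j / real m ..< (real j + e) / real m}" by auto
  then show "is_interval01 D"
    unfolding is_interval01_def using assms
    by (intro exI[of _ "real j / real m"] exI[of _ "(real j + e) / real m"]) (auto simp: divide_simps)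
qed auto

lemma integral_mult_grid_sum:
  assumes f: "f \<in> borel_measurable unit_leb" "\<And>x. x \<in> {0<..<1} \<Longrightarrow> \<bar>f x\<bar> \<le> A"
  shows "(LINT x|unit_leb. f x * (\<Sum>j<m. a j * indicat_real (grid_cell m j) x))
       = (\<Sum>j<m. a j * (LINT x|unit_leb. f x * indicat_real (grid_cell m j) x))"
proof -
  have [measurable]: "indicat_real (grid_cell m j) \<in> borel_measurable unit_leb" for j
    by (intro indicat_measurable_unit_leb) auto
  have int: "integrable unit_leb (\<lambda>x. f x * indicat_real (grid_cell m j) x)" for j
  proof (rule integrable_unit_leb_bounded[where A = A])
    show "\<bar>f x * indicat_real (grid_cell m j) x\<bar> \<le> A" if "x \<in> {0<..<1}" for x
      using f(2)[OF that] by (auto simp: indicator_def)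
  qed (use f(1) in measurable)
  have "(LINT x|unit_leb. f x * (\<Sum>j<m. a j * indicat_real (grid_cell m j) x))
      = (LINT x|unit_leb. (\<Sum>j<m. a j * (f x * indicat_real (grid_cell m j) x)))"
    unfolding sum_distrib_left by (simp only: mult.left_commute)
  also have "\<dots> = (\<Sum>j<m. LINT x|unit_leb. a j * (f x * indicat_real (grid_cell m j) x))"
    using int by (intro Bochner_Integration.integral_sum) auto
  also have "\<dots> = (\<Sum>j<m. a j * (LINT x|unit_leb. f x * indicat_real (grid_cell m j) x))"
    by simp
  finally show ?thesis .
qed

lemma measure_grid_set:
  assumes "0 < e" "e < 1" "m > 0"
  shows "measure lebesgue (grid_set e m) = e"
proof -
  have S: "grid_set e m \<in> sets lebesgue" "grid_set e m \<subseteq> {0..<1}"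
    using finite_interval_set_sets[OF finite_interval_set_grid_set[OF assms(1,2)]] by auto
  have "measure lebesgue (grid_set e m) = (LINT x|unit_leb. indicat_real (grid_set e m) x)"
    by (rule integral_indicat_unit_leb[OF S, symmetric])
  also have "\<dots> = (LINT x|unit_leb. indicat_real (grid_set e m) x * (\<Sum>j<m. 1 * indicat_real (grid_cell m j) x))"
    using assms sum_grid_cell(1)[of m _ "\<lambda>_. 1"] by (intro Bochner_Integration.integral_cong) auto
  also have "\<dots> = (\<Sum>j<m. 1 * (LINT x|unit_leb. indicat_real (grid_set e m) x * indicat_real (grid_cell m j) x))"
    by (intro integral_mult_grid_sum[where A=1] indicat_measurable_unit_leb S) (auto simp: indicator_def)
  also have "\<dots> = (\<Sum>j<m. e / real m)"
  proof (intro sum.cong refl)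
    fix j assume "j \<in> {..<m}"
    then have j: "j < m" by simp
    have "(LINT x|unit_leb. indicat_real (grid_set e m) x * indicat_real (grid_cell m j) x)
        = (LINT x|unit_leb. indicat_real (grid_set e m \<inter> grid_cell m j) x)"
      by (simp add: indicator_inter_arith)
    also have "\<dots> = measure lebesgue (grid_set e m \<inter> grid_cell m j)"
      using S by (intro integral_indicat_unit_leb) auto
    also have "\<dots> = e / real m"
      using assms unfolding grid_set_cell[OF assms(1,2) j] by (simp add: divide_simps)
    finally show "1 * (LINT x|unit_leb. indicat_real (grid_set e m) x * indicat_real (grid_cell m j) x) = e / real m"
      by simp
  qed
  also have "\<dots> = e" using assms by simp
  finally show ?thesis .
qed

text \<open>The set fills the fraction \<open>e\<close> of each cell and the division by
  \<open>e\<close> compensates exactly. So the first factor is orthogonal to every step function of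
  the grid, which is the heart of the weak convergence below.\<close>

lemma grid_set_balanced:
  assumes e: "0 < e" "e < 1" and j: "j < m"
  shows "(LINT x|unit_leb. (indicat_real (grid_set e m) x / e - 1) * indicat_real (grid_cell m j) x) = 0"
proof -
  have S: "grid_set e m \<in> sets lebesgue"
    using finite_interval_set_sets[OF finite_interval_set_grid_set[OF e]] by auto
  have sub: "grid_cell m j \<subseteq> {0..<1}" using grid_cell_subset[OF j] .
  have "(LINT x|unit_leb. (indicat_real (grid_set e m) x / e - 1) * indicat_real (grid_cell m j) x)
      = (LINT x|unit_leb. indicat_real (grid_set e m \<inter> grid_cell m j) x / e - indicat_real (grid_cell m j) x)"
    by (simp add: indicator_inter_arith algebra_simps)
  also have "\<dots> = (LINT x|unit_leb. indicat_real (grid_set e m \<inter> grid_cell m j) x / e)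
        - (LINT x|unit_leb. indicat_real (grid_cell m j) x)"
    using S by (intro Bochner_Integration.integral_diff integrable_divide_zero integrable_indicat_unit_leb) auto
  also have "\<dots> = measure lebesgue (grid_set e m \<inter> grid_cell m j) / e - measure lebesgue (grid_cell m j)"
    using S sub by (subst (1 2) integral_indicat_unit_leb[symmetric]) auto
  also have "\<dots> = 0"
    using e j by (subst grid_set_cell[OF e j]) (simp add: grid_cell_def divide_simps)
  finally show ?thesis .
qed

section \<open>Bounded functions and weak convergence\<close>

lemma Linf_space_iff:
  "f \<in> Linf_space \<longleftrightarrow> f \<in> borel_measurable unit_leb \<and> (\<exists>C. AE x in unit_leb. \<bar>f x\<bar> \<le> C)"
proof (cases "f \<in> borel_measurable unit_leb")
  case True
  have "Linf_norm f < \<infinity> \<longleftrightarrow> (\<exists>C. AE x in unit_leb. \<bar>f x\<bar> \<le> C)"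
  proof
    assume *: "Linf_norm f < \<infinity>"
    have ae: "AE x in unit_leb. ereal \<bar>f x\<bar> \<le> Linf_norm f"
      unfolding Linf_norm_def by (rule esssup_AE)
    have "\<exists>C. Linf_norm f \<le> ereal C"
      using * by (cases "Linf_norm f") auto
    then obtain C where "Linf_norm f \<le> ereal C" by blast
    with ae have "AE x in unit_leb. \<bar>f x\<bar> \<le> C"
      by (auto elim!: eventually_mono dest: order_trans)
    then show "\<exists>C. AE x in unit_leb. \<bar>f x\<bar> \<le> C" by blast
  next
    assume "\<exists>C. AE x in unit_leb. \<bar>f x\<bar> \<le> C"
    then obtain C where "AE x in unit_leb. \<bar>f x\<bar> \<le> C" by blast
    then have "Linf_norm f \<le> ereal C"
      unfolding Linf_norm_def using True by (intro esssup_I) auto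
    then show "Linf_norm f < \<infinity>" by (auto elim: order_le_less_trans)
  qed
  then show ?thesis using True unfolding Linf_space_def by simp
qed (simp add: Linf_space_def)

lemma Linf_space_integrable:
  assumes "f \<in> Linf_space"
  shows "integrable unit_leb f"
  using assms unit_leb.integrable_const_bound[of f] by (auto simp: Linf_space_iff)

text \<open>The functions \<open>\<phi> m\<close> are bounded by 1/e and orthogonal to the step
  functions of mesh 1/m. Every test function is L1-close to such step functions for all large m:
  pass to a continuous function, then use uniform continuity.\<close>

lemma weakly_converges_grid_set:
  assumes e: "0 < e" "e < 1"
  shows "weakly_converges (\<lambda>l x. indicat_real (grid_set e (Suc l)) x / measure lebesgue (grid_set e (Suc l)))
           (indicat_real {0..<1})"
  unfolding weakly_converges_def Lp_space_1
proof (intro conjI allI ballI)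
  have S: "grid_set e m \<in> sets lebesgue" for m
    using finite_interval_set_sets[OF finite_interval_set_grid_set[OF e]] by auto
  show "integrable unit_leb (\<lambda>x. indicat_real (grid_set e (Suc l)) x / measure lebesgue (grid_set e (Suc l)))" for l
    by (intro integrable_divide_zero integrable_indicat_unit_leb S)
  show "integrable unit_leb (indicat_real {0..<1})" by (intro integrable_indicat_unit_leb) auto
  fix h assume "h \<in> Linf_space"
  then have h: "integrable unit_leb h" by (rule Linf_space_integrable)
  define \<phi> where "\<phi> m x = indicat_real (grid_set e m) x / e - 1" for m x
  have [measurable]: "\<phi> m \<in> borel_measurable unit_leb" for m
    unfolding \<phi>_def by (intro borel_measurable_diff borel_measurable_divide indicat_measurable_unit_leb S) auto
  have \<phi>b: "\<bar>\<phi> m x\<bar> \<le> 1 / e" for m x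
    unfolding \<phi>_def using e by (auto simp: indicator_def abs_if divide_simps)
  have int: "integrable unit_leb (\<lambda>x. \<phi> m x * u x)" if "integrable unit_leb u" for m u
  proof (rule Bochner_Integration.integrable_bound[OF integrable_mult_right[OF that, of "1/e"]])
    show "AE x in unit_leb. norm (\<phi> m x * u x) \<le> norm (1 / e * u x)"
      using \<phi>b e by (intro AE_I2, unfold real_norm_def abs_mult) (intro mult_right_mono, auto)
  qed (use that in auto)
  have ib: "\<bar>LINT x|unit_leb. \<phi> m x * u x\<bar> \<le> (LINT x|unit_leb. \<bar>u x\<bar>) / e" if "integrable unit_leb u" for m u
  proof -
    have "\<bar>LINT x|unit_leb. \<phi> m x * u x\<bar> \<le> (LINT x|unit_leb. \<bar>\<phi> m x * u x\<bar>)"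
      by (rule integral_abs_bound)
    also have "\<dots> \<le> (LINT x|unit_leb. (1/e) * \<bar>u x\<bar>)"
    proof (rule integral_mono)
      show "\<bar>\<phi> m x * u x\<bar> \<le> 1 / e * \<bar>u x\<bar>" for x
        unfolding abs_mult by (intro mult_right_mono \<phi>b) simp
    qed (use int[OF that] that in \<open>auto simp del: abs_mult\<close>)
    finally show ?thesis by simp
  qed
  have "(\<lambda>m. LINT x|unit_leb. \<phi> m x * h x) \<longlonglongrightarrow> 0"
  proof (rule LIMSEQ_I)
    fix r :: real assume r: "r > 0"
    \<comment> \<open>Both approximation errors are divided by \<open>e\<close> when they pass
      through \<open>ib\<close>, leaving r/4 + r/4 < r.\<close>
    then have re: "r * e / 4 > 0" using e by simp
    obtain c where c: "continuous_on UNIV c" "(LINT x|unit_leb. \<bar>h x - c x\<bar>) < r * e / 4"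
      using L1_approx_continuous[OF h re] .
    have ic: "integrable unit_leb c" using c by (intro continuous_imp_integrable_unit_leb)
    obtain m0 where m0: "m0 > 0" "\<And>m x. m \<ge> m0 \<Longrightarrow> 0 \<le> x \<Longrightarrow> x < 1 \<Longrightarrow>
       \<bar>c x - (\<Sum>j<m. c (real j / real m) * indicat_real (grid_cell m j) x)\<bar> \<le> r * e / 4"
      using continuous_grid_approx[OF c(1) re] by blast
    show "\<exists>no. \<forall>m\<ge>no. norm ((LINT x|unit_leb. \<phi> m x * h x) - 0) < r"
    proof (intro exI[of _ m0] allI impI)
      fix m assume m: "m \<ge> m0"
      define s where "s x = (\<Sum>j<m. c (real j / real m) * indicat_real (grid_cell m j) x)" for x
      have ints: "integrable unit_leb s"
        unfolding s_def by (intro Bochner_Integration.integrable_sum integrable_mult_right integrable_indicat_unit_leb) auto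
      have "(LINT x|unit_leb. \<phi> m x * s x)
         = (\<Sum>j<m. c (real j / real m) * (LINT x|unit_leb. \<phi> m x * indicat_real (grid_cell m j) x))"
        unfolding s_def by (intro integral_mult_grid_sum[where A="1/e"] \<phi>b) auto
      also have "\<dots> = 0"
        using grid_set_balanced[OF e] unfolding \<phi>_def by (intro sum.neutral) auto
      finally have s0: "(LINT x|unit_leb. \<phi> m x * s x) = 0" .
      have "(LINT x|unit_leb. \<phi> m x * h x) = (LINT x|unit_leb. \<phi> m x * (h x - c x) + \<phi> m x * (c x - s x) + \<phi> m x * s x)"
        by (simp add: algebra_simps)
      also have "\<dots> = (LINT x|unit_leb. \<phi> m x * (h x - c x)) + (LINT x|unit_leb. \<phi> m x * (c x - s x)) + 0"
        using int h ic ints s0 by (simp del: right_diff_distrib' )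
      finally have "\<bar>LINT x|unit_leb. \<phi> m x * h x\<bar> \<le>
         \<bar>LINT x|unit_leb. \<phi> m x * (h x - c x)\<bar> + \<bar>LINT x|unit_leb. \<phi> m x * (c x - s x)\<bar>" by linarith
      also have "\<dots> \<le> (LINT x|unit_leb. \<bar>h x - c x\<bar>) / e + (LINT x|unit_leb. \<bar>c x - s x\<bar>) / e"
        using h ic ints by (intro add_mono ib) auto
      also have "\<dots> \<le> (r * e / 4) / e + (r * e / 4) / e"
      proof (intro add_mono divide_right_mono)
        show "(LINT x|unit_leb. \<bar>c x - s x\<bar>) \<le> r * e / 4"
          using m0(2)[OF m] ic ints unfolding s_def[symmetric]
          by (intro unit_leb_integral_abs_le_const) auto
      qed (use c(2) e in auto)
      also have "\<dots> < r" using e r by simp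
      finally show "norm ((LINT x|unit_leb. \<phi> m x * h x) - 0) < r" by simp
    qed
  qed
  then have "(\<lambda>l. (LINT x|unit_leb. \<phi> (Suc l) x * h x) + (LINT x|unit_leb. h x)) \<longlonglongrightarrow> 0 + (LINT x|unit_leb. h x)"
    by (intro tendsto_add tendsto_const) (rule LIMSEQ_Suc)
  moreover have "(LINT x|unit_leb. \<phi> (Suc l) x * h x) + (LINT x|unit_leb. h x)
     = (LINT x|unit_leb. indicat_real (grid_set e (Suc l)) x / measure lebesgue (grid_set e (Suc l)) * h x)" for l
    using int[OF h] h
    by (subst Bochner_Integration.integral_add[symmetric]) (auto simp: measure_grid_set[OF e] \<phi>_def algebra_simps)
  moreover have "(LINT x|unit_leb. indicat_real {0..<1} x * h x) = (LINT x|unit_leb. h x)"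
    by (intro Bochner_Integration.integral_cong) auto
  ultimately show "(\<lambda>l. LINT x|unit_leb. indicat_real (grid_set e (Suc l)) x / measure lebesgue (grid_set e (Suc l)) * h x)
      \<longlonglongrightarrow> (LINT x|unit_leb. indicat_real {0..<1} x * h x)" by simp
qed

text \<open>Egorov's theorem as a tail estimate: the sets decrease in \<open>N\<close>, a point in
  all of them would violate convergence, and a finite measure is continuous from above.\<close>

lemma tail_measure_tendsto_0:
  fixes F :: "nat \<Rightarrow> 'a \<Rightarrow> real"
  assumes "finite_measure M" and F [measurable]: "\<And>n. F n \<in> borel_measurable M"
    and ae: "AE x in M. (\<lambda>n. F n x) \<longlonglongrightarrow> 0" and e: "e > 0"
  shows "(\<lambda>N. measure M {x \<in> space M. \<exists>n\<ge>N. \<bar>F n x\<bar> > e}) \<longlonglongrightarrow> 0"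
proof -
  interpret finite_measure M by fact
  define B where "B N = {x \<in> space M. \<exists>n\<ge>N. \<bar>F n x\<bar> > e}" for N
  have [measurable]: "B N \<in> sets M" for N unfolding B_def by measurable
  have "decseq B" unfolding B_def decseq_def by (auto intro: order_trans)
  then have "(\<lambda>N. measure M (B N)) \<longlonglongrightarrow> measure M (\<Inter>N. B N)"
    by (intro finite_Lim_measure_decseq) auto
  moreover have "AE x in M. x \<notin> (\<Inter>N. B N)"
    using ae
  proof eventually_elim
    case (elim x)
    then obtain N where "\<forall>n\<ge>N. norm (F n x - 0) < e"
      using e LIMSEQ_D by blast
    then have "x \<notin> B N" unfolding B_def by force
    then show ?case by blast
  qed
  then have "measure M (\<Inter>N. B N) = 0"
    by (intro measure_eq_0_null_sets) (subst AE_iff_null_sets, auto)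
  ultimately show ?thesis unfolding B_def by simp
qed

text \<open>The bound holds at every point of the interval and not just almost everywhere, so that
  functions can be altered by case distinctions at points; a limit is brought back into the class by
  truncation.\<close>

definition bounded_on_unit :: "real \<Rightarrow> (real \<Rightarrow> real) \<Rightarrow> bool" where
  "bounded_on_unit A f \<longleftrightarrow> f \<in> borel_measurable unit_leb \<and> (\<forall>x\<in>{0<..<1}. \<bar>f x\<bar> \<le> A)"

lemma bounded_on_unit_integrable: "bounded_on_unit A f \<Longrightarrow> integrable unit_leb f"
  unfolding bounded_on_unit_def by (auto intro: integrable_unit_leb_bounded)

lemma bounded_on_unit_add:
  "bounded_on_unit A f \<Longrightarrow> bounded_on_unit B g \<Longrightarrow> bounded_on_unit (A + B) (\<lambda>x. f x + g x)"
  unfolding bounded_on_unit_def by (fastforce intro: order_trans[OF abs_triangle_ineq])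

lemma bounded_on_unit_sum:
  assumes "finite I" "\<And>i. i \<in> I \<Longrightarrow> bounded_on_unit (A i) (f i)"
  shows "bounded_on_unit (\<Sum>i\<in>I. A i) (\<lambda>x. \<Sum>i\<in>I. f i x)"
  using assms
proof (induction I rule: finite_induct)
  case empty
  then show ?case by (simp add: bounded_on_unit_def)
next
  case (insert i I)
  then show ?case using bounded_on_unit_add[of "A i" "f i"] by simp
qed

lemma bounded_on_unit_indicat: "S \<in> sets lebesgue \<Longrightarrow> bounded_on_unit 1 (indicat_real S)"
  unfolding bounded_on_unit_def by (auto intro!: indicat_measurable_unit_leb simp: indicator_def)

section \<open>Approximating sequences of compact operators\<close>

text \<open>(B) enters as \<open>L1_conv\<close>: bounded functions lie in Lp, and on a finite
  measure space convergence in Lp implies convergence in L1. In this form no exponent occurs, and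
  the functions with a given bound are complete in the L1 metric, as the category argument
  requires.\<close>

locale compact_approximation =
  fixes U :: "nat \<Rightarrow> (real \<Rightarrow> real) \<Rightarrow> real \<Rightarrow> real"
  assumes bounded_op: "\<And>n. bounded_op_L1_Linf (U n)"
    and prop_A: "prop_A U"
    and L1_conv: "\<And>A f. bounded_on_unit A f \<Longrightarrow> (\<lambda>n. LINT x|unit_leb. \<bar>U n f x - f x\<bar>) \<longlonglongrightarrow> 0"
begin

lemma U_Linf:
  assumes "integrable unit_leb f"
  shows "U n f \<in> Linf_space"
  using bounded_op[of n] assms[folded Lp_space_1] unfolding bounded_op_L1_Linf_def by blast

lemma U_integrable:
  assumes "integrable unit_leb f"
  shows "integrable unit_leb (U n f)"
  using U_Linf[OF assms] by (rule Linf_space_integrable)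

lemma U_measurable:
  assumes "integrable unit_leb f"
  shows "U n f \<in> borel_measurable unit_leb"
  using U_integrable[OF assms] by auto

lemma U_add:
  assumes "integrable unit_leb f" "integrable unit_leb g"
  shows "AE x in unit_leb. U n (\<lambda>t. f t + g t) x = U n f x + U n g x"
  using bounded_op[of n] assms[folded Lp_space_1] unfolding bounded_op_L1_Linf_def linear_on_L1_def by blast

lemma U_cmult:
  assumes "integrable unit_leb f"
  shows "AE x in unit_leb. U n (\<lambda>t. c * f t) x = c * U n f x"
  using bounded_op[of n] assms[folded Lp_space_1] unfolding bounded_op_L1_Linf_def linear_on_L1_def by blast

lemma U_diff:
  assumes "integrable unit_leb f" "integrable unit_leb g"
  shows "AE x in unit_leb. U n (\<lambda>t. f t - g t) x = U n f x - U n g x"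
proof -
  have "AE x in unit_leb. U n (\<lambda>t. f t + (-1) * g t) x = U n f x + U n (\<lambda>t. (-1) * g t) x"
    using assms by (intro U_add) auto
  moreover have "AE x in unit_leb. U n (\<lambda>t. (-1) * g t) x = (-1) * U n g x"
    using assms by (intro U_cmult)
  ultimately show ?thesis by eventually_elim simp
qed

lemma U_sum:
  assumes "finite I" "\<And>i. i \<in> I \<Longrightarrow> integrable unit_leb (f i)"
  shows "AE x in unit_leb. U n (\<lambda>t. \<Sum>i\<in>I. f i t) x = (\<Sum>i\<in>I. U n (f i) x)"
  using assms
proof (induction I rule: finite_induct)
  case empty
  have "AE x in unit_leb. U n (\<lambda>t. 0 * (0::real)) x = 0 * U n (\<lambda>t. 0) x"
    by (rule U_cmult) simp
  then show ?case by simp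
next
  case (insert i I)
  have "AE x in unit_leb. U n (\<lambda>t. f i t + (\<Sum>i\<in>I. f i t)) x = U n (f i) x + U n (\<lambda>t. \<Sum>i\<in>I. f i t) x"
    using insert.prems by (intro U_add) auto
  moreover have "AE x in unit_leb. U n (\<lambda>t. \<Sum>i\<in>I. f i t) x = (\<Sum>i\<in>I. U n (f i) x)"
    using insert by auto
  ultimately show ?case
    by eventually_elim (use insert.hyps in simp)
qed

text \<open>The constant depends on \<open>n\<close>. Bounds uniform in \<open>n\<close> come from
  \<open>uniform_L1_small\<close> and \<open>correction\<close>.\<close>

lemma U_Linf_bound:
  obtains C where "C \<ge> 0"
    "\<And>f. integrable unit_leb f \<Longrightarrow> AE x in unit_leb. \<bar>U n f x\<bar> \<le> C * (LINT x|unit_leb. \<bar>f x\<bar>)"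
proof -
  obtain C where C: "\<forall>f\<in>Lp_space 1. Linf_norm (U n f) \<le> ereal (C * Lp_norm 1 f)"
    using bounded_op[of n] unfolding bounded_op_L1_Linf_def by blast
  have "AE x in unit_leb. \<bar>U n f x\<bar> \<le> \<bar>C\<bar> * (LINT x|unit_leb. \<bar>f x\<bar>)" if f: "integrable unit_leb f" for f
  proof -
    have "AE x in unit_leb. ereal \<bar>U n f x\<bar> \<le> Linf_norm (U n f)"
      unfolding Linf_norm_def by (rule esssup_AE)
    moreover have "Linf_norm (U n f) \<le> ereal (C * (LINT x|unit_leb. \<bar>f x\<bar>))"
      using C f by (simp add: Lp_space_1 Lp_norm_1)
    moreover have "C * (LINT x|unit_leb. \<bar>f x\<bar>) \<le> \<bar>C\<bar> * (LINT x|unit_leb. \<bar>f x\<bar>)"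
      by (intro mult_right_mono integral_nonneg_AE) auto
    ultimately show ?thesis
    proof (elim eventually_mono)
      fix x assume "ereal \<bar>U n f x\<bar> \<le> Linf_norm (U n f)"
      then have "ereal \<bar>U n f x\<bar> \<le> ereal (C * (LINT x|unit_leb. \<bar>f x\<bar>))"
        using \<open>Linf_norm (U n f) \<le> _\<close> by (rule order_trans)
      then show "\<bar>U n f x\<bar> \<le> \<bar>C\<bar> * (LINT x|unit_leb. \<bar>f x\<bar>)"
        using \<open>C * _ \<le> _\<close> by simp
    qed
  qed
  then show ?thesis by (intro that[of "\<bar>C\<bar>"]) auto
qed

lemma U_L1_bound:
  obtains C where "C \<ge> 0"
    "\<And>f. integrable unit_leb f \<Longrightarrow> (LINT x|unit_leb. \<bar>U n f x\<bar>) \<le> C * (LINT x|unit_leb. \<bar>f x\<bar>)"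
proof -
  obtain C where C: "C \<ge> 0"
    "\<And>f. integrable unit_leb f \<Longrightarrow> AE x in unit_leb. \<bar>U n f x\<bar> \<le> C * (LINT x|unit_leb. \<bar>f x\<bar>)"
    using U_Linf_bound[of n] by blast
  have "(LINT x|unit_leb. \<bar>U n f x\<bar>) \<le> C * (LINT x|unit_leb. \<bar>f x\<bar>)" if "integrable unit_leb f" for f
    using C(2)[OF that] U_integrable[OF that] by (intro unit_leb.integral_le_const) auto
  then show ?thesis using C(1) that by blast
qed

lemma U_diff_norm:
  assumes "integrable unit_leb f" "integrable unit_leb g"
  shows "(LINT x|unit_leb. \<bar>U n (\<lambda>t. f t - g t) x\<bar>) = (LINT x|unit_leb. \<bar>U n f x - U n g x\<bar>)"
proof (rule integral_cong_AE)
  show "AE x in unit_leb. \<bar>U n (\<lambda>t. f t - g t) x\<bar> = \<bar>U n f x - U n g x\<bar>"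
    using U_diff[OF assms, of n] by eventually_elim simp
  have "integrable unit_leb (\<lambda>t. f t - g t)" using assms by simp
  from U_measurable[OF this, of n] show "(\<lambda>x. \<bar>U n (\<lambda>t. f t - g t) x\<bar>) \<in> borel_measurable unit_leb"
    by simp
  show "(\<lambda>x. \<bar>U n f x - U n g x\<bar>) \<in> borel_measurable unit_leb"
    using assms[THEN U_measurable, of n] by simp
qed

lemma U_weak_L1:
  assumes "weakly_converges F f"
  shows "(\<lambda>l. LINT x|unit_leb. \<bar>U n f x - U n (F l) x\<bar>) \<longlonglongrightarrow> 0"
proof -
  have "(\<lambda>l. LINT x|unit_leb. \<bar>U n (F l) x - U n f x\<bar>) \<longlonglongrightarrow> 0"
    using prop_A assms unfolding prop_A_def compact_op_def Lp_norm_1 by blast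
  then show ?thesis by (simp add: abs_minus_commute)
qed

text \<open>The Baire category argument of the Vitali--Hahn--Saks theorem, on the functions bounded
  by \<open>A\<close> with the \<open>L\<^sup>1\<close> metric: on some ball the oscillation \<open>\<parallel>U\<^sub>n h - U\<^sub>k h\<parallel>\<^sub>1\<close> is small for
  all large \<open>n\<close> and \<open>k\<close>.\<close>

lemma oscillation_ball:
  assumes A: "A \<ge> 0" and e: "e > 0"
  shows "\<exists>h0 r N. bounded_on_unit A h0 \<and> r > 0 \<and>
    (\<forall>h n k. bounded_on_unit A h \<longrightarrow> (LINT x|unit_leb. \<bar>h x - h0 x\<bar>) \<le> r \<longrightarrow> n \<ge> N \<longrightarrow> k \<ge> N \<longrightarrow>
       (LINT x|unit_leb. \<bar>U n h x - U k h x\<bar>) \<le> e)"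
proof (rule ccontr)
  define osc where "osc n k h = (LINT x|unit_leb. \<bar>U n h x - U k h x\<bar>)" for n k h
  assume "\<not> ?thesis"
  then have neg: "\<exists>h n k. bounded_on_unit A h \<and> (LINT x|unit_leb. \<bar>h x - h0 x\<bar>) \<le> r \<and> n \<ge> N \<and> k \<ge> N \<and> osc n k h > e"
    if "bounded_on_unit A h0" "r > 0" for h0 r N
    unfolding osc_def using that by (meson not_le)
  \<comment> \<open>Each single operator is bounded on L1, so \<open>osc n k\<close> is continuous
    and the set where it exceeds \<open>e\<close> is open: this supplies the balls of the Baire
    argument.\<close>
  have osc_cont: "\<exists>\<rho>>0. \<forall>h'. bounded_on_unit A h' \<longrightarrow> (LINT x|unit_leb. \<bar>h' x - h x\<bar>) \<le> \<rho> \<longrightarrow> osc n k h' > e"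
    if h: "bounded_on_unit A h" and "osc n k h > e" for h n k
  proof -
    obtain C1 where C1: "C1 \<ge> 0"
      "\<And>f. integrable unit_leb f \<Longrightarrow> (LINT x|unit_leb. \<bar>U n f x\<bar>) \<le> C1 * (LINT x|unit_leb. \<bar>f x\<bar>)"
      using U_L1_bound[of n] by blast
    obtain C2 where C2: "C2 \<ge> 0"
      "\<And>f. integrable unit_leb f \<Longrightarrow> (LINT x|unit_leb. \<bar>U k f x\<bar>) \<le> C2 * (LINT x|unit_leb. \<bar>f x\<bar>)"
      using U_L1_bound[of k] by blast
    define \<rho> where "\<rho> = (osc n k h - e) / (2 * (C1 + C2 + 1))"
    have \<rho>: "\<rho> > 0" unfolding \<rho>_def using C1 C2 that by simp
    have "(C1 + C2) * \<rho> < osc n k h - e"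
    proof -
      have "(C1 + C2) * \<rho> \<le> (C1 + C2 + 1) * \<rho>" using \<rho> by (intro mult_right_mono) auto
      also have "\<dots> = (osc n k h - e) / 2" unfolding \<rho>_def using C1 C2 by (simp add: field_simps)
      also have "\<dots> < osc n k h - e" using that by simp
      finally show ?thesis .
    qed
    moreover have "osc n k h \<le> osc n k h' + (C1 + C2) * \<rho>"
      if h': "bounded_on_unit A h'" "(LINT x|unit_leb. \<bar>h' x - h x\<bar>) \<le> \<rho>" for h'
    proof -
      note ih = bounded_on_unit_integrable[OF h] and ih' = bounded_on_unit_integrable[OF h'(1)]
      have i: "integrable unit_leb (\<lambda>x. h' x - h x)" using ih ih' by simp
      note iu = U_integrable[OF ih] U_integrable[OF ih']
      have "osc n k h = (LINT x|unit_leb. \<bar>(U n h' x - U k h' x) + ((U k h' x - U k h x) + - (U n h' x - U n h x))\<bar>)"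
        unfolding osc_def by (intro Bochner_Integration.integral_cong refl) simp
      also have "\<dots> \<le> osc n k h' + (LINT x|unit_leb. \<bar>(U k h' x - U k h x) + - (U n h' x - U n h x)\<bar>)"
        unfolding osc_def using iu by (intro integral_abs_triangle) auto
      also have "(LINT x|unit_leb. \<bar>(U k h' x - U k h x) + - (U n h' x - U n h x)\<bar>)
          \<le> (LINT x|unit_leb. \<bar>U k h' x - U k h x\<bar>) + (LINT x|unit_leb. \<bar>- (U n h' x - U n h x)\<bar>)"
        using iu by (intro integral_abs_triangle) auto
      also have "(LINT x|unit_leb. \<bar>U k h' x - U k h x\<bar>) \<le> C2 * \<rho>"
        using C2(2)[OF i] h'(2) mult_left_mono[OF h'(2) C2(1)] by (simp add: U_diff_norm[OF ih' ih])
      also have "(LINT x|unit_leb. \<bar>- (U n h' x - U n h x)\<bar>) \<le> C1 * \<rho>"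
        unfolding abs_minus_cancel
        using C1(2)[OF i] h'(2) mult_left_mono[OF h'(2) C1(1)] by (simp add: U_diff_norm[OF ih' ih])
      finally show ?thesis by (simp add: algebra_simps)
    qed
    ultimately show ?thesis using \<rho> by (intro exI[of _ \<rho>]) force
  qed
  define P where "P n s \<longleftrightarrow> bounded_on_unit A (fst s) \<and> 0 < snd s" for n :: nat and s :: "(real \<Rightarrow> real) \<times> real"
  \<comment> \<open>A state is a centre with a radius. The next centre lies within the current
    radius and the radii at least halve, so the limit is at distance at most twice the radius from
    each centre; hence the ball of radius \<open>2 * snd s'\<close>.\<close>
  define Q where "Q N s s' \<longleftrightarrow> (LINT x|unit_leb. \<bar>fst s' x - fst s x\<bar>) \<le> snd s \<and> snd s' \<le> snd s / 2 \<and>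
      (\<exists>n k. n \<ge> N \<and> k \<ge> N \<and> (\<forall>h'. bounded_on_unit A h' \<longrightarrow> (LINT x|unit_leb. \<bar>h' x - fst s' x\<bar>) \<le> 2 * snd s' \<longrightarrow> osc n k h' > e))"
    for N :: nat and s s' :: "(real \<Rightarrow> real) \<times> real"
  have "\<exists>S. \<forall>n. P n (S n) \<and> Q n (S n) (S (Suc n))"
  proof (rule dependent_nat_choice)
    show "\<exists>s. P 0 s" using A unfolding P_def by (intro exI[of _ "(\<lambda>x. 0, 1)"]) (auto simp: bounded_on_unit_def)
  next
    fix s N assume "P N s"
    then obtain h n k where h: "bounded_on_unit A h" "(LINT x|unit_leb. \<bar>h x - fst s x\<bar>) \<le> snd s" "n \<ge> N" "k \<ge> N" "osc n k h > e"
      using neg[of "fst s" "snd s" N] unfolding P_def by blast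
    obtain \<rho> where \<rho>: "\<rho> > 0" "\<forall>h'. bounded_on_unit A h' \<longrightarrow> (LINT x|unit_leb. \<bar>h' x - h x\<bar>) \<le> \<rho> \<longrightarrow> osc n k h' > e"
      using osc_cont[OF h(1,5)] by blast
    have le: "2 * min (\<rho> / 2) (snd s / 2) \<le> \<rho>" by (simp add: min_def)
    have "Q N s (h, min (\<rho> / 2) (snd s / 2))"
      unfolding Q_def fst_conv snd_conv
    proof (intro conjI exI allI impI)
      fix h' assume "bounded_on_unit A h'" "(LINT x|unit_leb. \<bar>h' x - h x\<bar>) \<le> 2 * min (\<rho> / 2) (snd s / 2)"
      then show "osc n k h' > e" using \<rho>(2) le by (meson order_trans)
    qed (use h in auto)
    then show "\<exists>s'. P (Suc N) s' \<and> Q N s s'"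
      using h(1) \<rho>(1) \<open>P N s\<close> unfolding P_def by (intro exI[of _ "(h, min (\<rho> / 2) (snd s / 2))"]) auto
  qed
  then obtain S where P: "\<And>n. P n (S n)" and Q: "\<And>n. Q n (S n) (S (Suc n))" by blast
  define h where "h n = fst (S n)" for n
  define r where "r n = snd (S n)" for n
  have hb: "bounded_on_unit A (h n)" and r0: "r n > 0" for n using P unfolding P_def h_def r_def by auto
  have hd: "(LINT x|unit_leb. \<bar>h (Suc n) x - h n x\<bar>) \<le> r n" and rs: "r (Suc n) \<le> r n / 2" for n
    using Q[of n] unfolding Q_def h_def r_def by auto
  have ih: "integrable unit_leb (h n)" for n using hb by (rule bounded_on_unit_integrable)
  have rk: "r (n + j) \<le> r n * (1/2) ^ j" for n j
  proof (induction j)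
    case (Suc j)
    then show ?case using rs[of "n + j"] by simp
  qed simp
  have part: "(\<Sum>j<J. h (Suc (n + j)) x - h (n + j) x) = h (n + J) x - h n x" for n J x
    using sum_lessThan_telescope[of "\<lambda>j. h (n + j) x" J] by simp
  have sm: "summable (\<lambda>j. LINT x|unit_leb. \<bar>h (Suc j) x - h j x\<bar>)"
  proof (rule summable_comparison_test')
    show "summable (\<lambda>j. r 0 * (1/2) ^ j)" by (intro summable_mult summable_geometric) auto
    show "norm (LINT x|unit_leb. \<bar>h (Suc j) x - h j x\<bar>) \<le> r 0 * (1/2) ^ j" for j
      using order_trans[OF hd[of j]] rk[of 0 j] by simp
  qed
  define H where "H x = h 0 x + (\<Sum>j. h (Suc j) x - h j x)" for x
  have ihd: "integrable unit_leb (\<lambda>x. h (Suc j) x - h j x)" for j using ih by simp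
  have lim: "AE x in unit_leb. (\<lambda>n. h n x) \<longlonglongrightarrow> H x"
    using summable_integral_abs(1)[OF ihd sm]
  proof eventually_elim
    case (elim x)
    have "(\<lambda>n. \<Sum>j<n. h (Suc j) x - h j x) \<longlonglongrightarrow> (\<Sum>j. h (Suc j) x - h j x)"
      using elim by (intro summable_LIMSEQ[OF summable_rabs_cancel]) auto
    then have "(\<lambda>n. h 0 x + (\<Sum>j<n. h (Suc j) x - h j x)) \<longlonglongrightarrow> H x"
      unfolding H_def by (intro tendsto_intros)
    then show ?case using part[of 0] by simp
  qed
  have iH: "integrable unit_leb H"
    unfolding H_def using ih summable_integral_abs(2)[OF _ sm] by simp
  \<comment> \<open>The limit obeys the bound only almost everywhere; truncation restores it at
    every point, as \<open>bounded_on_unit\<close> demands.\<close>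
  define K where "K x = max (- A) (min A (H x))" for x
  have Kb: "bounded_on_unit A K"
    unfolding bounded_on_unit_def K_def using iH A by auto
  have limK: "AE x in unit_leb. (\<lambda>n. h n x) \<longlonglongrightarrow> K x"
    using lim AE_space
  proof eventually_elim
    case (elim x)
    have "\<bar>h n x\<bar> \<le> A" for n using hb elim unfolding bounded_on_unit_def by auto
    then have "\<bar>H x\<bar> \<le> A"
      using elim by (intro LIMSEQ_le_const2[OF tendsto_rabs]) auto
    then have "K x = H x" unfolding K_def by auto
    then show ?case using elim by simp
  qed
  note iK = bounded_on_unit_integrable[OF Kb]
  have "(LINT x|unit_leb. \<bar>K x - h n x\<bar>) \<le> 2 * r n" for n
  proof (rule LIMSEQ_le_const2)
    show "(\<lambda>j. LINT x|unit_leb. \<bar>h (n + j) x - h n x\<bar>) \<longlonglongrightarrow> (LINT x|unit_leb. \<bar>K x - h n x\<bar>)"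
    proof (rule integral_dominated_convergence[where w = "\<lambda>_. 2 * A"])
      show "AE x in unit_leb. (\<lambda>j. \<bar>h (n + j) x - h n x\<bar>) \<longlonglongrightarrow> \<bar>K x - h n x\<bar>"
        using limK
      proof eventually_elim
        case (elim x)
        then have "(\<lambda>j. h (j + n) x) \<longlonglongrightarrow> K x" by (rule LIMSEQ_ignore_initial_segment)
        then show ?case by (intro tendsto_intros) (simp add: add.commute)
      qed
      show "AE x in unit_leb. norm \<bar>h (n + j) x - h n x\<bar> \<le> 2 * A" for j
      proof (rule AE_I2)
        fix x :: real assume "x \<in> space unit_leb"
        then have "\<bar>h (n + j) x\<bar> \<le> A" "\<bar>h n x\<bar> \<le> A" using hb unfolding bounded_on_unit_def by auto
        then show "norm \<bar>h (n + j) x - h n x\<bar> \<le> 2 * A" by (simp add: abs_le_iff)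
      qed
    qed (use ih iK in \<open>auto intro!: borel_measurable_abs borel_measurable_diff\<close>)
    have "(LINT x|unit_leb. \<bar>h (n + j) x - h n x\<bar>) \<le> 2 * r n" for j
    proof -
      have "(LINT x|unit_leb. \<bar>h (n + j) x - h n x\<bar>)
          \<le> (\<Sum>i<j. LINT x|unit_leb. \<bar>h (Suc (n + i)) x - h (n + i) x\<bar>)"
        unfolding part[symmetric] using ih by (intro integral_abs_sum_le) auto
      also have "\<dots> \<le> (\<Sum>i<j. r n * (1/2) ^ i)"
        using order_trans[OF hd rk] by (intro sum_mono) auto
      also have "\<dots> = r n * (\<Sum>i<j. (1/2) ^ i)" by (simp add: sum_distrib_left)
      also have "\<dots> \<le> r n * 2"
        using r0[of n] by (intro mult_left_mono) (auto simp: geometric_sum)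
      finally show ?thesis by simp
    qed
    then show "\<exists>N. \<forall>j\<ge>N. (LINT x|unit_leb. \<bar>h (n + j) x - h n x\<bar>) \<le> 2 * r n" by blast
  qed
  then have bad: "\<exists>n k. n \<ge> N \<and> k \<ge> N \<and> osc n k K > e" for N
    using Q[of N] Kb unfolding Q_def h_def r_def by blast
  \<comment> \<open>By construction \<open>K\<close> has oscillation above \<open>e\<close> beyond
    every index, whereas the images of \<open>K\<close> converge to \<open>K\<close> in L1 and thus
    form a Cauchy sequence.\<close>
  have "eventually (\<lambda>n. (LINT x|unit_leb. \<bar>U n K x - K x\<bar>) < e / 2) sequentially"
    using L1_conv[OF Kb] e by (intro order_tendstoD) auto
  then obtain N where N: "\<And>n. n \<ge> N \<Longrightarrow> (LINT x|unit_leb. \<bar>U n K x - K x\<bar>) < e / 2"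
    unfolding eventually_sequentially by blast
  obtain n k where nk: "n \<ge> N" "k \<ge> N" "osc n k K > e" using bad by blast
  note iu = U_integrable[OF iK]
  have "osc n k K = (LINT x|unit_leb. \<bar>(U n K x - K x) + - (U k K x - K x)\<bar>)"
    unfolding osc_def by simp
  also have "\<dots> \<le> (LINT x|unit_leb. \<bar>U n K x - K x\<bar>) + (LINT x|unit_leb. \<bar>- (U k K x - K x)\<bar>)"
    using iu iK by (intro integral_abs_triangle) auto
  also have "\<dots> < e / 2 + e / 2" unfolding abs_minus_cancel using N nk by (intro add_strict_mono)
  finally show False using nk by simp
qed

text \<open>This moves the ball around \<open>h0\<close> to the origin. Adding \<open>h\<close> to
  \<open>h0\<close> could break the bound \<open>A\<close>, so \<open>h0\<close> is first erased on
  \<open>E\<close>: the result \<open>v\<close> and \<open>w = v + h\<close> both keep the bound and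
  stay close to \<open>h0\<close>, and \<open>U n h\<close> is the difference of their images. Hence
  \<open>U n h\<close> is within e/2 of \<open>U N h\<close> for n > \<open>N\<close>, and the
  finitely many operators up to \<open>N\<close> are controlled by their norms.\<close>

lemma uniform_L1_small:
  assumes A: "A \<ge> 0" and e: "e > 0"
  shows "\<exists>\<tau>>0. \<forall>h E n. bounded_on_unit A h \<longrightarrow> E \<in> sets lebesgue \<longrightarrow> E \<subseteq> {0..<1} \<longrightarrow> measure lebesgue E \<le> \<tau> \<longrightarrow>
     (\<forall>x. x \<notin> E \<longrightarrow> h x = 0) \<longrightarrow> (LINT x|unit_leb. \<bar>U n h x\<bar>) \<le> e"
proof -
  obtain h0 r N where h0: "bounded_on_unit A h0" and r: "r > 0"
    and osc: "\<And>h n k. bounded_on_unit A h \<Longrightarrow> (LINT x|unit_leb. \<bar>h x - h0 x\<bar>) \<le> r \<Longrightarrow> n \<ge> N \<Longrightarrow> k \<ge> N \<Longrightarrow>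
       (LINT x|unit_leb. \<bar>U n h x - U k h x\<bar>) \<le> e / 4"
  proof -
    have "e / 4 > 0" using e by simp
    then show ?thesis using oscillation_ball[OF A, of "e / 4"] that by blast
  qed
  have "\<exists>C\<ge>0. \<forall>f. integrable unit_leb f \<longrightarrow> (LINT x|unit_leb. \<bar>U n f x\<bar>) \<le> C * (LINT x|unit_leb. \<bar>f x\<bar>)" for n
    using U_L1_bound[of n] by metis
  then obtain C where C: "\<And>n. C n \<ge> 0"
     "\<And>n f. integrable unit_leb f \<Longrightarrow> (LINT x|unit_leb. \<bar>U n f x\<bar>) \<le> C n * (LINT x|unit_leb. \<bar>f x\<bar>)"
    by metis
  define D where "D = (\<Sum>n\<le>N. C n)"
  have D: "C n \<le> D" if "n \<le> N" for n
    unfolding D_def using that C(1) by (intro member_le_sum) auto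
  have D0: "D \<ge> 0" unfolding D_def using C by (intro sum_nonneg) auto
  \<comment> \<open>The first term puts \<open>v\<close> and \<open>w\<close> within
    \<open>r\<close> of \<open>h0\<close>, from which they differ by at most 2A on \<open>E\<close>;
    the second makes the images of \<open>h\<close> at most e/2 for n \<le> \<open>N\<close>. Adding
    1 avoids division by zero.\<close>
  define \<tau> where "\<tau> = min (r / (2 * A + 1)) (e / (2 * (D * A + 1)))"
  have \<tau>: "\<tau> > 0" unfolding \<tau>_def using r e A D0 by (auto simp: add_nonneg_pos)
  have \<tau>1: "2 * A * \<tau> \<le> r"
  proof -
    have "2 * A * \<tau> \<le> (2 * A + 1) * \<tau>" using \<tau> by (intro mult_right_mono) auto
    also have "\<dots> \<le> (2 * A + 1) * (r / (2 * A + 1))" unfolding \<tau>_def using A by (intro mult_left_mono) auto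
    also have "\<dots> = r" using A by simp
    finally show ?thesis .
  qed
  have \<tau>2: "D * (A * \<tau>) \<le> e / 2"
  proof -
    have "D * (A * \<tau>) \<le> (D * A + 1) * \<tau>" using \<tau> by (simp add: algebra_simps)
    also have "\<dots> \<le> (D * A + 1) * (e / (2 * (D * A + 1)))" unfolding \<tau>_def using A D0 by (intro mult_left_mono) auto
    also have "\<dots> = e / 2"
    proof -
      have "D * A + 1 \<noteq> 0" using A D0 mult_nonneg_nonneg[OF D0 A] by linarith
      then show ?thesis by (simp add: divide_simps)
    qed
    finally show ?thesis .
  qed
  have "(LINT x|unit_leb. \<bar>U n h x\<bar>) \<le> e"
    if h: "bounded_on_unit A h" and E: "E \<in> sets lebesgue" "E \<subseteq> {0..<1}" "measure lebesgue E \<le> \<tau>"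
      and h0E: "\<And>x. x \<notin> E \<Longrightarrow> h x = 0" for h E n
  proof -
    define v where "v x = indicat_real (- E) x * h0 x" for x
    define w where "w x = v x + h x" for x
    have [measurable]: "indicat_real (- E) \<in> borel_measurable unit_leb"
      using E by (intro indicat_measurable_unit_leb) (simp add: Compl_in_sets_lebesgue)
    have [measurable]: "h0 \<in> borel_measurable unit_leb" "h \<in> borel_measurable unit_leb"
      using h h0 unfolding bounded_on_unit_def by auto
    have vm [measurable]: "v \<in> borel_measurable unit_leb" unfolding v_def by measurable
    have vb: "bounded_on_unit A v"
      using h0 A vm unfolding bounded_on_unit_def v_def by (auto simp: indicator_def)
    have wb: "bounded_on_unit A w"
      unfolding bounded_on_unit_def
    proof
      show "w \<in> borel_measurable unit_leb" unfolding w_def by measurable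
      show "\<forall>x\<in>{0<..<1}. \<bar>w x\<bar> \<le> A"
      proof
        fix x :: real assume x: "x \<in> {0<..<1}"
        show "\<bar>w x\<bar> \<le> A"
        proof (cases "x \<in> E")
          case True
          then show ?thesis using h x unfolding bounded_on_unit_def w_def v_def by auto
        next
          case False
          then show ?thesis using h0 x h0E[of x] unfolding bounded_on_unit_def w_def v_def by auto
        qed
      qed
    qed
    note ih = bounded_on_unit_integrable[OF h] and iv = bounded_on_unit_integrable[OF vb]
      and iw = bounded_on_unit_integrable[OF wb] and ih0 = bounded_on_unit_integrable[OF h0]
    have iE: "(LINT x|unit_leb. B * indicat_real E x) \<le> B * \<tau>" if "B \<ge> 0" for B
      using mult_left_mono[OF E(3) that] unfolding integral_indicat_unit_leb[OF E(1,2), symmetric]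
      by (subst integral_mult_right_zero)
    have iEi: "integrable unit_leb (\<lambda>x. B * indicat_real E x)" for B
      using E by (intro integrable_mult_right integrable_indicat_unit_leb)
    have le: "(LINT x|unit_leb. \<bar>u x\<bar>) \<le> B * \<tau>"
      if "integrable unit_leb u" "\<And>x. x \<in> {0<..<1} \<Longrightarrow> \<bar>u x\<bar> \<le> B * indicat_real E x" "B \<ge> 0" for u B
    proof -
      have "(LINT x|unit_leb. \<bar>u x\<bar>) \<le> (LINT x|unit_leb. B * indicat_real E x)"
        using that iEi by (intro integral_mono) auto
      then show ?thesis using iE[OF that(3)] by linarith
    qed
    have "(LINT x|unit_leb. \<bar>v x - h0 x\<bar>) \<le> 2 * A * \<tau>"
    proof (intro le)
      fix x :: real assume x: "x \<in> {0<..<1}"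
      then have "\<bar>h0 x\<bar> \<le> A" using h0 unfolding bounded_on_unit_def by auto
      then show "\<bar>v x - h0 x\<bar> \<le> 2 * A * indicat_real E x"
        unfolding v_def by (auto simp: indicator_def)
    qed (use iv ih0 A in auto)
    then have v1: "(LINT x|unit_leb. \<bar>v x - h0 x\<bar>) \<le> r" using \<tau>1 by linarith
    have "(LINT x|unit_leb. \<bar>w x - h0 x\<bar>) \<le> 2 * A * \<tau>"
    proof (intro le)
      fix x :: real assume x: "x \<in> {0<..<1}"
      then have "\<bar>h0 x\<bar> \<le> A" "\<bar>h x\<bar> \<le> A" using h h0 unfolding bounded_on_unit_def by auto
      then show "\<bar>w x - h0 x\<bar> \<le> 2 * A * indicat_real E x"
        using h0E[of x] unfolding w_def v_def by (auto simp: indicator_def)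
    qed (use iw ih0 A in auto)
    then have w1: "(LINT x|unit_leb. \<bar>w x - h0 x\<bar>) \<le> r" using \<tau>1 by linarith
    have "(LINT x|unit_leb. \<bar>h x\<bar>) \<le> A * \<tau>"
    proof (intro le)
      fix x :: real assume x: "x \<in> {0<..<1}"
      then have "\<bar>h x\<bar> \<le> A" using h unfolding bounded_on_unit_def by auto
      then show "\<bar>h x\<bar> \<le> A * indicat_real E x" using h0E[of x] by (auto simp: indicator_def)
    qed (use ih A in auto)
    then have small: "(LINT x|unit_leb. \<bar>U n h x\<bar>) \<le> e / 2" if "n \<le> N" for n
    proof -
      have nn: "(LINT x|unit_leb. \<bar>h x\<bar>) \<ge> 0" by simp
      have "(LINT x|unit_leb. \<bar>U n h x\<bar>) \<le> C n * (LINT x|unit_leb. \<bar>h x\<bar>)" by (rule C(2)[OF ih])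
      also have "\<dots> \<le> D * (LINT x|unit_leb. \<bar>h x\<bar>)" using D[OF that] by (intro mult_right_mono nn)
      also have "\<dots> \<le> D * (A * \<tau>)" using \<open>(LINT x|unit_leb. \<bar>h x\<bar>) \<le> A * \<tau>\<close> D0 by (intro mult_left_mono)
      also have "\<dots> \<le> e / 2" by (rule \<tau>2)
      finally show ?thesis .
    qed
    show ?thesis
    proof (cases "n \<le> N")
      case True
      then show ?thesis using small[OF True] e by simp
    next
      case False
      note iu = U_integrable[OF iv] U_integrable[OF iw] U_integrable[OF ih]
      have dec: "AE x in unit_leb. U k h x = U k w x - U k v x" for k
        using U_add[OF iv ih, of k] unfolding w_def by eventually_elim simp
      have "(LINT x|unit_leb. \<bar>U n h x\<bar>)
          = (LINT x|unit_leb. \<bar>U N h x + ((U n w x - U N w x) + - (U n v x - U N v x))\<bar>)"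
      proof (rule integral_cong_AE)
        show "AE x in unit_leb. \<bar>U n h x\<bar> = \<bar>U N h x + ((U n w x - U N w x) + - (U n v x - U N v x))\<bar>"
          using dec[of n] dec[of N] by eventually_elim simp
      qed (use iu in \<open>auto intro!: borel_measurable_abs borel_measurable_add borel_measurable_diff\<close>)
      also have "\<dots> \<le> (LINT x|unit_leb. \<bar>U N h x\<bar>)
          + (LINT x|unit_leb. \<bar>(U n w x - U N w x) + - (U n v x - U N v x)\<bar>)"
        using iu by (intro integral_abs_triangle) auto
      also have "(LINT x|unit_leb. \<bar>(U n w x - U N w x) + - (U n v x - U N v x)\<bar>)
         \<le> (LINT x|unit_leb. \<bar>U n w x - U N w x\<bar>) + (LINT x|unit_leb. \<bar>- (U n v x - U N v x)\<bar>)"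
        using iu by (intro integral_abs_triangle) auto
      also have "(LINT x|unit_leb. \<bar>U n w x - U N w x\<bar>) \<le> e / 4"
        using False by (intro osc wb w1) auto
      also have "(LINT x|unit_leb. \<bar>- (U n v x - U N v x)\<bar>) \<le> e / 4"
        unfolding abs_minus_cancel using False by (intro osc vb v1) auto
      finally show ?thesis using small[of N] by simp
    qed
  qed
  then show ?thesis using \<tau> by blast
qed

end

section \<open>Almost everywhere convergence for finite-interval sets\<close>

lemma is_interval01_sets:
  assumes "is_interval01 D"
  shows "D \<in> sets lebesgue" "D \<subseteq> {0..<1}"
  using assms unfolding is_interval01_def by auto

lemma is_interval01_Int:
  assumes "is_interval01 I" "is_interval01 J" "I \<inter> J \<noteq> {}"
  shows "is_interval01 (I \<inter> J)"
proof -
  obtain a b where I: "0 \<le> a" "a < b" "b \<le> 1" "I = {a..<b}" using assms unfolding is_interval01_def by blast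
  obtain c d where J: "0 \<le> c" "c < d" "d \<le> 1" "J = {c..<d}" using assms unfolding is_interval01_def by blast
  have eq: "I \<inter> J = {max a c..<min b d}" using I J by auto
  have "max a c < min b d" using assms(3) unfolding eq by auto
  then show ?thesis
    unfolding eq is_interval01_def using I J by (intro exI[of _ "max a c"] exI[of _ "min b d"]) auto
qed

lemma weakly_convergesD:
  assumes "weakly_converges F f" "g \<in> Linf_space"
  shows "(\<lambda>l. LINT x|unit_leb. F l x * g x) \<longlonglongrightarrow> (LINT x|unit_leb. f x * g x)"
  using assms by (simp add: weakly_converges_def)

context compact_approximation
begin

definition conv_ae :: "(real \<Rightarrow> real) \<Rightarrow> bool" where
  "conv_ae f \<longleftrightarrow> (AE x in unit_leb. (\<lambda>n. U n f x) \<longlonglongrightarrow> f x)"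

lemma conv_ae_add:
  assumes "integrable unit_leb f" "integrable unit_leb g" "conv_ae f" "conv_ae g"
  shows "conv_ae (\<lambda>x. f x + g x)"
proof -
  have "AE x in unit_leb. \<forall>n. U n (\<lambda>t. f t + g t) x = U n f x + U n g x"
    unfolding AE_all_countable using U_add[OF assms(1,2)] by blast
  with assms(3,4) show ?thesis
    unfolding conv_ae_def by eventually_elim (auto intro: tendsto_add)
qed

lemma conv_ae_cmult:
  assumes "integrable unit_leb f" "conv_ae f"
  shows "conv_ae (\<lambda>x. c * f x)"
proof -
  have "AE x in unit_leb. \<forall>n. U n (\<lambda>t. c * f t) x = c * U n f x"
    unfolding AE_all_countable using U_cmult[OF assms(1)] by blast
  with assms(2) show ?thesis
    unfolding conv_ae_def by eventually_elim (auto intro: tendsto_mult_left)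
qed

lemma conv_ae_sum:
  assumes "finite I" "\<And>i. i \<in> I \<Longrightarrow> integrable unit_leb (f i)" "\<And>i. i \<in> I \<Longrightarrow> conv_ae (f i)"
  shows "conv_ae (\<lambda>x. \<Sum>i\<in>I. f i x)"
proof -
  have "AE x in unit_leb. \<forall>n. U n (\<lambda>t. \<Sum>i\<in>I. f i t) x = (\<Sum>i\<in>I. U n (f i) x)"
    unfolding AE_all_countable by (intro allI U_sum assms)
  moreover have "AE x in unit_leb. \<forall>i\<in>I. (\<lambda>n. U n (f i) x) \<longlonglongrightarrow> f i x"
    using assms(1,3) unfolding conv_ae_def by (simp add: AE_finite_all)
  ultimately show ?thesis
    unfolding conv_ae_def by eventually_elim (auto intro: tendsto_sum)
qed

lemma conv_ae_interval:
  assumes C: "prop_C U" and J: "is_interval01 J"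
  shows "conv_ae (indicat_real J)"
  unfolding conv_ae_def
proof (rule AE_limit_eq_L1_limit)
  note J' = is_interval01_sets(1)[OF J]
  show "integrable unit_leb (indicat_real J)" using J' by (rule integrable_indicat_unit_leb)
  then show "integrable unit_leb (U n (indicat_real J))" for n by (rule U_integrable)
  show "AE x in unit_leb. convergent (\<lambda>n. U n (indicat_real J) x)"
    using C J unfolding prop_C_def by blast
  show "(\<lambda>n. LINT x|unit_leb. \<bar>U n (indicat_real J) x - indicat_real J x\<bar>) \<longlonglongrightarrow> 0"
    using bounded_on_unit_indicat[OF J'] by (rule L1_conv)
qed

text \<open>Inclusion and exclusion for the new interval \<open>I\<close>. The overlap is the old
  union cut with \<open>I \<inter> J\<close>, which is why the induction runs over arbitrary
  \<open>J\<close>; an empty \<open>I \<inter> J\<close> is split off, as it is not an interval in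
  the sense of \<open>is_interval01\<close>.\<close>

lemma conv_ae_intervals:
  assumes C: "prop_C U" and "finite \<D>" "\<And>I. I \<in> \<D> \<Longrightarrow> is_interval01 I" "is_interval01 J"
  shows "conv_ae (indicat_real (\<Union>\<D> \<inter> J))"
  using assms(2-)
proof (induction \<D> arbitrary: J rule: finite_induct)
  case empty
  have "conv_ae (\<lambda>x. 0 * indicat_real J x)"
    using conv_ae_interval[OF C empty(2)] is_interval01_sets[OF empty(2)]
    by (intro conv_ae_cmult integrable_indicat_unit_leb)
  moreover have "(\<lambda>x. 0 * indicat_real J x) = indicat_real (\<Union>{} \<inter> J)" by (auto simp: indicator_def)
  ultimately show ?case by simp
next
  case (insert I \<D>)
  show ?case
  proof (cases "I \<inter> J = {}")
    case True
    then have "\<Union>(insert I \<D>) \<inter> J = \<Union>\<D> \<inter> J" by auto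
    then show ?thesis using insert by simp
  next
    case False
    have IJ: "is_interval01 (I \<inter> J)" using insert False by (intro is_interval01_Int) auto
    have sets: "K \<in> sets lebesgue" if "K \<in> \<D> \<or> K = J \<or> K = I" for K
      using that insert is_interval01_sets by blast
    have "\<Union>\<D> \<in> sets lebesgue" using insert.hyps sets by (intro sets.finite_Union) auto
    moreover have "I \<in> sets lebesgue" "J \<in> sets lebesgue" using sets by blast+
    ultimately have int: "integrable unit_leb (indicat_real (\<Union>\<D> \<inter> J))" "integrable unit_leb (indicat_real (I \<inter> J))"
      "integrable unit_leb (indicat_real (\<Union>\<D> \<inter> (I \<inter> J)))"
      by - (intro integrable_indicat_unit_leb sets.Int; assumption)+
    have "conv_ae (\<lambda>x. (indicat_real (I \<inter> J) x + indicat_real (\<Union>\<D> \<inter> J) x) + (-1) * indicat_real (\<Union>\<D> \<inter> (I \<inter> J)) x)"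
    proof (rule conv_ae_add)
      show "conv_ae (\<lambda>x. indicat_real (I \<inter> J) x + indicat_real (\<Union>\<D> \<inter> J) x)"
        by (rule conv_ae_add[OF int(2,1) conv_ae_interval[OF C IJ]])
          (rule insert.IH[OF insert.prems(1) insert.prems(2)], simp)
      show "conv_ae (\<lambda>x. (-1) * indicat_real (\<Union>\<D> \<inter> (I \<inter> J)) x)"
        by (rule conv_ae_cmult[OF int(3)]) (rule insert.IH[OF insert.prems(1) IJ], simp)
    qed (use int in auto)
    moreover have "(\<lambda>x. (indicat_real (I \<inter> J) x + indicat_real (\<Union>\<D> \<inter> J) x) + (-1) * indicat_real (\<Union>\<D> \<inter> (I \<inter> J)) x)
      = indicat_real (\<Union>(insert I \<D>) \<inter> J)"
      by (auto simp: indicator_def fun_eq_iff)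
    ultimately show ?thesis by simp
  qed
qed

definition max_set :: "real \<Rightarrow> (real \<Rightarrow> real) \<Rightarrow> real set" where
  "max_set t f = {x \<in> space unit_leb. \<exists>n. \<bar>U n f x\<bar> > t}"

lemma max_set_eq: "{x \<in> {0<..<1}. maximal_op U f x > ereal t} = max_set t f"
  unfolding max_set_def maximal_op_def by (simp add: less_SUP_iff)

lemma sets_max_set:
  assumes "integrable unit_leb f"
  shows "max_set t f \<in> sets unit_leb"
proof -
  note [measurable] = U_measurable[OF assms]
  show ?thesis unfolding max_set_def by measurable
qed

end

text \<open>The sets of (D) for one value of \<open>\<epsilon>\<close>; of the basis only the subdivisions of \<open>[0,1)\<close> into \<open>m\<close>
  equal cells, \<open>m \<in> L\<close>, are kept. With \<open>Q\<close> false the locale asks nothing of (C) and (D), so that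
  one argument serves both halves of the theorem.\<close>

locale correction_sets = compact_approximation +
  fixes G :: "nat \<Rightarrow> real set" and \<gamma> e \<beta> :: real and L :: "nat set" and Q :: bool
  assumes G_fin: "\<And>l. finite_interval_set (G l)"
    and \<gamma>_pos: "\<gamma> > 0" and \<gamma>_le: "\<And>l. \<gamma> \<le> measure lebesgue (G l)"
    and G_le: "\<And>l. measure lebesgue (G l) \<le> e"
    and G_weak: "weakly_converges (\<lambda>l x. indicat_real (G l) x / measure lebesgue (G l)) (indicat_real {0..<1})"
    and L_inf: "infinite L" and \<beta>_nonneg: "\<beta> \<ge> 0"
    and Q_C: "Q \<Longrightarrow> prop_C U"
    and Q_D: "\<And>m j t l. Q \<Longrightarrow> m \<in> L \<Longrightarrow> j < m \<Longrightarrow> t > 0 \<Longrightarrow>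
       t * measure unit_leb (max_set t (indicat_real (G l \<inter> grid_cell m j))) \<le> \<beta> * measure lebesgue (G l \<inter> grid_cell m j)"
begin

lemma G_sets: "G l \<in> sets lebesgue"
  using finite_interval_set_sets[OF G_fin] by auto

lemma G_pos: "measure lebesgue (G l) > 0"
  using \<gamma>_pos \<gamma>_le[of l] by linarith

text \<open>Localisation: a test function times the indicator of \<open>D\<close> is again a test
  function.\<close>

lemma weak_Int:
  assumes D: "D \<in> sets lebesgue" "D \<subseteq> {0..<1}"
  shows "weakly_converges (\<lambda>l x. (1 / measure lebesgue (G l)) * indicat_real (G l \<inter> D) x) (indicat_real D)"
  unfolding weakly_converges_def Lp_space_1
proof (intro conjI allI ballI)
  show "integrable unit_leb (\<lambda>x. (1 / measure lebesgue (G l)) * indicat_real (G l \<inter> D) x)" for l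
    using D G_sets[of l] by (intro integrable_mult_right integrable_indicat_unit_leb) auto
  show "integrable unit_leb (indicat_real D)"
    using D by (intro integrable_indicat_unit_leb)
  fix g assume g: "g \<in> Linf_space"
  have "(\<lambda>x. indicat_real D x * g x) \<in> Linf_space"
  proof -
    obtain C where C: "AE x in unit_leb. \<bar>g x\<bar> \<le> C" using g unfolding Linf_space_iff by blast
    have "AE x in unit_leb. \<bar>indicat_real D x * g x\<bar> \<le> \<bar>C\<bar>"
      using C by eventually_elim (auto simp: indicator_def)
    moreover have "(\<lambda>x. indicat_real D x * g x) \<in> borel_measurable unit_leb"
      using g indicat_measurable_unit_leb[OF D(1)] unfolding Linf_space_iff by (intro borel_measurable_times) auto
    ultimately show ?thesis unfolding Linf_space_iff by blast
  qed
  then have "(\<lambda>l. LINT x|unit_leb. indicat_real (G l) x / measure lebesgue (G l) * (indicat_real D x * g x))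
      \<longlonglongrightarrow> (LINT x|unit_leb. indicat_real {0..<1} x * (indicat_real D x * g x))"
    by (rule weakly_convergesD[OF G_weak])
  moreover have "indicat_real (G l) x / measure lebesgue (G l) * (indicat_real D x * g x)
    = (1 / measure lebesgue (G l)) * indicat_real (G l \<inter> D) x * g x" for l x
    by (simp add: indicator_inter_arith)
  moreover have "indicat_real {0..<1} x * (indicat_real D x * g x) = indicat_real D x * g x" for x
    using D(2) by (auto simp: indicator_def)
  ultimately show "(\<lambda>l. LINT x|unit_leb. (1 / measure lebesgue (G l)) * indicat_real (G l \<inter> D) x * g x)
      \<longlonglongrightarrow> (LINT x|unit_leb. indicat_real D x * g x)" by (simp only:)
qed

text \<open>Weak convergence tested with the constant 1. Asymptotically \<open>G l\<close> takes its
  fair share of each cell; from this come the factor 2 in \<open>piece_choice\<close> and the bound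
  2e for the exceptional set.\<close>

lemma ratio_tendsto:
  assumes D: "D \<in> sets lebesgue" "D \<subseteq> {0..<1}"
  shows "(\<lambda>l. measure lebesgue (G l \<inter> D) / measure lebesgue (G l)) \<longlonglongrightarrow> measure lebesgue D"
proof -
  have "(\<lambda>x. 1) \<in> Linf_space" unfolding Linf_space_iff by (auto intro: exI[of _ 1])
  then have "(\<lambda>l. LINT x|unit_leb. (1 / measure lebesgue (G l)) * indicat_real (G l \<inter> D) x * 1)
     \<longlonglongrightarrow> (LINT x|unit_leb. indicat_real D x * 1)"
    by (rule weakly_convergesD[OF weak_Int[OF D]])
  moreover have "(LINT x|unit_leb. (1 / measure lebesgue (G l)) * indicat_real (G l \<inter> D) x * 1)
     = measure lebesgue (G l \<inter> D) / measure lebesgue (G l)" for l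
  proof -
    have "(LINT x|unit_leb. indicat_real (G l \<inter> D) x) = measure lebesgue (G l \<inter> D)"
      using D G_sets[of l] by (intro integral_indicat_unit_leb) auto
    then show ?thesis unfolding mult_1_right by (subst integral_mult_right_zero) simp
  qed
  moreover have "(LINT x|unit_leb. indicat_real D x * 1) = measure lebesgue D"
    using integral_indicat_unit_leb[OF D] unfolding mult_1_right .
  ultimately show ?thesis by (simp only:)
qed

text \<open>The weak type estimate passes from the sets \<open>G l \<inter> D\<close> to \<open>D\<close> itself, because for each
  \<open>n\<close> compactness makes \<open>U\<^sub>n 1\<^sub>D\<close> an \<open>L\<^sup>1\<close> limit.\<close>

lemma max_set_indicat:
  assumes D: "D \<in> sets lebesgue" "D \<subseteq> {0..<1}" and t: "t > 0"
    and wt: "\<And>s l. s > 0 \<Longrightarrow> s * measure unit_leb (max_set s (indicat_real (G l \<inter> D))) \<le> \<beta> * measure lebesgue (G l \<inter> D)"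
  shows "measure unit_leb (max_set t (indicat_real D)) \<le> 2 * \<beta> * measure lebesgue D / t"
proof -
  define \<mu> where "\<mu> l = measure lebesgue (G l)" for l
  have \<mu>: "\<mu> l > 0" for l unfolding \<mu>_def by (rule G_pos)
  define F where "F l x = (1 / \<mu> l) * indicat_real (G l \<inter> D) x" for l x
  have iD: "integrable unit_leb (indicat_real D)" using D by (intro integrable_indicat_unit_leb)
  have iG: "integrable unit_leb (indicat_real (G l \<inter> D))" for l
    using D G_sets by (intro integrable_indicat_unit_leb) auto
  have iF: "integrable unit_leb (F l)" for l unfolding F_def using iG by simp
  have [measurable]: "U n (indicat_real D) \<in> borel_measurable unit_leb" "U n (F l) \<in> borel_measurable unit_leb" for n l
    using U_measurable iD iF by auto
  have W: "(\<lambda>l. LINT x|unit_leb. \<bar>U n (indicat_real D) x - U n (F l) x\<bar>) \<longlonglongrightarrow> 0" for n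
    using U_weak_L1[OF weak_Int[OF D], of n] unfolding F_def \<mu>_def .
  \<comment> \<open>L1 convergence as \<open>l\<close> grows is known for each \<open>n\<close>
    separately, so the maximum is cut off at \<open>N\<close>. The resulting bound is free of
    \<open>N\<close>, and \<open>N\<close> tends to infinity at the end.\<close>
  define S where "S N = {x \<in> space unit_leb. \<exists>n<N. \<bar>U n (indicat_real D) x\<bar> > t}" for N :: nat
  have Sm: "S N \<in> sets unit_leb" for N unfolding S_def by measurable
  have SN: "measure unit_leb (S N) \<le> 2 * \<beta> * measure lebesgue D / t" for N
  proof (rule LIMSEQ_le_const)
    show "(\<lambda>l. 2 * \<beta> * (measure lebesgue (G l \<inter> D) / measure lebesgue (G l)) / t
         + (\<Sum>n<N. (LINT x|unit_leb. \<bar>U n (indicat_real D) x - U n (F l) x\<bar>) / (t / 2)))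
        \<longlonglongrightarrow> 2 * \<beta> * measure lebesgue D / t"
    proof -
      have "(\<lambda>l. 2 * \<beta> * (measure lebesgue (G l \<inter> D) / measure lebesgue (G l)) / t
         + (\<Sum>n<N. (LINT x|unit_leb. \<bar>U n (indicat_real D) x - U n (F l) x\<bar>) / (t / 2)))
        \<longlonglongrightarrow> 2 * \<beta> * measure lebesgue D / t + (\<Sum>n<N. 0 / (t / 2))"
        using t by (intro tendsto_intros ratio_tendsto[OF D] W) auto
      then show ?thesis by simp
    qed
    have "measure unit_leb (S N) \<le> 2 * \<beta> * (measure lebesgue (G l \<inter> D) / measure lebesgue (G l)) / t
         + (\<Sum>n<N. (LINT x|unit_leb. \<bar>U n (indicat_real D) x - U n (F l) x\<bar>) / (t / 2))" for l
    proof -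
      define B where "B n = {x \<in> space unit_leb. \<bar>U n (indicat_real D) x - U n (F l) x\<bar> > t / 2}" for n
      have Bm: "B n \<in> sets unit_leb" for n unfolding B_def by measurable
      have Gm: "max_set (t / 2 * \<mu> l) (indicat_real (G l \<inter> D)) \<in> sets unit_leb" by (rule sets_max_set[OF iG])
      have "AE x in unit_leb. \<forall>n. U n (F l) x = (1 / \<mu> l) * U n (indicat_real (G l \<inter> D)) x"
        unfolding AE_all_countable F_def using U_cmult[OF iG] by blast
      \<comment> \<open>Half of the level is spent on the difference between the images of the
        indicator of \<open>D\<close> and of \<open>F l\<close>. The other half, rescaled by
        \<open>\<mu> l\<close>, is a level for the indicator of \<open>G l \<inter> D\<close>, so
        that \<open>wt\<close> yields the ratio of measures whose limit is known.\<close>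
      then have "AE x in unit_leb. x \<in> S N \<longrightarrow> x \<in> max_set (t / 2 * \<mu> l) (indicat_real (G l \<inter> D)) \<union> (\<Union>n<N. B n)"
      proof eventually_elim
        case (elim x)
        show ?case
        proof
          assume "x \<in> S N"
          then obtain n where n: "n < N" "\<bar>U n (indicat_real D) x\<bar> > t" and x: "x \<in> space unit_leb"
            unfolding S_def by blast
          show "x \<in> max_set (t / 2 * \<mu> l) (indicat_real (G l \<inter> D)) \<union> (\<Union>n<N. B n)"
          proof (cases "\<bar>U n (indicat_real D) x - U n (F l) x\<bar> > t / 2")
            case True
            then show ?thesis using n x unfolding B_def by blast
          next
            case False
            then have "\<bar>U n (F l) x\<bar> > t / 2" using n by linarith
            then have "\<bar>U n (indicat_real (G l \<inter> D)) x\<bar> > t / 2 * \<mu> l"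
              using elim \<mu>[of l] by (simp add: abs_mult pos_less_divide_eq)
            then show ?thesis using x unfolding max_set_def by blast
          qed
        qed
      qed
      then have "measure unit_leb (S N) \<le> measure unit_leb (max_set (t / 2 * \<mu> l) (indicat_real (G l \<inter> D)) \<union> (\<Union>n<N. B n))"
        using Bm Gm by (intro unit_leb.finite_measure_mono_AE) auto
      also have "\<dots> \<le> measure unit_leb (max_set (t / 2 * \<mu> l) (indicat_real (G l \<inter> D))) + measure unit_leb (\<Union>n<N. B n)"
        using Bm Gm by (intro measure_Un_le) auto
      also have "measure unit_leb (\<Union>n<N. B n) \<le> (\<Sum>n<N. measure unit_leb (B n))"
        using Bm by (intro measure_UNION_le) auto
      also have "\<dots> \<le> (\<Sum>n<N. (LINT x|unit_leb. \<bar>U n (indicat_real D) x - U n (F l) x\<bar>) / (t / 2))"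
        unfolding B_def using U_integrable iD iF t by (intro sum_mono Markov_abs) auto
      also have "measure unit_leb (max_set (t / 2 * \<mu> l) (indicat_real (G l \<inter> D)))
         \<le> 2 * \<beta> * (measure lebesgue (G l \<inter> D) / measure lebesgue (G l)) / t"
        using wt[of "t / 2 * \<mu> l" l] t \<mu>[of l] unfolding \<mu>_def[symmetric] by (simp add: field_simps)
      finally show ?thesis by simp
    qed
    then show "\<exists>N'. \<forall>l\<ge>N'. measure unit_leb (S N) \<le> 2 * \<beta> * (measure lebesgue (G l \<inter> D) / measure lebesgue (G l)) / t
         + (\<Sum>n<N. (LINT x|unit_leb. \<bar>U n (indicat_real D) x - U n (F l) x\<bar>) / (t / 2))" by blast
  qed
  have "incseq S" unfolding S_def incseq_def by (auto intro: less_le_trans)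
  then have "(\<lambda>N. measure unit_leb (S N)) \<longlonglongrightarrow> measure unit_leb (\<Union>N. S N)"
    using Sm by (intro unit_leb.finite_Lim_measure_incseq) auto
  moreover have "(\<Union>N. S N) = max_set t (indicat_real D)"
    unfolding S_def max_set_def by (auto intro: lessI)
  ultimately show ?thesis using SN by (auto intro: LIMSEQ_le_const2)
qed

section \<open>Corrected pieces on one cell\<close>

definition piece :: "real \<Rightarrow> real set \<Rightarrow> nat \<Rightarrow> real \<Rightarrow> real" where
  "piece a D l x = a * (indicat_real D x - (1 / measure lebesgue (G l)) * indicat_real (G l \<inter> D) x)"

context
  fixes a :: real and D :: "real set"
  assumes D: "is_interval01 D"
begin

lemma D_sets: "D \<in> sets lebesgue" "D \<subseteq> {0..<1}"
  using is_interval01_sets[OF D] .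

lemma integrable_indicat_D: "integrable unit_leb (indicat_real D)"
  "integrable unit_leb (indicat_real (G l \<inter> D))"
  using D_sets G_sets by (auto intro!: integrable_indicat_unit_leb)

text \<open>The bound involves \<open>\<gamma>\<close> but not \<open>l\<close>, so the scale at
  which \<open>uniform_L1_small\<close> applies can be fixed before any index \<open>l\<close> is
  chosen.\<close>

lemma piece_bounded: "bounded_on_unit (\<bar>a\<bar> * (1 + 1 / \<gamma>)) (piece a D l)"
proof -
  have "\<bar>1 / measure lebesgue (G l)\<bar> \<le> 1 / \<gamma>"
    using G_pos[of l] \<gamma>_le[of l] \<gamma>_pos by (simp add: frac_le)
  then have "\<bar>indicat_real D x - (1 / measure lebesgue (G l)) * indicat_real (G l \<inter> D) x\<bar> \<le> 1 + 1 / \<gamma>" for x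
    using \<gamma>_pos by (cases "x \<in> D"; cases "x \<in> G l"; simp; linarith)
  then have "\<bar>piece a D l x\<bar> \<le> \<bar>a\<bar> * (1 + 1 / \<gamma>)" for x
    unfolding piece_def abs_mult by (intro mult_left_mono) auto
  moreover have "piece a D l \<in> borel_measurable unit_leb"
    unfolding piece_def using integrable_indicat_D
    by (intro borel_measurable_times borel_measurable_diff borel_measurable_const borel_measurable_integrable)
  ultimately show ?thesis unfolding bounded_on_unit_def by blast
qed

lemma piece_integrable: "integrable unit_leb (piece a D l)"
  using piece_bounded by (rule bounded_on_unit_integrable)

lemma U_piece:
  "AE x in unit_leb. \<forall>n. U n (piece a D l) x
     = a * (U n (indicat_real D) x - (1 / measure lebesgue (G l)) * U n (indicat_real (G l \<inter> D)) x)"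
  unfolding AE_all_countable
proof
  fix n
  have "AE x in unit_leb. U n (piece a D l) x
      = a * U n (\<lambda>x. indicat_real D x - (1 / measure lebesgue (G l)) * indicat_real (G l \<inter> D) x) x"
    unfolding piece_def using integrable_indicat_D by (intro U_cmult) auto
  moreover have "AE x in unit_leb. U n (\<lambda>x. indicat_real D x - (1 / measure lebesgue (G l)) * indicat_real (G l \<inter> D) x) x
     = U n (indicat_real D) x - U n (\<lambda>x. (1 / measure lebesgue (G l)) * indicat_real (G l \<inter> D) x) x"
    using integrable_indicat_D by (intro U_diff) auto
  moreover have "AE x in unit_leb. U n (\<lambda>x. (1 / measure lebesgue (G l)) * indicat_real (G l \<inter> D) x) x
     = (1 / measure lebesgue (G l)) * U n (indicat_real (G l \<inter> D)) x"
    by (intro U_cmult integrable_indicat_D)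
  ultimately show "AE x in unit_leb. U n (piece a D l) x
     = a * (U n (indicat_real D) x - (1 / measure lebesgue (G l)) * U n (indicat_real (G l \<inter> D)) x)"
    by eventually_elim simp
qed

lemma U_piece_tendsto: "(\<lambda>l. LINT x|unit_leb. \<bar>U n (piece a D l) x\<bar>) \<longlonglongrightarrow> 0"
proof -
  define F where "F l x = (1 / measure lebesgue (G l)) * indicat_real (G l \<inter> D) x" for l x
  have iF: "integrable unit_leb (F l)" for l unfolding F_def using integrable_indicat_D by auto
  have "(\<lambda>l. \<bar>a\<bar> * (LINT x|unit_leb. \<bar>U n (indicat_real D) x - U n (F l) x\<bar>)) \<longlonglongrightarrow> \<bar>a\<bar> * 0"
    using U_weak_L1[OF weak_Int[OF D_sets], of n] unfolding F_def by (intro tendsto_mult_left)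
  moreover have "\<bar>a\<bar> * (LINT x|unit_leb. \<bar>U n (indicat_real D) x - U n (F l) x\<bar>) = (LINT x|unit_leb. \<bar>U n (piece a D l) x\<bar>)" for l
  proof -
    have "AE x in unit_leb. U n (F l) x = (1 / measure lebesgue (G l)) * U n (indicat_real (G l \<inter> D)) x"
      unfolding F_def by (intro U_cmult integrable_indicat_D)
    then have ae: "AE x in unit_leb. \<bar>a\<bar> * \<bar>U n (indicat_real D) x - U n (F l) x\<bar> = \<bar>U n (piece a D l) x\<bar>"
      using U_piece[of l] by eventually_elim (simp add: abs_mult)
    have "\<bar>a\<bar> * (LINT x|unit_leb. \<bar>U n (indicat_real D) x - U n (F l) x\<bar>)
        = (LINT x|unit_leb. \<bar>a\<bar> * \<bar>U n (indicat_real D) x - U n (F l) x\<bar>)" by simp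
    also have "\<dots> = (LINT x|unit_leb. \<bar>U n (piece a D l) x\<bar>)"
      using ae U_measurable[OF integrable_indicat_D(1), of n] U_measurable[OF iF, of n l] U_measurable[OF piece_integrable, of n l]
      by (intro integral_cong_AE) auto
    finally show ?thesis .
  qed
  ultimately show ?thesis by simp
qed

lemma piece_conv_ae:
  assumes Q
  shows "conv_ae (piece a D l)"
proof -
  obtain \<D> where \<D>: "finite \<D>" "\<And>I. I \<in> \<D> \<Longrightarrow> is_interval01 I" "G l = \<Union>\<D>"
    using G_fin[of l] unfolding finite_interval_set_def by blast
  have c: "conv_ae (indicat_real (G l \<inter> D))"
    unfolding \<D>(3) using conv_ae_intervals[OF Q_C[OF assms] \<D>(1,2) D] by blast
  have "conv_ae (\<lambda>x. a * (indicat_real D x + (- (1 / measure lebesgue (G l))) * indicat_real (G l \<inter> D) x))"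
    using integrable_indicat_D
    by (intro conv_ae_cmult conv_ae_add conv_ae_interval[OF Q_C[OF assms] D] c Bochner_Integration.integrable_add integrable_mult_right)
  moreover have "(\<lambda>x. a * (indicat_real D x + (- (1 / measure lebesgue (G l))) * indicat_real (G l \<inter> D) x)) = piece a D l"
    unfolding piece_def by (auto simp: fun_eq_iff)
  ultimately show ?thesis by simp
qed

text \<open>Of the factor 3, one unit is due to \<open>D\<close> and two to the subtracted part,
  since \<open>G l\<close> is allowed twice its fair share of \<open>D\<close>.\<close>

lemma piece_norm:
  assumes "measure lebesgue (G l \<inter> D) \<le> 2 * measure lebesgue D * measure lebesgue (G l)"
  shows "(LINT x|unit_leb. \<bar>piece a D l x\<bar>) \<le> 3 * \<bar>a\<bar> * measure lebesgue D"
proof -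
  define \<mu> where "\<mu> = measure lebesgue (G l)"
  have \<mu>: "\<mu> > 0" unfolding \<mu>_def by (rule G_pos)
  have "(LINT x|unit_leb. \<bar>piece a D l x\<bar>) \<le> (LINT x|unit_leb. \<bar>a\<bar> * indicat_real D x + \<bar>a\<bar> / \<mu> * indicat_real (G l \<inter> D) x)"
  proof (rule integral_mono)
    show "integrable unit_leb (\<lambda>x. \<bar>piece a D l x\<bar>)" using piece_integrable by simp
    show "integrable unit_leb (\<lambda>x. \<bar>a\<bar> * indicat_real D x + \<bar>a\<bar> / \<mu> * indicat_real (G l \<inter> D) x)"
      by (intro Bochner_Integration.integrable_add integrable_mult_right integrable_indicat_D)
    show "\<bar>piece a D l x\<bar> \<le> \<bar>a\<bar> * indicat_real D x + \<bar>a\<bar> / \<mu> * indicat_real (G l \<inter> D) x" for x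
    proof -
      have "\<bar>piece a D l x\<bar> \<le> \<bar>a\<bar> * (indicat_real D x + (1 / \<mu>) * indicat_real (G l \<inter> D) x)"
        unfolding piece_def \<mu>_def[symmetric] abs_mult using \<mu>
        by (intro mult_left_mono order_trans[OF abs_triangle_ineq4]) auto
      then show ?thesis by (simp add: algebra_simps)
    qed
  qed
  also have "\<dots> = (LINT x|unit_leb. \<bar>a\<bar> * indicat_real D x) + (LINT x|unit_leb. \<bar>a\<bar> / \<mu> * indicat_real (G l \<inter> D) x)"
    by (intro Bochner_Integration.integral_add integrable_mult_right integrable_indicat_D)
  also have "\<dots> = \<bar>a\<bar> * measure lebesgue D + \<bar>a\<bar> / \<mu> * measure lebesgue (G l \<inter> D)"
  proof -
    have "(LINT x|unit_leb. indicat_real (G l \<inter> D) x) = measure lebesgue (G l \<inter> D)"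
      using D_sets G_sets[of l] by (intro integral_indicat_unit_leb) auto
    then show ?thesis using integral_indicat_unit_leb[OF D_sets]
      by (subst (1 2) integral_mult_right_zero) simp
  qed
  also have "\<dots> \<le> \<bar>a\<bar> * measure lebesgue D + \<bar>a\<bar> / \<mu> * (2 * measure lebesgue D * \<mu>)"
    using assms \<mu> unfolding \<mu>_def[symmetric] by (intro add_left_mono mult_left_mono) auto
  also have "\<dots> = 3 * \<bar>a\<bar> * measure lebesgue D" using \<mu> by simp
  finally show ?thesis .
qed

text \<open>If a difference exceeds twice a level, one of its terms exceeds the level. Each term
  contributes 2\<beta>: the one for \<open>D\<close> through \<open>max_set_indicat\<close>, the one
  for \<open>G l \<inter> D\<close> through \<open>wt\<close> and the factor 2 in
  \<open>ratio\<close>. The level is divided by the modulus of \<open>a\<close>, hence the separate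
  case \<open>a = 0\<close>.\<close>

lemma piece_weak_type:
  assumes t: "t > 0"
    and ratio: "measure lebesgue (G l \<inter> D) \<le> 2 * measure lebesgue D * measure lebesgue (G l)"
    and wt: "\<And>s l. s > 0 \<Longrightarrow> s * measure unit_leb (max_set s (indicat_real (G l \<inter> D))) \<le> \<beta> * measure lebesgue (G l \<inter> D)"
  shows "measure unit_leb (max_set (2 * t) (piece a D l)) \<le> 4 * \<beta> * (\<bar>a\<bar> * measure lebesgue D) / t"
proof (cases "a = 0")
  case True
  have "AE x in unit_leb. x \<notin> max_set (2 * t) (piece a D l)"
    using U_piece[of l] by eventually_elim (use t True in \<open>simp add: max_set_def\<close>)
  then have "measure unit_leb (max_set (2 * t) (piece a D l)) = 0"
    using sets_max_set[OF piece_integrable] by (intro measure_eq_0_null_sets) (subst AE_iff_null_sets, auto)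
  then show ?thesis using \<beta>_nonneg t by simp
next
  case False
  define \<mu> where "\<mu> = measure lebesgue (G l)"
  have \<mu>: "\<mu> > 0" unfolding \<mu>_def by (rule G_pos)
  define s where "s = t / \<bar>a\<bar>"
  have s: "s > 0" unfolding s_def using t False by simp
  have "AE x in unit_leb. x \<in> max_set (2 * t) (piece a D l) \<longrightarrow>
      x \<in> max_set s (indicat_real D) \<union> max_set (s * \<mu>) (indicat_real (G l \<inter> D))"
    using U_piece[of l]
  proof eventually_elim
    case (elim x)
    show ?case
    proof
      assume "x \<in> max_set (2 * t) (piece a D l)"
      then obtain n where x: "x \<in> space unit_leb" and n: "\<bar>U n (piece a D l) x\<bar> > 2 * t"
        unfolding max_set_def by blast
      define u v where "u = U n (indicat_real D) x" and "v = U n (indicat_real (G l \<inter> D)) x"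
      have "\<bar>a\<bar> * \<bar>u - (1 / \<mu>) * v\<bar> > 2 * t"
        using n elim unfolding u_def v_def \<mu>_def by (simp add: abs_mult)
      then have "\<bar>u - (1 / \<mu>) * v\<bar> > 2 * s"
        unfolding s_def using False by (simp add: field_simps)
      then have "\<bar>u\<bar> > s \<or> \<bar>(1 / \<mu>) * v\<bar> > s" by linarith
      then have "\<bar>u\<bar> > s \<or> \<bar>v\<bar> > s * \<mu>" using \<mu> by (simp add: abs_mult pos_less_divide_eq)
      then show "x \<in> max_set s (indicat_real D) \<union> max_set (s * \<mu>) (indicat_real (G l \<inter> D))"
        using x unfolding max_set_def u_def v_def by blast
    qed
  qed
  then have "measure unit_leb (max_set (2 * t) (piece a D l))
      \<le> measure unit_leb (max_set s (indicat_real D) \<union> max_set (s * \<mu>) (indicat_real (G l \<inter> D)))"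
    by (intro unit_leb.finite_measure_mono_AE sets.Un sets_max_set integrable_indicat_D)
  also have "\<dots> \<le> measure unit_leb (max_set s (indicat_real D)) + measure unit_leb (max_set (s * \<mu>) (indicat_real (G l \<inter> D)))"
    by (intro measure_Un_le sets_max_set integrable_indicat_D)
  also have "measure unit_leb (max_set s (indicat_real D)) \<le> 2 * \<beta> * measure lebesgue D / s"
    using wt by (intro max_set_indicat D_sets s)
  also have "measure unit_leb (max_set (s * \<mu>) (indicat_real (G l \<inter> D))) \<le> \<beta> * measure lebesgue (G l \<inter> D) / (s * \<mu>)"
    using wt[of "s * \<mu>" l] s \<mu> by (simp add: pos_le_divide_eq mult.commute)
  also have "\<beta> * measure lebesgue (G l \<inter> D) / (s * \<mu>) \<le> \<beta> * (2 * measure lebesgue D * \<mu>) / (s * \<mu>)"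
    using ratio \<beta>_nonneg s \<mu> unfolding \<mu>_def[symmetric] by (intro divide_right_mono mult_left_mono) auto
  also have "\<dots> = 2 * \<beta> * measure lebesgue D / s" using \<mu> by simp
  also have "2 * \<beta> * measure lebesgue D / s + 2 * \<beta> * measure lebesgue D / s = 4 * \<beta> * (\<bar>a\<bar> * measure lebesgue D) / t"
    unfolding s_def using False t by (simp add: field_simps)
  finally show ?thesis by simp
qed

text \<open>Given \<open>N\<close>, compactness for the finitely many n < \<open>N\<close> provides
  \<open>l\<close>; after that, convergence for this one fixed piece provides \<open>N'\<close>. For
  indices from \<open>N\<close> up to \<open>N'\<close> nothing is claimed about the images.\<close>

lemma piece_choice:
  assumes \<eta>: "\<eta> > 0"
  shows "\<exists>l N'. N' \<ge> N
    \<and> measure lebesgue (G l \<inter> D) \<le> 2 * measure lebesgue D * measure lebesgue (G l)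
    \<and> (\<forall>n<N. (LINT x|unit_leb. \<bar>U n (piece a D l) x\<bar>) \<le> \<eta>)
    \<and> measure unit_leb {x \<in> space unit_leb. \<exists>n<N. \<bar>U n (piece a D l) x\<bar> > \<eta>} \<le> \<eta>
    \<and> (\<forall>n\<ge>N'. (LINT x|unit_leb. \<bar>U n (piece a D l) x - piece a D l x\<bar>) \<le> \<eta>)
    \<and> (Q \<longrightarrow> measure unit_leb {x \<in> space unit_leb. \<exists>n\<ge>N'. \<bar>U n (piece a D l) x - piece a D l x\<bar> > \<eta>} \<le> \<eta>)"
proof -
  have Dpos: "measure lebesgue D > 0"
    using D unfolding is_interval01_def by auto
  define T where "T l = (\<Sum>n<N. (LINT x|unit_leb. \<bar>U n (piece a D l) x\<bar>))" for l
  have "T \<longlonglongrightarrow> (\<Sum>n<N. 0)" unfolding T_def by (intro tendsto_sum U_piece_tendsto)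
  then have T0: "T \<longlonglongrightarrow> 0" by simp
  \<comment> \<open>Below \<open>\<eta>\<close> the sum bounds every norm in it; below
    \<open>\<eta> * \<eta>\<close> Markov's inequality bounds the measure of the bad set by
    \<open>\<eta>\<close>.\<close>
  have "eventually (\<lambda>l. T l < min \<eta> (\<eta> * \<eta>)) sequentially"
    using T0 \<eta> by (intro order_tendstoD) auto
  moreover have "eventually (\<lambda>l. measure lebesgue (G l \<inter> D) / measure lebesgue (G l) < 2 * measure lebesgue D) sequentially"
    using ratio_tendsto[OF D_sets] Dpos by (intro order_tendstoD) auto
  ultimately have "eventually (\<lambda>l. T l < min \<eta> (\<eta> * \<eta>) \<and> measure lebesgue (G l \<inter> D) / measure lebesgue (G l) < 2 * measure lebesgue D) sequentially"
    by (rule eventually_conj)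
  then obtain l where l: "T l < min \<eta> (\<eta> * \<eta>)" "measure lebesgue (G l \<inter> D) / measure lebesgue (G l) < 2 * measure lebesgue D"
    by (auto simp: eventually_sequentially)
  note iu = U_integrable[OF piece_integrable]
  have [measurable]: "U n (piece a D l) \<in> borel_measurable unit_leb" "piece a D l \<in> borel_measurable unit_leb" for n
    using iu piece_integrable by auto
  have small: "(LINT x|unit_leb. \<bar>U n (piece a D l) x\<bar>) \<le> \<eta>" if "n < N" for n
  proof -
    have "(LINT x|unit_leb. \<bar>U n (piece a D l) x\<bar>) \<le> T l"
      unfolding T_def using that by (intro member_le_sum[where f = "\<lambda>n. LINT x|unit_leb. \<bar>U n (piece a D l) x\<bar>"]) auto
    then show ?thesis using l by simp
  qed
  have bad: "measure unit_leb {x \<in> space unit_leb. \<exists>n<N. \<bar>U n (piece a D l) x\<bar> > \<eta>} \<le> \<eta>"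
  proof -
    have "{x \<in> space unit_leb. \<exists>n<N. \<bar>U n (piece a D l) x\<bar> > \<eta>} = (\<Union>n<N. {x \<in> space unit_leb. \<bar>U n (piece a D l) x\<bar> > \<eta>})"
      by auto
    then have "measure unit_leb {x \<in> space unit_leb. \<exists>n<N. \<bar>U n (piece a D l) x\<bar> > \<eta>}
       \<le> (\<Sum>n<N. measure unit_leb {x \<in> space unit_leb. \<bar>U n (piece a D l) x\<bar> > \<eta>})"
      by (simp only:) (intro measure_UNION_le finite_lessThan, measurable)
    also have "\<dots> \<le> (\<Sum>n<N. (LINT x|unit_leb. \<bar>U n (piece a D l) x\<bar>) / \<eta>)"
      by (intro sum_mono Markov_abs iu \<eta>)
    also have "\<dots> = T l / \<eta>" unfolding T_def by (simp add: sum_divide_distrib)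
    also have "\<dots> \<le> \<eta>" using l(1) \<eta> by (simp add: pos_divide_le_eq)
    finally show ?thesis .
  qed
  have "eventually (\<lambda>N'. \<forall>n\<ge>N'. (LINT x|unit_leb. \<bar>U n (piece a D l) x - piece a D l x\<bar>) < \<eta>) sequentially"
    using L1_conv[OF piece_bounded] \<eta> by (intro eventually_all_ge_at_top order_tendstoD) auto
  moreover have "eventually (\<lambda>N'. Q \<longrightarrow> measure unit_leb {x \<in> space unit_leb. \<exists>n\<ge>N'. \<bar>U n (piece a D l) x - piece a D l x\<bar> > \<eta>} < \<eta>) sequentially"
  proof (cases Q)
    case True
    have "(\<lambda>N'. measure unit_leb {x \<in> space unit_leb. \<exists>n\<ge>N'. \<bar>U n (piece a D l) x - piece a D l x\<bar> > \<eta>}) \<longlonglongrightarrow> 0"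
    proof (rule tail_measure_tendsto_0[OF _ _ _ \<eta>])
      show "finite_measure unit_leb" by unfold_locales
      show "AE x in unit_leb. (\<lambda>n. U n (piece a D l) x - piece a D l x) \<longlonglongrightarrow> 0"
        using piece_conv_ae[OF True, of l] unfolding conv_ae_def by (simp add: LIM_zero_iff)
    qed measurable
    then show ?thesis using \<eta> order_tendstoD(2) by fastforce
  qed simp
  moreover have "eventually (\<lambda>N'. N' \<ge> N) sequentially" by (rule eventually_ge_at_top)
  ultimately have "eventually (\<lambda>N'. N' \<ge> N \<and> (\<forall>n\<ge>N'. (LINT x|unit_leb. \<bar>U n (piece a D l) x - piece a D l x\<bar>) \<le> \<eta>)
     \<and> (Q \<longrightarrow> measure unit_leb {x \<in> space unit_leb. \<exists>n\<ge>N'. \<bar>U n (piece a D l) x - piece a D l x\<bar> > \<eta>} \<le> \<eta>)) sequentially"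
    by eventually_elim (auto intro: less_imp_le)
  then obtain N' where "N' \<ge> N" "\<forall>n\<ge>N'. (LINT x|unit_leb. \<bar>U n (piece a D l) x - piece a D l x\<bar>) \<le> \<eta>"
     "Q \<longrightarrow> measure unit_leb {x \<in> space unit_leb. \<exists>n\<ge>N'. \<bar>U n (piece a D l) x - piece a D l x\<bar> > \<eta>} \<le> \<eta>"
    by (auto simp: eventually_sequentially)
  moreover have "measure lebesgue (G l \<inter> D) \<le> 2 * measure lebesgue D * measure lebesgue (G l)"
    using l(2) G_pos[of l] by (simp add: pos_divide_less_eq)
  ultimately show ?thesis using small bad by blast
qed

end

end

text \<open>The ranges from \<open>N j\<close> up to \<open>N (Suc j)\<close> are disjoint, so
  \<open>n\<close> falls into at most one of them, and \<open>i\<close> is its index. If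
  \<open>n\<close> is beyond all thresholds, any \<open>i\<close> will do.\<close>

lemma mono_separating_index:
  fixes N :: "nat \<Rightarrow> nat"
  assumes "\<And>i. N i \<le> N (Suc i)"
  shows "\<exists>i. \<forall>j. j \<noteq> i \<longrightarrow> n < N j \<or> N (Suc j) \<le> n"
proof (cases "\<exists>i. n < N (Suc i)")
  case True
  define i where "i = (LEAST i. n < N (Suc i))"
  have i: "n < N (Suc i)" unfolding i_def using True by (rule LeastI_ex)
  have "n < N j" if "j > i" for j
    using i lift_Suc_mono_le[of N, OF assms, of "Suc i" j] that by auto
  moreover have "N (Suc j) \<le> n" if "j < i" for j
    using not_less_Least[of j "\<lambda>i. n < N (Suc i)"] that unfolding i_def by auto
  ultimately show ?thesis by (metis nat_neq_iff)
qed (auto simp: not_less)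

lemma bounded_on_unit_mono: "bounded_on_unit A f \<Longrightarrow> A \<le> B \<Longrightarrow> bounded_on_unit B f"
  unfolding bounded_on_unit_def by force

section \<open>Correction of one continuous function\<close>

context correction_sets
begin

text \<open>The factor 3 in the norms is that of \<open>piece_norm\<close>. In the maximal estimate
  the 3 comes from Markov's inequality for the sum of the moduli of the pieces, and 4\<beta> from
  \<open>piece_weak_type\<close>. Levels below \<open>\<delta>\<close> are excluded so that the
  accumulated errors can be absorbed into \<open>t\<close>.\<close>

lemma correction:
  fixes d :: "real \<Rightarrow> real"
  assumes d: "continuous_on UNIV d" and \<delta>: "\<delta> > 0"
  shows "\<exists>E g A. E \<in> sets lebesgue \<and> E \<subseteq> {0..<1} \<and> measure lebesgue E \<le> 2 * e \<and> bounded_on_unit A g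
    \<and> (\<forall>x\<in>{0<..<1} - E. \<bar>d x - g x\<bar> \<le> \<delta>)
    \<and> (LINT x|unit_leb. \<bar>g x\<bar>) \<le> 3 * (LINT x|unit_leb. \<bar>d x\<bar>) + \<delta>
    \<and> (\<forall>n. (LINT x|unit_leb. \<bar>U n g x\<bar>) \<le> 3 * (LINT x|unit_leb. \<bar>d x\<bar>) + \<delta>)
    \<and> (Q \<longrightarrow> conv_ae g)
    \<and> (Q \<longrightarrow> (\<forall>t\<ge>\<delta>. measure unit_leb (max_set (4 * t) g)
           \<le> (3 + 4 * \<beta>) * ((LINT x|unit_leb. \<bar>d x\<bar>) + \<delta>) / t + \<delta>))"
proof -
  have id: "integrable unit_leb d" using d by (rule continuous_imp_integrable_unit_leb)
  have "compact (d ` {0..1})"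
    by (intro compact_continuous_image continuous_on_subset[OF d]) auto
  then obtain B where B: "\<And>x. x \<in> {0..1} \<Longrightarrow> \<bar>d x\<bar> \<le> B"
    unfolding compact_eq_bounded_closed bounded_iff by (auto simp del: atLeastAtMost_iff)
  have B0: "B \<ge> 0" using B[of 0] by simp
  \<comment> \<open>A bound for all pieces, whatever the grid and the indices \<open>l\<close>; it
    allows \<open>\<tau>\<close> to be fixed before \<open>m\<close>.\<close>
  define A0 where "A0 = B * (1 + 1 / \<gamma>)"
  have "A0 \<ge> 0" unfolding A0_def using B0 \<gamma>_pos by simp
  then obtain \<tau> where \<tau>: "\<tau> > 0" and UI: "\<And>h F n. bounded_on_unit A0 h \<Longrightarrow> F \<in> sets lebesgue \<Longrightarrow> F \<subseteq> {0..<1} \<Longrightarrow>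
      measure lebesgue F \<le> \<tau> \<Longrightarrow> (\<And>x. x \<notin> F \<Longrightarrow> h x = 0) \<Longrightarrow> (LINT x|unit_leb. \<bar>U n h x\<bar>) \<le> \<delta> / 4"
    using uniform_L1_small[of A0 "\<delta> / 4"] \<delta> by (metis zero_less_divide_iff zero_less_numeral)
  have \<delta>6: "\<delta> / 6 > 0" using \<delta> by simp
  obtain m0 where m0: "m0 > 0" "\<And>m x. m \<ge> m0 \<Longrightarrow> 0 \<le> x \<Longrightarrow> x < 1 \<Longrightarrow>
     \<bar>d x - (\<Sum>j<m. d (real j / real m) * indicat_real (grid_cell m j) x)\<bar> \<le> \<delta> / 6"
    using continuous_grid_approx[OF d \<delta>6] by blast
  obtain m1 where m1: "1 / \<tau> < real m1" using reals_Archimedean2 by blast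
  \<comment> \<open>The grid must be fine enough for \<open>d\<close>, have cells of measure at most
    \<open>\<tau>\<close> so that a single piece has small images, and belong to \<open>L\<close>,
    where \<open>Q_D\<close> is available.\<close>
  obtain m where mL: "m \<in> L" and "m \<ge> max m0 m1"
    using L_inf unfolding infinite_nat_iff_unbounded_le by blast
  then have m: "m \<ge> m0" "m \<ge> m1" by auto
  have mp: "m > 0" using m m0 by simp
  have "1 / \<tau> < real m" using m1 m(2) by linarith
  then have m\<tau>: "1 / real m \<le> \<tau>" using \<tau> mp by (simp add: field_simps)
  define a where "a j = d (real j / real m)" for j
  define D where "D j = grid_cell m j" for j
  have Dint: "is_interval01 (D j)" if "j < m" for j unfolding D_def using that by (rule is_interval01_grid_cell)
  have Dm: "measure lebesgue (D j) = 1 / real m" for j unfolding D_def using mp by (rule measure_grid_cell)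
  have ab: "\<bar>a j\<bar> \<le> B" if "j < m" for j unfolding a_def using that by (intro B) (auto simp: divide_simps)
  \<comment> \<open>There are \<open>m\<close> pieces, so errors of size \<open>\<eta>\<close> add
    up to \<delta>/4.\<close>
  define \<eta> where "\<eta> = \<delta> / (4 * real m)"
  have \<eta>: "\<eta> > 0" unfolding \<eta>_def using \<delta> mp by simp
  have m\<eta>: "real m * \<eta> = \<delta> / 4" unfolding \<eta>_def using mp by simp
  \<comment> \<open>Guarded by \<open>j < m\<close>, so that choice functions exist for all
    \<open>j\<close> and the thresholds can be defined by plain recursion on the natural
    numbers.\<close>
  define R where "R j N l N' \<longleftrightarrow> (j < m \<longrightarrow> 
      measure lebesgue (G l \<inter> D j) \<le> 2 * measure lebesgue (D j) * measure lebesgue (G l)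
    \<and> (\<forall>n<N. (LINT x|unit_leb. \<bar>U n (piece (a j) (D j) l) x\<bar>) \<le> \<eta>)
    \<and> measure unit_leb {x \<in> space unit_leb. \<exists>n<N. \<bar>U n (piece (a j) (D j) l) x\<bar> > \<eta>} \<le> \<eta>
    \<and> (\<forall>n\<ge>N'. (LINT x|unit_leb. \<bar>U n (piece (a j) (D j) l) x - piece (a j) (D j) l x\<bar>) \<le> \<eta>)
    \<and> (Q \<longrightarrow> measure unit_leb {x \<in> space unit_leb. \<exists>n\<ge>N'. \<bar>U n (piece (a j) (D j) l) x - piece (a j) (D j) l x\<bar> > \<eta>} \<le> \<eta>))"
    for j N l N'
  have "\<exists>l N'. N' \<ge> N \<and> R j N l N'" for j N
  proof (cases "j < m")
    case True
    show ?thesis using piece_choice[OF Dint[OF True] \<eta>, of N "a j"] unfolding R_def by blast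
  next
    case False
    then show ?thesis unfolding R_def by blast
  qed
  then have "\<forall>j N. \<exists>l N'. N' \<ge> N \<and> R j N l N'" by blast
  then obtain lf nf where lf: "\<And>j N. nf j N \<ge> N \<and> R j N (lf j N) (nf j N)"
    unfolding choice_iff by blast
  define N where "N = rec_nat 0 nf"
  have NS: "N (Suc j) = nf j (N j)" for j unfolding N_def by simp
  define l where "l j = lf j (N j)" for j
  have Nmono: "N j \<le> N (Suc j)" for j unfolding NS using lf by blast
  have RN: "R j (N j) (l j) (N (Suc j))" for j unfolding NS l_def using lf by blast
  define p where "p j = piece (a j) (D j) (l j)" for j
  have ratio: "measure lebesgue (G (l j) \<inter> D j) \<le> 2 * measure lebesgue (D j) * measure lebesgue (G (l j))"
    and p1: "\<And>n. n < N j \<Longrightarrow> (LINT x|unit_leb. \<bar>U n (p j) x\<bar>) \<le> \<eta>"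
    and p2: "measure unit_leb {x \<in> space unit_leb. \<exists>n<N j. \<bar>U n (p j) x\<bar> > \<eta>} \<le> \<eta>"
    and p3: "\<And>n. n \<ge> N (Suc j) \<Longrightarrow> (LINT x|unit_leb. \<bar>U n (p j) x - p j x\<bar>) \<le> \<eta>"
    and p4: "Q \<Longrightarrow> measure unit_leb {x \<in> space unit_leb. \<exists>n\<ge>N (Suc j). \<bar>U n (p j) x - p j x\<bar> > \<eta>} \<le> \<eta>"
    if "j < m" for j
    using RN[of j] that unfolding R_def p_def by blast+
  have ip: "integrable unit_leb (p j)" if "j < m" for j
    unfolding p_def by (rule piece_integrable[OF Dint[OF that]])
  have iup: "integrable unit_leb (U n (p j))" if "j < m" for j n
    using ip[OF that] by (rule U_integrable)
  have pb: "bounded_on_unit A0 (p j)" if "j < m" for j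
    unfolding p_def A0_def using ab[OF that] \<gamma>_pos
    by (intro bounded_on_unit_mono[OF piece_bounded[OF Dint[OF that]]] mult_right_mono) auto
  define S where "S = (\<Sum>j<m. \<bar>a j\<bar> * (1 / real m))"
  have pn: "(LINT x|unit_leb. \<bar>p j x\<bar>) \<le> 3 * (\<bar>a j\<bar> * (1 / real m))" if "j < m" for j
    using piece_norm[OF Dint[OF that] ratio[OF that], of "a j"] unfolding p_def Dm by simp
  have pnS: "(\<Sum>j<m. (LINT x|unit_leb. \<bar>p j x\<bar>)) \<le> 3 * S"
    unfolding S_def sum_distrib_left using pn by (intro sum_mono) auto
  have approx: "\<bar>d x - a (nat \<lfloor>x * real m\<rfloor>)\<bar> \<le> \<delta> / 6" if "0 \<le> x" "x < 1" for x
    using m0(2)[OF m(1) that] sum_grid_cell(1)[OF mp that, of a] unfolding a_def by simp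
  \<comment> \<open>\<open>S\<close> is a Riemann sum for the L1 norm of \<open>d\<close>: the step
    function with values \<open>\<bar>a j\<bar>\<close> is within \<delta>/6 of the modulus of
    \<open>d\<close> at every point.\<close>
  have Sd: "S \<le> (LINT x|unit_leb. \<bar>d x\<bar>) + \<delta> / 6"
  proof -
    have iD: "integrable unit_leb (indicat_real (D j))" for j
      unfolding D_def by (intro integrable_indicat_unit_leb) simp
    have "S = (\<Sum>j<m. \<bar>a j\<bar> * (LINT x|unit_leb. indicat_real (D j) x))"
      unfolding S_def using Dm is_interval01_sets[OF Dint] by (intro sum.cong) (auto simp: integral_indicat_unit_leb simp del: Bochner_Integration.integral_indicator)
    also have "\<dots> = (\<Sum>j<m. (LINT x|unit_leb. \<bar>a j\<bar> * indicat_real (D j) x))"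
      by (simp only: integral_mult_right_zero)
    also have "\<dots> = (LINT x|unit_leb. (\<Sum>j<m. \<bar>a j\<bar> * indicat_real (D j) x))"
      by (rule Bochner_Integration.integral_sum[symmetric]) (intro integrable_mult_right iD)
    also have "\<dots> \<le> (LINT x|unit_leb. \<bar>d x\<bar> + \<delta> / 6)"
    proof (rule integral_mono)
      show "integrable unit_leb (\<lambda>x. \<Sum>j<m. \<bar>a j\<bar> * indicat_real (D j) x)"
        by (intro Bochner_Integration.integrable_sum integrable_mult_right iD)
      show "integrable unit_leb (\<lambda>x. \<bar>d x\<bar> + \<delta> / 6)" using id by simp
      fix x assume "x \<in> space unit_leb"
      then have x: "0 \<le> x" "x < 1" by auto
      show "(\<Sum>j<m. \<bar>a j\<bar> * indicat_real (D j) x) \<le> \<bar>d x\<bar> + \<delta> / 6"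
        using approx[OF x] sum_grid_cell(1)[OF mp x, of "\<lambda>j. \<bar>a j\<bar>"] unfolding D_def by linarith
    qed
    also have "\<dots> = (LINT x|unit_leb. \<bar>d x\<bar>) + \<delta> / 6" using id by (simp add: unit_leb.prob_space[unfolded space_unit_leb])
    finally show ?thesis .
  qed
  define g where "g x = (\<Sum>j<m. p j x)" for x
  \<comment> \<open>Off this set all subtracted parts vanish and \<open>g\<close> is the step
    function that approximates \<open>d\<close>.\<close>
  define E where "E = (\<Union>j<m. G (l j) \<inter> D j)"
  have Es: "G (l j) \<inter> D j \<in> sets lebesgue" for j
    using G_sets unfolding D_def by auto
  have E1: "E \<in> sets lebesgue" unfolding E_def using Es by auto
  have E2: "E \<subseteq> {0..<1}" unfolding E_def using is_interval01_sets(2)[OF Dint] by blast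
  have E3: "measure lebesgue E \<le> 2 * e"
  proof -
    have "measure lebesgue E \<le> (\<Sum>j<m. measure lebesgue (G (l j) \<inter> D j))"
      unfolding E_def using Es by (intro measure_UNION_le) auto
    also have "\<dots> \<le> (\<Sum>j<m. 2 * (1 / real m) * e)"
    proof (rule sum_mono)
      fix j assume "j \<in> {..<m}"
      then have "measure lebesgue (G (l j) \<inter> D j) \<le> 2 * (1 / real m) * measure lebesgue (G (l j))"
        using ratio[of j] Dm by simp
      also have "\<dots> \<le> 2 * (1 / real m) * e" by (intro mult_left_mono G_le) auto
      finally show "measure lebesgue (G (l j) \<inter> D j) \<le> 2 * (1 / real m) * e" .
    qed
    also have "\<dots> = 2 * e" using mp by simp
    finally show ?thesis .
  qed
  have gb: "bounded_on_unit (\<Sum>j<m. A0) g"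
    unfolding g_def using pb by (intro bounded_on_unit_sum) auto
  have gd: "\<bar>d x - g x\<bar> \<le> \<delta>" if "x \<in> {0<..<1} - E" for x
  proof -
    have x: "0 \<le> x" "x < 1" using that by auto
    have "g x = (\<Sum>j<m. a j * indicat_real (grid_cell m j) x)"
      unfolding g_def p_def piece_def D_def
    proof (rule sum.cong)
      fix j assume "j \<in> {..<m}"
      then have "x \<notin> G (l j) \<inter> grid_cell m j" using that unfolding E_def D_def by blast
      then have z: "indicat_real (G (l j) \<inter> grid_cell m j) x = 0" by (rule indicator_simps(2))
      show "a j * (indicat_real (grid_cell m j) x - 1 / measure lebesgue (G (l j)) * indicat_real (G (l j) \<inter> grid_cell m j) x)
         = a j * indicat_real (grid_cell m j) x" by (simp only: z mult_zero_right diff_zero)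
    qed simp
    then show ?thesis using approx[OF x] sum_grid_cell(1)[OF mp x, of a] \<delta> by linarith
  qed
  have gn: "(LINT x|unit_leb. \<bar>g x\<bar>) \<le> 3 * (LINT x|unit_leb. \<bar>d x\<bar>) + \<delta>"
  proof -
    have "(LINT x|unit_leb. \<bar>g x\<bar>) \<le> (\<Sum>j<m. (LINT x|unit_leb. \<bar>p j x\<bar>))"
      unfolding g_def using ip by (intro integral_abs_sum_le) auto
    then show ?thesis using pnS Sd \<delta> by linarith
  qed
  have Ug: "AE x in unit_leb. \<forall>n. U n g x = (\<Sum>j<m. U n (p j) x)"
    unfolding AE_all_countable g_def using ip by (intro allI U_sum) auto
  have Un: "(LINT x|unit_leb. \<bar>U n g x\<bar>) \<le> 3 * (LINT x|unit_leb. \<bar>d x\<bar>) + \<delta>" for n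
  proof -
    obtain i where i: "\<And>j. j \<noteq> i \<Longrightarrow> n < N j \<or> N (Suc j) \<le> n"
      using mono_separating_index[of N n, OF Nmono] by blast
    have "(LINT x|unit_leb. \<bar>U n g x\<bar>) = (LINT x|unit_leb. \<bar>\<Sum>j<m. U n (p j) x\<bar>)"
    proof (rule integral_cong_AE)
      show "AE x in unit_leb. \<bar>U n g x\<bar> = \<bar>\<Sum>j<m. U n (p j) x\<bar>" using Ug by eventually_elim simp
      show "(\<lambda>x. \<bar>U n g x\<bar>) \<in> borel_measurable unit_leb"
        using U_measurable[OF bounded_on_unit_integrable[OF gb]] by simp
      show "(\<lambda>x. \<bar>\<Sum>j<m. U n (p j) x\<bar>) \<in> borel_measurable unit_leb"
        using iup by (intro borel_measurable_abs borel_measurable_sum) auto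
    qed
    also have "\<dots> \<le> (\<Sum>j<m. LINT x|unit_leb. \<bar>U n (p j) x\<bar>)"
      using iup by (intro integral_abs_sum_le) auto
    \<comment> \<open>With \<open>n\<close> fixed, a piece with n < \<open>N j\<close> costs
      \<open>\<eta>\<close>, a piece with n \<ge> \<open>N (Suc j)\<close> costs its own norm plus
      \<open>\<eta>\<close>, and the remaining one at most \<delta>/4. These errors make \<delta>/2,
      and replacing 3S by three times the norm of \<open>d\<close> costs the other
      \<delta>/2.\<close>
    also have "\<dots> \<le> (\<Sum>j<m. (LINT x|unit_leb. \<bar>p j x\<bar>) + \<eta> + (if j = i then \<delta> / 4 else 0))"
    proof (rule sum_mono)
      fix j assume "j \<in> {..<m}"
      then have j: "j < m" by simp
      have nn: "(LINT x|unit_leb. \<bar>p j x\<bar>) \<ge> 0" by simp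
      consider "j = i" | "j \<noteq> i" "n < N j" | "j \<noteq> i" "N (Suc j) \<le> n" using i by blast
      then show "(LINT x|unit_leb. \<bar>U n (p j) x\<bar>) \<le> (LINT x|unit_leb. \<bar>p j x\<bar>) + \<eta> + (if j = i then \<delta> / 4 else 0)"
      proof cases
        case 1
        have "(LINT x|unit_leb. \<bar>U n (p j) x\<bar>) \<le> \<delta> / 4"
        proof (rule UI[OF pb[OF j]])
          show "measure lebesgue (D j) \<le> \<tau>" using Dm m\<tau> by simp
          show "x \<notin> D j \<Longrightarrow> p j x = 0" for x unfolding p_def piece_def by simp
        qed (use is_interval01_sets[OF Dint[OF j]] in auto)
        then show ?thesis unfolding if_P[OF 1] using nn \<eta> by linarith
      next
        case 2
        show ?thesis unfolding if_not_P[OF 2(1)] using p1[OF j 2(2)] nn by linarith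
      next
        case 3
        have "(LINT x|unit_leb. \<bar>U n (p j) x\<bar>) = (LINT x|unit_leb. \<bar>(U n (p j) x - p j x) + p j x\<bar>)" by simp
        also have "\<dots> \<le> (LINT x|unit_leb. \<bar>U n (p j) x - p j x\<bar>) + (LINT x|unit_leb. \<bar>p j x\<bar>)"
          using iup[OF j] ip[OF j] by (intro integral_abs_triangle) auto
        finally show ?thesis unfolding if_not_P[OF 3(1)] using p3[OF j 3(2)] by linarith
      qed
    qed
    also have "\<dots> = (\<Sum>j<m. (LINT x|unit_leb. \<bar>p j x\<bar>)) + real m * \<eta> + (if i < m then \<delta> / 4 else 0)"
      by (simp add: sum.distrib)
    also have "\<dots> \<le> 3 * S + \<delta> / 4 + \<delta> / 4" using pnS m\<eta> \<delta> by simp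
    also have "\<dots> \<le> 3 * (LINT x|unit_leb. \<bar>d x\<bar>) + \<delta>" using Sd by simp
    finally show ?thesis .
  qed
  have gc: "conv_ae g" if Q
    unfolding g_def using ip piece_conv_ae[OF Dint that] unfolding p_def by (intro conv_ae_sum) auto
  have mx: "measure unit_leb (max_set (4 * t) g) \<le> (3 + 4 * \<beta>) * ((LINT x|unit_leb. \<bar>d x\<bar>) + \<delta>) / t + \<delta>"
    if Q and t: "t \<ge> \<delta>" for t
  proof -
    have tp: "t > 0" using t \<delta> by linarith
    define H where "H x = (\<Sum>j<m. \<bar>p j x\<bar>)" for x
    have iH: "integrable unit_leb H" unfolding H_def using ip by (intro Bochner_Integration.integrable_sum) auto
    define B1 where "B1 j = {x \<in> space unit_leb. \<exists>n<N j. \<bar>U n (p j) x\<bar> > \<eta>}" for j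
    define B2 where "B2 j = {x \<in> space unit_leb. \<exists>n\<ge>N (Suc j). \<bar>U n (p j) x - p j x\<bar> > \<eta>}" for j
    define B3 where "B3 = {x \<in> space unit_leb. \<bar>H x\<bar> > t}"
    define B4 where "B4 j = max_set (2 * t) (p j)" for j
    have sets: "B1 j \<in> sets unit_leb" "B2 j \<in> sets unit_leb" "B4 j \<in> sets unit_leb" if "j < m" for j
    proof -
      have [measurable]: "p j \<in> borel_measurable unit_leb" "\<And>n. U n (p j) \<in> borel_measurable unit_leb"
        using ip[OF that] iup[OF that] by auto
      show "B1 j \<in> sets unit_leb" "B2 j \<in> sets unit_leb" unfolding B1_def B2_def by measurable
      show "B4 j \<in> sets unit_leb" unfolding B4_def using ip[OF that] by (rule sets_max_set)
    qed
    have B3s: "B3 \<in> sets unit_leb"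
    proof -
      have [measurable]: "H \<in> borel_measurable unit_leb" using iH by simp
      show ?thesis unfolding B3_def by measurable
    qed
    \<comment> \<open>Off \<open>V\<close>, whatever \<open>n\<close> is, the images of early pieces
      and the errors of late ones are at most \<open>\<eta>\<close>, the moduli of the pieces sum to
      at most \<open>t\<close>, and every maximal function of a piece is at most 2t. The last level
      is the same for all pieces, because only one of them is invoked at a time.\<close>
    define V where "V = ((\<Union>j<m. B1 j) \<union> (\<Union>j<m. B2 j)) \<union> (B3 \<union> (\<Union>j<m. B4 j))"
    have "AE x in unit_leb. x \<in> max_set (4 * t) g \<longrightarrow> x \<in> V"
      using Ug
    proof eventually_elim
      case (elim x)
      show ?case
      proof (intro impI, rule ccontr)
        assume "x \<in> max_set (4 * t) g" and nV: "x \<notin> V"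
        then obtain n where x: "x \<in> space unit_leb" and n: "\<bar>U n g x\<bar> > 4 * t" unfolding max_set_def by blast
        obtain i where i: "\<And>j. j \<noteq> i \<Longrightarrow> n < N j \<or> N (Suc j) \<le> n"
          using mono_separating_index[of N n, OF Nmono] by blast
        have "\<bar>U n g x\<bar> \<le> (\<Sum>j<m. \<bar>U n (p j) x\<bar>)" using elim by (simp add: sum_abs)
        also have "\<dots> \<le> (\<Sum>j<m. \<bar>p j x\<bar> + \<eta> + (if j = i then 2 * t else 0))"
        proof (rule sum_mono)
          fix j assume "j \<in> {..<m}"
          then have j: "j < m" by simp
          have nb: "x \<notin> B1 j" "x \<notin> B2 j" "x \<notin> B4 j" using nV j unfolding V_def by auto
          consider "j = i" | "j \<noteq> i" "n < N j" | "j \<noteq> i" "N (Suc j) \<le> n" using i by blast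
          then show "\<bar>U n (p j) x\<bar> \<le> \<bar>p j x\<bar> + \<eta> + (if j = i then 2 * t else 0)"
          proof cases
            case 1
            have "\<bar>U n (p j) x\<bar> \<le> 2 * t" using nb(3) x unfolding B4_def max_set_def mem_Collect_eq by (meson not_le)
            then show ?thesis using 1 \<eta> by simp
          next
            case 2
            have "\<bar>U n (p j) x\<bar> \<le> \<eta>" using nb(1) x 2 unfolding B1_def mem_Collect_eq by (meson not_le)
            then show ?thesis using 2 by simp
          next
            case 3
            have "\<bar>U n (p j) x - p j x\<bar> \<le> \<eta>" using nb(2) x 3 unfolding B2_def mem_Collect_eq by (meson not_le)
            then show ?thesis using 3 by simp
          qed
        qed
        \<comment> \<open>In total at most t + \<delta>/4 + 2t, which is below 4t because \<delta>
          \<le> t.\<close>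
        also have "\<dots> = H x + real m * \<eta> + (if i < m then 2 * t else 0)"
          unfolding H_def by (simp add: sum.distrib)
        also have "H x \<le> t" using nV x unfolding V_def B3_def by auto
        finally show False using n m\<eta> t tp \<delta> by (simp split: if_splits)
      qed
    qed
    moreover have Vs: "V \<in> sets unit_leb" unfolding V_def using sets B3s by auto
    ultimately have "measure unit_leb (max_set (4 * t) g) \<le> measure unit_leb V"
      by (rule unit_leb.finite_measure_mono_AE)
    also have "\<dots> \<le> (measure unit_leb (\<Union>j<m. B1 j) + measure unit_leb (\<Union>j<m. B2 j))
        + (measure unit_leb B3 + measure unit_leb (\<Union>j<m. B4 j))"
      unfolding V_def using sets B3s
      by (intro order_trans[OF measure_Un_le] add_mono measure_Un_le) auto
    also have "measure unit_leb (\<Union>j<m. B1 j) \<le> \<delta> / 4"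
    proof -
      have "measure unit_leb (\<Union>j<m. B1 j) \<le> (\<Sum>j<m. measure unit_leb (B1 j))"
        using sets by (intro measure_UNION_le) auto
      also have "\<dots> \<le> (\<Sum>j<m. \<eta>)" using p2 unfolding B1_def by (intro sum_mono) auto
      finally show ?thesis using m\<eta> by simp
    qed
    also have "measure unit_leb (\<Union>j<m. B2 j) \<le> \<delta> / 4"
    proof -
      have "measure unit_leb (\<Union>j<m. B2 j) \<le> (\<Sum>j<m. measure unit_leb (B2 j))"
        using sets by (intro measure_UNION_le) auto
      also have "\<dots> \<le> (\<Sum>j<m. \<eta>)" using p4[OF _ \<open>Q\<close>] unfolding B2_def by (intro sum_mono) auto
      finally show ?thesis using m\<eta> by simp
    qed
    also have "measure unit_leb B3 \<le> 3 * S / t"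
    proof -
      have "measure unit_leb B3 \<le> (LINT x|unit_leb. \<bar>H x\<bar>) / t"
        unfolding B3_def by (rule Markov_abs[OF iH tp])
      also have "(LINT x|unit_leb. \<bar>H x\<bar>) \<le> 3 * S"
      proof -
        have "(LINT x|unit_leb. \<bar>H x\<bar>) \<le> (\<Sum>j<m. LINT x|unit_leb. \<bar>\<bar>p j x\<bar>\<bar>)"
          unfolding H_def using ip by (intro integral_abs_sum_le) auto
        then show ?thesis using pnS by simp
      qed
      finally show ?thesis using tp by (simp add: divide_right_mono)
    qed
    also have "measure unit_leb (\<Union>j<m. B4 j) \<le> 4 * \<beta> * S / t"
    proof -
      have "measure unit_leb (\<Union>j<m. B4 j) \<le> (\<Sum>j<m. measure unit_leb (B4 j))"
        using sets by (intro measure_UNION_le) auto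
      also have "\<dots> \<le> (\<Sum>j<m. 4 * \<beta> * (\<bar>a j\<bar> * measure lebesgue (D j)) / t)"
      proof (rule sum_mono)
        fix j assume "j \<in> {..<m}"
        then have j: "j < m" by simp
        show "measure unit_leb (B4 j) \<le> 4 * \<beta> * (\<bar>a j\<bar> * measure lebesgue (D j)) / t"
          unfolding B4_def p_def
        proof (rule piece_weak_type[OF Dint[OF j] tp ratio[OF j]])
          fix s l assume "(s::real) > 0"
          then show "s * measure unit_leb (max_set s (indicat_real (G l \<inter> D j))) \<le> \<beta> * measure lebesgue (G l \<inter> D j)"
            unfolding D_def by (rule Q_D[OF \<open>Q\<close> mL j])
        qed
      qed
      also have "\<dots> = 4 * \<beta> * S / t" unfolding S_def Dm by (simp add: sum_distrib_left sum_divide_distrib)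
      finally show ?thesis .
    qed
    also have "\<delta> / 4 + \<delta> / 4 + (3 * S / t + 4 * \<beta> * S / t) = (3 + 4 * \<beta>) * S / t + \<delta> / 2"
      by (simp add: distrib_right add_divide_distrib)
    also have "\<dots> \<le> (3 + 4 * \<beta>) * ((LINT x|unit_leb. \<bar>d x\<bar>) + \<delta>) / t + \<delta>"
      using Sd \<beta>_nonneg tp \<delta> by (intro add_mono divide_right_mono mult_left_mono) auto
    finally show ?thesis by simp
  qed
  show ?thesis
    using E1 E2 E3 gb gd gn Un gc mx by blast
qed

end

section \<open>The correction theorem\<close>

context compact_approximation
begin

section \<open>Series of corrected functions\<close>

lemma U_sums_AE:
  assumes g: "integrable unit_leb g" and u: "\<And>j. integrable unit_leb (u j)"
    and lim: "(\<lambda>J. LINT x|unit_leb. \<bar>g x - (\<Sum>j<J. u j x)\<bar>) \<longlonglongrightarrow> 0"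
  shows "AE x in unit_leb. \<forall>n. (\<lambda>j. U n (u j) x) sums U n g x"
  unfolding AE_all_countable
proof
  fix n
  obtain C where C: "\<And>f. integrable unit_leb f \<Longrightarrow> AE x in unit_leb. \<bar>U n f x\<bar> \<le> C * (LINT x|unit_leb. \<bar>f x\<bar>)"
    using U_Linf_bound[of n] by blast
  have ints: "integrable unit_leb (\<lambda>x. \<Sum>j<J. u j x)" for J using u by simp
  have "AE x in unit_leb. \<forall>J. \<bar>U n g x - (\<Sum>j<J. U n (u j) x)\<bar> \<le> C * (LINT x|unit_leb. \<bar>g x - (\<Sum>j<J. u j x)\<bar>)"
    unfolding AE_all_countable
  proof
    fix J
    have "integrable unit_leb (\<lambda>x. g x - (\<Sum>j<J. u j x))" using g ints by simp
    from C[OF this] U_diff[OF g ints, of n J] U_sum[of "{..<J}" u n]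
    show "AE x in unit_leb. \<bar>U n g x - (\<Sum>j<J. U n (u j) x)\<bar> \<le> C * (LINT x|unit_leb. \<bar>g x - (\<Sum>j<J. u j x)\<bar>)"
      using u by (auto elim!: eventually_elim2)
  qed
  then show "AE x in unit_leb. (\<lambda>j. U n (u j) x) sums U n g x"
  proof eventually_elim
    case (elim x)
    have "(\<lambda>J. C * (LINT x|unit_leb. \<bar>g x - (\<Sum>j<J. u j x)\<bar>)) \<longlonglongrightarrow> C * 0"
      using lim by (intro tendsto_mult_left)
    then have "(\<lambda>J. C * (LINT x|unit_leb. \<bar>g x - (\<Sum>j<J. u j x)\<bar>)) \<longlonglongrightarrow> 0" by simp
    then have "(\<lambda>J. U n g x - (\<Sum>j<J. U n (u j) x)) \<longlonglongrightarrow> 0"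
      by (rule Lim_null_comparison[rotated]) (use elim in auto)
    then have "(\<lambda>J. U n g x - (U n g x - (\<Sum>j<J. U n (u j) x))) \<longlonglongrightarrow> U n g x - 0"
      by (intro tendsto_diff tendsto_const)
    then show ?case unfolding sums_def by simp
  qed
qed

text \<open>Two limits are interchanged. The sequence \<open>b\<close> bounds the norms of
  \<open>u j\<close> and of all its images, so 2b dominates the errors uniformly in
  \<open>n\<close>, as Tannery's theorem requires. The expansion of \<open>U n g\<close> is
  justified for fixed \<open>n\<close>: the remainder is multiplied by a constant depending on
  \<open>n\<close>, but \<open>J\<close> tends to infinity first.\<close>

lemma L1_conv_series:
  assumes g: "integrable unit_leb g" and u: "\<And>j. bounded_on_unit (A j) (u j)"
    and lim: "(\<lambda>J. LINT x|unit_leb. \<bar>g x - (\<Sum>j<J. u j x)\<bar>) \<longlonglongrightarrow> 0"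
    and b: "\<And>j. (LINT x|unit_leb. \<bar>u j x\<bar>) \<le> b j" "\<And>j n. (LINT x|unit_leb. \<bar>U n (u j) x\<bar>) \<le> b j"
    and sb: "summable b"
  shows "(\<lambda>n. LINT x|unit_leb. \<bar>U n g x - g x\<bar>) \<longlonglongrightarrow> 0"
proof -
  have iu: "integrable unit_leb (u j)" for j using u by (rule bounded_on_unit_integrable)
  note iU = U_integrable[OF iu]
  define a where "a j n = (LINT x|unit_leb. \<bar>U n (u j) x - u j x\<bar>)" for j n
  have ab: "a j n \<le> 2 * b j" for j n
  proof -
    have "a j n = (LINT x|unit_leb. \<bar>U n (u j) x + - u j x\<bar>)" unfolding a_def by simp
    also have "\<dots> \<le> (LINT x|unit_leb. \<bar>U n (u j) x\<bar>) + (LINT x|unit_leb. \<bar>- u j x\<bar>)"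
      using iu iU by (intro integral_abs_triangle) auto
    finally show ?thesis using b(1)[of j] b(2)[of n j] by simp
  qed
  have a0: "a j n \<ge> 0" for j n unfolding a_def by simp
  have sb2: "summable (\<lambda>j. 2 * b j)" using sb by (rule summable_mult)
  have sa: "summable (\<lambda>j. a j n)" for n
    using a0 ab by (intro summable_comparison_test'[OF sb2]) auto
  have "eventually (\<lambda>n. summable (\<lambda>j. norm (a j n))) sequentially \<and> summable (\<lambda>j. norm (0::real))
     \<and> (\<lambda>n. \<Sum>j. a j n) \<longlonglongrightarrow> (\<Sum>j. 0)"
  proof (rule tannerys_theorem)
    show "(\<lambda>n. a j n) \<longlonglongrightarrow> 0" for j unfolding a_def using u by (rule L1_conv)
    show "eventually (\<lambda>(j, n). norm (a j n) \<le> 2 * b j) (sequentially \<times>\<^sub>F sequentially)"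
      using a0 ab by (intro always_eventually) auto
  qed (use sb2 in auto)
  then have lima: "(\<lambda>n. \<Sum>j. a j n) \<longlonglongrightarrow> 0" by simp
  have "(LINT x|unit_leb. \<bar>U n g x - g x\<bar>) \<le> (\<Sum>j. a j n)" for n
  proof -
    obtain C where C: "\<And>f. integrable unit_leb f \<Longrightarrow> (LINT x|unit_leb. \<bar>U n f x\<bar>) \<le> C * (LINT x|unit_leb. \<bar>f x\<bar>)"
      using U_L1_bound[of n] by blast
    define \<rho> where "\<rho> J = (LINT x|unit_leb. \<bar>g x - (\<Sum>j<J. u j x)\<bar>)" for J
    have bd: "(LINT x|unit_leb. \<bar>U n g x - g x\<bar>) \<le> C * \<rho> J + (\<rho> J + (\<Sum>j. a j n))" for J
    proof -
      define s where "s x = (\<Sum>j<J. u j x)" for x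
      have ints: "integrable unit_leb s" unfolding s_def using iu by simp
      have ii: "integrable unit_leb (\<lambda>x. g x - s x)" using g ints by simp
      note iUd = U_integrable[OF ii, of n]
      have ae: "AE x in unit_leb. U n g x - g x = U n (\<lambda>t. g t - s t) x + (- (g x - s x) + (\<Sum>j<J. U n (u j) x - u j x))"
      proof -
        have "AE x in unit_leb. U n s x = (\<Sum>j<J. U n (u j) x)"
          unfolding s_def using iu by (intro U_sum) auto
        then show ?thesis using U_diff[OF g ints, of n]
          by eventually_elim (simp add: sum_subtractf s_def)
      qed
      have "(LINT x|unit_leb. \<bar>U n g x - g x\<bar>)
          = (LINT x|unit_leb. \<bar>U n (\<lambda>t. g t - s t) x + (- (g x - s x) + (\<Sum>j<J. U n (u j) x - u j x))\<bar>)"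
        using ae iUd U_integrable[OF g, of n] iU iu ii g
        by (intro integral_cong_AE borel_measurable_abs borel_measurable_add borel_measurable_sum borel_measurable_diff
            borel_measurable_uminus borel_measurable_integrable) (auto elim!: eventually_mono)
      also have "\<dots> \<le> (LINT x|unit_leb. \<bar>U n (\<lambda>t. g t - s t) x\<bar>)
          + (LINT x|unit_leb. \<bar>- (g x - s x) + (\<Sum>j<J. U n (u j) x - u j x)\<bar>)"
        using iUd iU iu g ints
        by (intro integral_abs_triangle Bochner_Integration.integrable_add Bochner_Integration.integrable_sum
            Bochner_Integration.integrable_minus Bochner_Integration.integrable_diff) auto
      also have "(LINT x|unit_leb. \<bar>- (g x - s x) + (\<Sum>j<J. U n (u j) x - u j x)\<bar>)
          \<le> (LINT x|unit_leb. \<bar>- (g x - s x)\<bar>) + (LINT x|unit_leb. \<bar>\<Sum>j<J. U n (u j) x - u j x\<bar>)"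
        using iU iu g ints
        by (intro integral_abs_triangle Bochner_Integration.integrable_sum
            Bochner_Integration.integrable_minus Bochner_Integration.integrable_diff) auto
      also have "(LINT x|unit_leb. \<bar>\<Sum>j<J. U n (u j) x - u j x\<bar>) \<le> (\<Sum>j<J. a j n)"
        unfolding a_def using iU iu by (intro integral_abs_sum_le Bochner_Integration.integrable_diff)
      also have "(\<Sum>j<J. a j n) \<le> (\<Sum>j. a j n)" using sa a0 by (intro sum_le_suminf) auto
      also have "(LINT x|unit_leb. \<bar>U n (\<lambda>t. g t - s t) x\<bar>) \<le> C * \<rho> J"
        unfolding \<rho>_def s_def[symmetric] by (rule C[OF ii])
      also have "(LINT x|unit_leb. \<bar>- (g x - s x)\<bar>) = \<rho> J"
        unfolding \<rho>_def s_def[symmetric] abs_minus_cancel ..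
      finally show ?thesis by simp
    qed
    have "(\<lambda>J. C * \<rho> J + (\<rho> J + (\<Sum>j. a j n))) \<longlonglongrightarrow> C * 0 + (0 + (\<Sum>j. a j n))"
      using lim unfolding \<rho>_def by (intro tendsto_intros)
    then have "(LINT x|unit_leb. \<bar>U n g x - g x\<bar>) \<le> C * 0 + (0 + (\<Sum>j. a j n))"
      by (rule LIMSEQ_le_const) (use bd in blast)
    then show ?thesis by simp
  qed
  then show ?thesis
    by (intro Lim_null_comparison[OF _ lima] always_eventually) simp
qed

text \<open>By the Borel-Cantelli lemma, at almost every point the maximal function of
  \<open>u j\<close> is at most \<open>t j\<close> for all but finitely many \<open>j\<close>, a
  summable majorant independent of \<open>n\<close>. The finitely many exceptions do no harm, since
  domination is needed only eventually and each term converges by \<open>cu\<close>.\<close>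

lemma AE_conv_series:
  assumes g: "integrable unit_leb g" and u: "\<And>j. integrable unit_leb (u j)"
    and lim: "(\<lambda>J. LINT x|unit_leb. \<bar>g x - (\<Sum>j<J. u j x)\<bar>) \<longlonglongrightarrow> 0"
    and gS: "AE x in unit_leb. g x = (\<Sum>j. u j x)"
    and cu: "\<And>j. conv_ae (u j)"
    and t: "summable t" and mt: "summable (\<lambda>j. measure unit_leb (max_set (t j) (u j)))"
  shows "conv_ae g"
proof -
  have "AE x in unit_leb. eventually (\<lambda>j. x \<in> space unit_leb - max_set (t j) (u j)) sequentially"
    by (intro borel_cantelli_AE1 sets_max_set u mt) (simp add: unit_leb.emeasure_eq_measure)
  moreover have "AE x in unit_leb. \<forall>j. (\<lambda>n. U n (u j) x) \<longlonglongrightarrow> u j x"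
    unfolding AE_all_countable using cu unfolding conv_ae_def by blast
  moreover note U_sums_AE[OF g u lim] gS
  ultimately show ?thesis
    unfolding conv_ae_def
  proof eventually_elim
    case (elim x)
    have ev: "eventually (\<lambda>j. \<forall>n. \<bar>U n (u j) x\<bar> \<le> t j) sequentially"
      using elim(1) by eventually_elim (auto simp: max_set_def not_less)
    have "eventually (\<lambda>n. summable (\<lambda>j. norm (U n (u j) x))) sequentially \<and> summable (\<lambda>j. norm (u j x))
     \<and> (\<lambda>n. \<Sum>j. U n (u j) x) \<longlonglongrightarrow> (\<Sum>j. u j x)"
    proof (rule tannerys_theorem)
      show "(\<lambda>n. U n (u j) x) \<longlonglongrightarrow> u j x" for j using elim(2) by blast
      show "eventually (\<lambda>(j, n). norm (U n (u j) x) \<le> t j) (sequentially \<times>\<^sub>F sequentially)"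
        unfolding eventually_prod_filter using ev
        by (intro exI[of _ "\<lambda>j. \<forall>n. \<bar>U n (u j) x\<bar> \<le> t j"] exI[of _ "\<lambda>_. True"]) auto
    qed (use t in auto)
    moreover have "(\<Sum>j. U n (u j) x) = U n g x" for n
      using elim(3) by (simp add: sums_iff)
    ultimately show ?case using elim(4) by simp
  qed
qed

section \<open>One exceptional set for all integrable functions\<close>

lemma correction_theorem:
  assumes \<beta>: "\<beta> \<ge> 0" and \<epsilon>: "\<epsilon> > 0"
    and sets: "\<And>e. 0 < e \<Longrightarrow> e < 1 \<Longrightarrow> \<exists>G \<gamma> L. correction_sets U G \<gamma> e \<beta> L Q"
  shows "\<exists>G. open G \<and> G \<subseteq> {0<..<1} \<and> measure lebesgue G < \<epsilon> \<and>
    (\<forall>f. integrable unit_leb f \<longrightarrow> (\<exists>g. integrable unit_leb g \<and> {x \<in> {0<..<1}. f x \<noteq> g x} \<subseteq> G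
       \<and> (\<lambda>n. LINT x|unit_leb. \<bar>U n g x - g x\<bar>) \<longlonglongrightarrow> 0 \<and> (Q \<longrightarrow> conv_ae g)))"
proof -
  \<comment> \<open>Decoding a pair and keeping its second component lists every polynomial
    infinitely often, so each is found at arbitrarily large indices, where \<open>\<delta> k\<close>
    is small.\<close>
  define d where "d k = rat_Bernstein (from_nat (snd (prod_decode k)))" for k
  have dc: "continuous_on UNIV (d k)" for k unfolding d_def by (rule continuous_on_rat_Bernstein)
  have id: "integrable unit_leb (d k)" for k using dc by (rule continuous_imp_integrable_unit_leb)
  have dense: "\<exists>k\<ge>j. (LINT x|unit_leb. \<bar>r x - d k x\<bar>) \<le> (1/4) ^ j" if r: "integrable unit_leb r" for r j
  proof -
    obtain q where q: "(LINT x|unit_leb. \<bar>r x - rat_Bernstein q x\<bar>) < (1/4) ^ j"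
      using L1_approx_rat_Bernstein[OF r, of "(1/4) ^ j"] by auto
    show ?thesis
      using q unfolding d_def
      by (intro exI[of _ "prod_encode (j, to_nat q)"]) (auto simp: le_prod_encode_1)
  qed
  \<comment> \<open>The open sets below have measure at most \<open>3 * e k\<close>, and these
    bounds sum to 6c, which is less than \<epsilon>.\<close>
  define c where "c = min \<epsilon> 1 / 8"
  have c: "c > 0" "c < 1" "6 * c < \<epsilon>" unfolding c_def using \<epsilon> by (auto simp: min_def)
  define e where "e k = c * (1/2) ^ k" for k :: nat
  have e: "0 < e k" "e k < 1" for k
  proof -
    show "0 < e k" unfolding e_def using c by simp
    have "e k \<le> c * 1" unfolding e_def using c by (intro mult_left_mono power_le_one) auto
    then show "e k < 1" using c by simp
  qed
  define \<delta> where "\<delta> k = (1/4 :: real) ^ k" for k :: nat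
  have \<delta>: "\<delta> k > 0" for k unfolding \<delta>_def by simp
  have "\<exists>E g A. E \<in> sets lebesgue \<and> E \<subseteq> {0..<1} \<and> measure lebesgue E \<le> 2 * e k \<and> bounded_on_unit A g
    \<and> (\<forall>x\<in>{0<..<1} - E. \<bar>d k x - g x\<bar> \<le> \<delta> k)
    \<and> (LINT x|unit_leb. \<bar>g x\<bar>) \<le> 3 * (LINT x|unit_leb. \<bar>d k x\<bar>) + \<delta> k
    \<and> (\<forall>n. (LINT x|unit_leb. \<bar>U n g x\<bar>) \<le> 3 * (LINT x|unit_leb. \<bar>d k x\<bar>) + \<delta> k)
    \<and> (Q \<longrightarrow> conv_ae g)
    \<and> (Q \<longrightarrow> (\<forall>t\<ge>\<delta> k. measure unit_leb (max_set (4 * t) g)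
           \<le> (3 + 4 * \<beta>) * ((LINT x|unit_leb. \<bar>d k x\<bar>) + \<delta> k) / t + \<delta> k))" for k
  proof -
    obtain G \<gamma> L where "correction_sets U G \<gamma> (e k) \<beta> L Q" using sets[OF e] by blast
    then show ?thesis using dc \<delta> by (rule correction_sets.correction)
  qed
  then obtain E g A where E: "\<And>k. E k \<in> sets lebesgue" "\<And>k. E k \<subseteq> {0..<1}" "\<And>k. measure lebesgue (E k) \<le> 2 * e k"
    and gb: "\<And>k. bounded_on_unit (A k) (g k)"
    and gd: "\<And>k x. x \<in> {0<..<1} - E k \<Longrightarrow> \<bar>d k x - g k x\<bar> \<le> \<delta> k"
    and gn: "\<And>k. (LINT x|unit_leb. \<bar>g k x\<bar>) \<le> 3 * (LINT x|unit_leb. \<bar>d k x\<bar>) + \<delta> k"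
    and Un: "\<And>k n. (LINT x|unit_leb. \<bar>U n (g k) x\<bar>) \<le> 3 * (LINT x|unit_leb. \<bar>d k x\<bar>) + \<delta> k"
    and gc: "\<And>k. Q \<Longrightarrow> conv_ae (g k)"
    and mx: "\<And>k t. Q \<Longrightarrow> t \<ge> \<delta> k \<Longrightarrow> measure unit_leb (max_set (4 * t) (g k))
           \<le> (3 + 4 * \<beta>) * ((LINT x|unit_leb. \<bar>d k x\<bar>) + \<delta> k) / t + \<delta> k"
    by metis
  \<comment> \<open>\<open>E k\<close> accounts for \<open>2 * e k\<close> and its open
    neighbourhood for one more \<open>e k\<close>. The point 0, which \<open>E k\<close> may
    contain, is removed by cutting with the open interval.\<close>
  have "\<exists>T. open T \<and> E k \<subseteq> T \<and> measure unit_leb (T \<inter> {0<..<1}) \<le> 3 * e k" for k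
  proof -
    obtain T where T: "open T" "E k \<subseteq> T" "T - E k \<in> lmeasurable" "emeasure lebesgue (T - E k) < ennreal (e k)"
      using sets_lebesgue_outer_open[OF E(1) e(1)] by blast
    have m: "measure lebesgue (T - E k) \<le> e k"
      using T(4) e(1)[of k] unfolding measure_def by (intro enn2real_leI) auto
    have El: "E k \<in> lmeasurable"
      using E(1) bounded_subset[OF bounded_closed_interval[of 0 1], of "E k"] E(2)[of k]
      by (intro bounded_set_imp_lmeasurable) force+
    have Tl: "T \<in> sets lebesgue" using T(1) by auto
    have TE: "E k \<union> (T - E k) \<in> lmeasurable" using El T(3) by (rule fmeasurable.Un)
    have "measure unit_leb (T \<inter> {0<..<1}) = measure lebesgue (T \<inter> {0<..<1})"
      using Tl by (intro measure_unit_leb) (auto simp: sets_restrict_space)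
    also have "\<dots> \<le> measure lebesgue (E k \<union> (T - E k))"
      using Tl TE by (intro measure_mono_fmeasurable) auto
    also have "\<dots> \<le> measure lebesgue (E k) + measure lebesgue (T - E k)"
      using E Tl by (intro measure_Un_le) auto
    finally show ?thesis using T m E(3)[of k] by (intro exI[of _ T]) auto
  qed
  then obtain T where T: "\<And>k. open (T k)" "\<And>k. E k \<subseteq> T k" "\<And>k. measure unit_leb (T k \<inter> {0<..<1}) \<le> 3 * e k" by metis
  define G where "G = (\<Union>k. T k \<inter> {0<..<1})"
  have Go: "open G" unfolding G_def by (intro open_UN ballI open_Int T(1) open_greaterThanLessThan)
  have Gsub: "G \<subseteq> {0<..<1}" unfolding G_def by auto
  have Ts: "T k \<inter> {0<..<1} \<in> sets unit_leb" for k
    using T(1)[of k] by (subst sets_restrict_space_iff) auto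
  have Gs: "G \<in> sets unit_leb" unfolding G_def by (intro sets.countable_UN image_subsetI Ts)
  have Gm: "measure lebesgue G < \<epsilon>"
  proof -
    have se: "(\<lambda>k. 3 * e k) sums (3 * (c * 2))"
      unfolding e_def using geometric_sums[of "1/2 :: real"] by (intro sums_mult) simp
    have sT: "summable (\<lambda>k. measure unit_leb (T k \<inter> {0<..<1}))"
      using T(3) by (intro summable_comparison_test'[OF sums_summable[OF se]]) auto
    have "measure unit_leb G \<le> (\<Sum>k. measure unit_leb (T k \<inter> {0<..<1}))"
      unfolding G_def by (intro unit_leb.finite_measure_subadditive_countably image_subsetI Ts sT)
    also have "\<dots> \<le> (\<Sum>k. 3 * e k)" using T(3) sT se by (intro suminf_le) (auto simp: sums_iff)
    also have "\<dots> = 6 * c" using se by (simp add: sums_iff)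
    finally show ?thesis using c measure_unit_leb[OF Gs] by simp
  qed
  have main: "\<exists>h. integrable unit_leb h \<and> {x \<in> {0<..<1}. f x \<noteq> h x} \<subseteq> G
       \<and> (\<lambda>n. LINT x|unit_leb. \<bar>U n h x - h x\<bar>) \<longlonglongrightarrow> 0 \<and> (Q \<longrightarrow> conv_ae h)"
    if f: "integrable unit_leb f" for f
  proof -
    have "\<forall>j r. \<exists>k. integrable unit_leb r \<longrightarrow> k \<ge> j \<and> (LINT x|unit_leb. \<bar>r x - d k x\<bar>) \<le> (1/4) ^ j"
      using dense by blast
    then obtain K where K: "\<And>j r. integrable unit_leb r \<Longrightarrow> K j r \<ge> j"
      "\<And>j r. integrable unit_leb r \<Longrightarrow> (LINT x|unit_leb. \<bar>r x - d (K j r) x\<bar>) \<le> (1/4) ^ j"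
      unfolding choice_iff by blast
    \<comment> \<open>The residual is set to zero on \<open>G\<close>, where the functions
      \<open>g k\<close> are not close to \<open>d k\<close>. Off \<open>G\<close> it is
      \<open>f\<close> minus a partial sum, so its decay in L1 makes the series reproduce
      \<open>f\<close> there; on \<open>G\<close> the values of \<open>f\<close> are given
      up.\<close>
    define r where "r = rec_nat f (\<lambda>j r x. r x - g (K j r) x - indicat_real G x * (r x - g (K j r) x))"
    define k where "k j = K j (r j)" for j
    define u where "u j = g (k j)" for j
    have iu: "integrable unit_leb (u j)" for j unfolding u_def using gb by (rule bounded_on_unit_integrable)
    have r0: "r 0 = f" unfolding r_def by simp
    have rS: "r (Suc j) = (\<lambda>x. r j x - u j x - indicat_real G x * (r j x - u j x))" for j
      unfolding r_def u_def k_def by simp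
    have ir: "integrable unit_leb (r j)" for j
    proof (induction j)
      case (Suc j)
      then have "integrable unit_leb (\<lambda>x. r j x - u j x)" using iu by simp
      with integrable_mult_indicator[OF Gs this] show ?case unfolding rS by simp
    qed (use r0 f in simp)
    have kj: "k j \<ge> j" and rd: "(LINT x|unit_leb. \<bar>r j x - d (k j) x\<bar>) \<le> (1/4) ^ j" for j
      unfolding k_def using K ir by blast+
    have \<delta>k: "\<delta> (k j) \<le> (1/4) ^ j" for j unfolding \<delta>_def using kj by (intro power_decreasing) auto
    have rn: "(LINT x|unit_leb. \<bar>r (Suc j) x\<bar>) \<le> 2 * (1/4) ^ j" for j
    proof -
      have "(LINT x|unit_leb. \<bar>r (Suc j) x\<bar>) \<le> (LINT x|unit_leb. \<bar>r j x - d (k j) x\<bar> + (1/4) ^ j)"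
      proof (rule integral_mono)
        show "integrable unit_leb (\<lambda>x. \<bar>r (Suc j) x\<bar>)" using ir by simp
        show "integrable unit_leb (\<lambda>x. \<bar>r j x - d (k j) x\<bar> + (1/4) ^ j)" using ir id by simp
        fix x assume "x \<in> space unit_leb"
        then have x: "x \<in> {0<..<1}" by simp
        show "\<bar>r (Suc j) x\<bar> \<le> \<bar>r j x - d (k j) x\<bar> + (1/4) ^ j"
        proof (cases "x \<in> G")
          case True
          then show ?thesis unfolding rS by simp
        next
          case False
          then have "x \<notin> E (k j)" using T(2)[of "k j"] x unfolding G_def by blast
          then have "\<bar>d (k j) x - u j x\<bar> \<le> \<delta> (k j)" unfolding u_def using x by (intro gd) auto
          then show ?thesis using \<delta>k[of j] False unfolding rS by simp
        qed
      qed
      also have "\<dots> = (LINT x|unit_leb. \<bar>r j x - d (k j) x\<bar>) + (1/4) ^ j"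
        using ir id by (simp add: unit_leb.prob_space[unfolded space_unit_leb])
      finally show ?thesis using rd[of j] by simp
    qed
    \<comment> \<open>For j \<ge> 1 the estimate \<open>rn\<close> reads 2 * (1/4)^(j-1) = 8 *
      (1/4)^j, hence B - 1 \<ge> 8. The remaining 1 pays for the passage from \<open>r j\<close> to
      \<open>d (k j)\<close>.\<close>
    define B where "B = (LINT x|unit_leb. \<bar>f x\<bar>) + 9"
    have fn: "(LINT x|unit_leb. \<bar>f x\<bar>) \<ge> 0" by simp
    have rB: "(LINT x|unit_leb. \<bar>r j x\<bar>) \<le> (B - 1) * (1/4) ^ j" for j
    proof (cases j)
      case 0
      then show ?thesis unfolding B_def by (simp add: r0)
    next
      case (Suc i)
      have "2 * (1/4) ^ i = 8 * (1/4 :: real) ^ j" unfolding Suc by simp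
      also have "\<dots> \<le> (B - 1) * (1/4) ^ j" unfolding B_def using fn by (intro mult_right_mono) auto
      finally show ?thesis using rn[of i] unfolding Suc by linarith
    qed
    have dB: "(LINT x|unit_leb. \<bar>d (k j) x\<bar>) \<le> B * (1/4) ^ j" for j
    proof -
      have "(LINT x|unit_leb. \<bar>d (k j) x\<bar>) = (LINT x|unit_leb. \<bar>r j x + - (r j x - d (k j) x)\<bar>)" by simp
      also have "\<dots> \<le> (LINT x|unit_leb. \<bar>r j x\<bar>) + (LINT x|unit_leb. \<bar>- (r j x - d (k j) x)\<bar>)"
        using ir id by (intro integral_abs_triangle Bochner_Integration.integrable_minus) auto
      also have "\<dots> \<le> (B - 1) * (1/4) ^ j + (1/4) ^ j"
        unfolding abs_minus_cancel using rB rd by (intro add_mono)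
      also have "\<dots> = B * (1/4) ^ j" by (simp add: left_diff_distrib)
      finally show ?thesis .
    qed
    define b where "b j = (3 * B + 1) * (1/4) ^ j" for j :: nat
    have sb: "summable b" unfolding b_def by (intro summable_mult summable_geometric) auto
    have bb: "3 * (LINT x|unit_leb. \<bar>d (k j) x\<bar>) + \<delta> (k j) \<le> b j" for j
      unfolding b_def using dB[of j] \<delta>k[of j] by (simp add: distrib_right)
    have ub: "(LINT x|unit_leb. \<bar>u j x\<bar>) \<le> b j" for j
      unfolding u_def using gn[of "k j"] bb[of j] by linarith
    have Ub: "(LINT x|unit_leb. \<bar>U n (u j) x\<bar>) \<le> b j" for j n
      unfolding u_def using Un[of n "k j"] bb[of j] by linarith
    have su: "summable (\<lambda>j. LINT x|unit_leb. \<bar>u j x\<bar>)"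
      using ub by (intro summable_comparison_test'[OF sb]) auto
    have sr: "summable (\<lambda>j. LINT x|unit_leb. \<bar>r j x\<bar>)"
    proof (rule summable_comparison_test')
      show "summable (\<lambda>j. (B - 1) * (1/4) ^ j)" by (intro summable_mult summable_geometric) auto
      show "norm (LINT x|unit_leb. \<bar>r j x\<bar>) \<le> (B - 1) * (1/4) ^ j" for j using rB[of j] by simp
    qed
    define S where "S x = (\<Sum>j. u j x)" for x
    have iS: "integrable unit_leb S" unfolding S_def using iu su by (rule summable_integral_abs(2))
    have rsum: "r J x = f x - (\<Sum>j<J. u j x)" if "x \<notin> G" for x J
      using that by (induction J) (auto simp: r0 rS)
    have Sf: "AE x in unit_leb. x \<notin> G \<longrightarrow> S x = f x"
      using summable_integral_abs(1)[OF iu su] summable_integral_abs(1)[OF ir sr]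
    proof eventually_elim
      case (elim x)
      show ?case
      proof
        assume x: "x \<notin> G"
        have "(\<lambda>J. \<Sum>j<J. u j x) \<longlonglongrightarrow> S x"
          unfolding S_def by (rule summable_LIMSEQ[OF summable_rabs_cancel[OF elim(1)]])
        moreover have "(\<lambda>J. r J x) \<longlonglongrightarrow> 0"
          using summable_LIMSEQ_zero[OF elim(2)] by (rule tendsto_rabs_zero_cancel)
        then have "(\<lambda>J. f x - r J x) \<longlonglongrightarrow> f x - 0" by (intro tendsto_diff tendsto_const)
        then have "(\<lambda>J. \<Sum>j<J. u j x) \<longlonglongrightarrow> f x" using rsum[OF x] by simp
        ultimately show "S x = f x" by (rule LIMSEQ_unique)
      qed
    qed
    \<comment> \<open>\<open>S\<close> agrees with \<open>f\<close> off \<open>G\<close> only almost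
      everywhere, whereas the set where \<open>f\<close> and \<open>h\<close> differ has to lie in
      \<open>G\<close> without exception.\<close>
    define h where "h x = f x + indicat_real G x *\<^sub>R (S x - f x)" for x
    have ih: "integrable unit_leb h"
      unfolding h_def using f iS by (intro Bochner_Integration.integrable_add integrable_mult_indicator[OF Gs]) auto
    have hS: "AE x in unit_leb. h x = S x"
      using Sf by eventually_elim (auto simp: h_def indicator_def)
    have hlim: "(\<lambda>J. LINT x|unit_leb. \<bar>h x - (\<Sum>j<J. u j x)\<bar>) \<longlonglongrightarrow> 0"
    proof -
      have "(LINT x|unit_leb. \<bar>h x - (\<Sum>j<J. u j x)\<bar>) = (LINT x|unit_leb. \<bar>S x - (\<Sum>j<J. u j x)\<bar>)" for J
      proof (rule integral_cong_AE)
        show "AE x in unit_leb. \<bar>h x - (\<Sum>j<J. u j x)\<bar> = \<bar>S x - (\<Sum>j<J. u j x)\<bar>"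
          using hS by eventually_elim simp
      qed (use ih iS iu in \<open>auto intro!: borel_measurable_abs borel_measurable_diff borel_measurable_sum\<close>)
      then show ?thesis using summable_integral_abs(3)[OF iu su] unfolding S_def by simp
    qed
    have L1: "(\<lambda>n. LINT x|unit_leb. \<bar>U n h x - h x\<bar>) \<longlonglongrightarrow> 0"
      using ih gb hlim ub Ub sb unfolding u_def by (rule L1_conv_series)
    have ae: "conv_ae h" if Q
    proof (rule AE_conv_series[OF ih iu hlim])
      show "AE x in unit_leb. h x = (\<Sum>j. u j x)" using hS unfolding S_def .
      show "conv_ae (u j)" for j unfolding u_def using gc[OF that] .
      \<comment> \<open>The norms are of order (1/4)^j, so at level 4 * (1/2)^j the maximal estimate
        gives measures of order (1/2)^j: levels and measures are both summable. The estimate applies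
        because \<open>\<delta> (k j)\<close> is at most (1/4)^j.\<close>
      show "summable (\<lambda>j. 4 * (1/2 :: real) ^ j)" by (intro summable_mult summable_geometric) auto
      define C where "C = (3 + 4 * \<beta>) * (B + 1) + 1"
      have "norm (measure unit_leb (max_set (4 * (1/2) ^ j) (u j))) \<le> C * (1/2) ^ j" for j
      proof -
        have q: "(1/4 :: real) ^ j = (1/2) ^ j * (1/2) ^ j" by (simp flip: power_mult_distrib)
        have le1: "(1/2 :: real) ^ j \<le> 1" by (intro power_le_one) auto
        have le: "(1/4 :: real) ^ j \<le> (1/2) ^ j" by (intro power_mono) auto
        have "measure unit_leb (max_set (4 * (1/2) ^ j) (u j))
           \<le> (3 + 4 * \<beta>) * ((LINT x|unit_leb. \<bar>d (k j) x\<bar>) + \<delta> (k j)) / (1/2) ^ j + \<delta> (k j)"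
          unfolding u_def using \<delta>k[of j] le by (intro mx that) linarith
        also have "\<dots> \<le> (3 + 4 * \<beta>) * ((B + 1) * (1/4) ^ j) / (1/2) ^ j + (1/2) ^ j"
          using dB[of j] \<delta>k[of j] le \<beta>
          by (intro add_mono divide_right_mono mult_left_mono) (auto simp: distrib_right)
        also have "\<dots> = C * (1/2) ^ j"
        proof -
          have "y * ((B + 1) * (z * z)) / z + z = (y * (B + 1) + 1) * z" if "z \<noteq> 0" for y z :: real
            using that by (simp add: field_simps)
          then show ?thesis unfolding C_def q by simp
        qed
        finally show ?thesis by simp
      qed
      moreover have "summable (\<lambda>j. C * (1/2) ^ j)" by (intro summable_mult summable_geometric) auto
      ultimately show "summable (\<lambda>j. measure unit_leb (max_set (4 * (1/2) ^ j) (u j)))"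
        by - (rule summable_comparison_test')
    qed
    have "{x \<in> {0<..<1}. f x \<noteq> h x} \<subseteq> G" unfolding h_def by (auto simp: indicator_def)
    then show ?thesis using ih L1 ae by blast
  qed
  then show ?thesis using Go Gsub Gm by blast
qed

end

section \<open>From the stated properties to the locales\<close>

lemma L1_null_of_Lp_null:
  fixes h :: "nat \<Rightarrow> real \<Rightarrow> real"
  assumes p: "p > 1" and h: "\<And>n. integrable unit_leb (h n)" "\<And>n. integrable unit_leb (\<lambda>x. \<bar>h n x\<bar> powr p)"
    and lim: "(\<lambda>n. Lp_norm p (h n)) \<longlonglongrightarrow> 0"
  shows "(\<lambda>n. LINT x|unit_leb. \<bar>h n x\<bar>) \<longlonglongrightarrow> 0"
proof -
  define I where "I n = (LINT x|unit_leb. \<bar>h n x\<bar> powr p)" for n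
  have I0: "I n \<ge> 0" for n unfolding I_def by simp
  have "(\<lambda>n. Lp_norm p (h n) powr p) \<longlonglongrightarrow> 0"
    using p lim by (intro tendsto_zero_powrI[OF lim tendsto_const]) (auto simp: Lp_norm_def)
  moreover have "Lp_norm p (h n) powr p = I n" for n
    unfolding Lp_norm_def I_def[symmetric] powr_powr using p I0 by simp
  ultimately have limI: "I \<longlonglongrightarrow> 0" by (simp add: fun_eq_iff)
  show ?thesis
  proof (rule LIMSEQ_I)
    fix r :: real assume r: "r > 0"
    define s where "s = r / 2"
    have s: "s > 0" unfolding s_def using r by simp
    \<comment> \<open>For y > s one has y = y^(1-p) * y^p \<le> s^(1-p) * y^p, since 1 - p is
      negative. This splitting at the level s = r/2 takes the place of Hoelder's inequality.\<close>
    have bound: "(LINT x|unit_leb. \<bar>h n x\<bar>) \<le> s + s powr (1 - p) * I n" for n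
    proof -
      have "(LINT x|unit_leb. \<bar>h n x\<bar>) \<le> (LINT x|unit_leb. s + s powr (1 - p) * \<bar>h n x\<bar> powr p)"
      proof (rule integral_mono)
        fix x
        show "\<bar>h n x\<bar> \<le> s + s powr (1 - p) * \<bar>h n x\<bar> powr p"
        proof (cases "\<bar>h n x\<bar> \<le> s")
          case True
          moreover have "s powr (1 - p) * \<bar>h n x\<bar> powr p \<ge> 0" by simp
          ultimately show ?thesis by linarith
        next
          case False
          then have y: "\<bar>h n x\<bar> > 0" using s by linarith
          have "\<bar>h n x\<bar> = \<bar>h n x\<bar> powr (1 - p) * \<bar>h n x\<bar> powr p"
            using y by (simp flip: powr_add)
          also have "\<dots> \<le> s powr (1 - p) * \<bar>h n x\<bar> powr p"
            using False s p by (intro mult_right_mono powr_mono2') auto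
          finally show ?thesis using s by simp
        qed
      qed (use h in auto)
      also have "\<dots> = s + s powr (1 - p) * I n"
        unfolding I_def using h by (simp add: unit_leb.prob_space[unfolded space_unit_leb])
      finally show ?thesis .
    qed
    have "(\<lambda>n. s powr (1 - p) * I n) \<longlonglongrightarrow> s powr (1 - p) * 0"
      using limI by (intro tendsto_mult_left)
    then have "eventually (\<lambda>n. s powr (1 - p) * I n < s) sequentially"
      using s by (intro order_tendstoD) auto
    then obtain N where N: "\<And>n. n \<ge> N \<Longrightarrow> s powr (1 - p) * I n < s" unfolding eventually_sequentially by blast
    have "norm ((LINT x|unit_leb. \<bar>h n x\<bar>) - 0) < r" if "n \<ge> N" for n
    proof -
      have "(LINT x|unit_leb. \<bar>h n x\<bar>) < r" using bound[of n] N[OF that] unfolding s_def by linarith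
      then show ?thesis by simp
    qed
    then show "\<exists>no. \<forall>n\<ge>no. norm ((LINT x|unit_leb. \<bar>h n x\<bar>) - 0) < r" by blast
  qed
qed

lemma Linf_space_powr_integrable:
  assumes "f \<in> Linf_space" "p \<ge> 0"
  shows "integrable unit_leb (\<lambda>x. \<bar>f x\<bar> powr p)"
proof -
  obtain C where C: "AE x in unit_leb. \<bar>f x\<bar> \<le> C" and [measurable]: "f \<in> borel_measurable unit_leb"
    using assms unfolding Linf_space_iff by blast
  have "AE x in unit_leb. norm (\<bar>f x\<bar> powr p) \<le> C powr p"
    using C by eventually_elim (use assms in \<open>auto intro: powr_mono2\<close>)
  then show ?thesis by (intro unit_leb.integrable_const_bound[where B = "C powr p"]) auto
qed

text \<open>Bounded functions have essentially bounded images, so the differences in (B) have finite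
  Lp integrals and \<open>L1_null_of_Lp_null\<close> applies to them.\<close>

lemma compact_approximationI:
  assumes p: "1 < p" and b: "\<And>n. bounded_op_L1_Linf (U n)" and A: "prop_A U" and B: "prop_B p U"
  shows "compact_approximation U"
proof
  show "bounded_op_L1_Linf (U n)" for n by (rule b)
  show "prop_A U" by (rule A)
  fix A f assume f: "bounded_on_unit A f"
  have fm: "f \<in> borel_measurable unit_leb" using f unfolding bounded_on_unit_def by blast
  have fL: "f \<in> Linf_space"
    using f unfolding Linf_space_iff bounded_on_unit_def by (auto intro!: exI[of _ A] AE_I2)
  then have fp: "f \<in> Lp_space p"
    unfolding Lp_space_def using Linf_space_powr_integrable[OF fL, of p] p fm by simp
  have dL: "(\<lambda>x. U n f x - f x) \<in> Linf_space" for n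
  proof -
    have "U n f \<in> Linf_space"
      using b[of n] bounded_on_unit_integrable[OF f, folded Lp_space_1] unfolding bounded_op_L1_Linf_def by blast
    then obtain C where C: "AE x in unit_leb. \<bar>U n f x\<bar> \<le> C" and Um: "U n f \<in> borel_measurable unit_leb"
      unfolding Linf_space_iff by blast
    obtain C' where C': "AE x in unit_leb. \<bar>f x\<bar> \<le> C'" using fL unfolding Linf_space_iff by blast
    have "AE x in unit_leb. \<bar>U n f x - f x\<bar> \<le> C + C'" using C C' by eventually_elim linarith
    then show ?thesis unfolding Linf_space_iff using Um fm by auto
  qed
  show "(\<lambda>n. LINT x|unit_leb. \<bar>U n f x - f x\<bar>) \<longlonglongrightarrow> 0"
  proof (rule L1_null_of_Lp_null[OF p])
    show "integrable unit_leb (\<lambda>x. U n f x - f x)" for n using dL by (rule Linf_space_integrable)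
    show "integrable unit_leb (\<lambda>x. \<bar>U n f x - f x\<bar> powr p)" for n
      using Linf_space_powr_integrable[OF dL, of p] p by simp
    show "(\<lambda>n. Lp_norm p (\<lambda>x. U n f x - f x)) \<longlonglongrightarrow> 0" using B fp unfolding prop_B_def by blast
  qed
qed

context compact_approximation
begin

text \<open>\<open>Suc l\<close> skips the grid without cells, whose set would be empty. The measure
  is exactly \<open>e\<close>, which therefore serves as lower and upper bound at once.\<close>

lemma correction_sets_grid:
  assumes e: "0 < e" "e < 1"
  shows "correction_sets U (\<lambda>l. grid_set e (Suc l)) e e 0 UNIV False"
proof
  show "finite_interval_set (grid_set e (Suc l))" for l using e by (rule finite_interval_set_grid_set)
qed (use e weakly_converges_grid_set[OF e] in \<open>auto simp: measure_grid_set\<close>)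

text \<open>The order of quantifiers matters: one \<beta> serves all \<open>e\<close>, because
  \<open>correction_theorem\<close> sums maximal estimates for functions corrected with ever smaller
  \<open>e\<close>.\<close>

lemma correction_sets_prop_D:
  assumes C: "prop_C U" and D: "prop_D U"
  shows "\<exists>\<beta>\<ge>0. \<forall>e. 0 < e \<longrightarrow> e < 1 \<longrightarrow> (\<exists>G \<gamma> L. correction_sets U G \<gamma> e \<beta> L True)"
proof -
  obtain \<alpha> \<beta> where \<alpha>: "0 < \<alpha>" and \<beta>: "0 < \<beta>"
    and *: "\<forall>e. 0 < e \<and> e < 1 \<longrightarrow>
         (\<exists>G :: nat \<Rightarrow> real set.
            (\<forall>l. finite_interval_set (G l)) \<and>
            (\<forall>l. \<alpha> * e \<le> measure lebesgue (G l) \<and> measure lebesgue (G l) \<le> e) \<and>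
            weakly_converges (\<lambda>l x. indicat_real (G l) x / measure lebesgue (G l))
              (indicat_real {0..<1}) \<and>
            (\<exists>\<I>. interval_basis \<I> \<and>
               (\<forall>D\<in>\<I>. \<forall>t>0. \<forall>l.
                  t * measure lebesgue
                    {x \<in> {0<..<1}. maximal_op U (indicat_real (G l \<inter> D)) x > ereal t}
                  \<le> \<beta> * measure lebesgue (G l \<inter> D))))"
    using D unfolding prop_D_def by (elim exE conjE) (rule that)
  have "\<exists>G \<gamma> L. correction_sets U G \<gamma> e \<beta> L True" if e: "0 < e" "e < 1" for e
  proof -
    obtain G \<I> where G: "\<And>l. finite_interval_set (G l)" "\<And>l. \<alpha> * e \<le> measure lebesgue (G l)" "\<And>l. measure lebesgue (G l) \<le> e"
      "weakly_converges (\<lambda>l x. indicat_real (G l) x / measure lebesgue (G l)) (indicat_real {0..<1})"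
      and I: "interval_basis \<I>"
      and mx: "\<And>D t l. D \<in> \<I> \<Longrightarrow> t > 0 \<Longrightarrow> t * measure lebesgue
                    {x \<in> {0<..<1}. maximal_op U (indicat_real (G l \<inter> D)) x > ereal t}
                  \<le> \<beta> * measure lebesgue (G l \<inter> D)"
      using spec[OF *, THEN mp, OF conjI[OF e]] by blast
    \<comment> \<open>The basis condition at a = 0 and b = 1, which gives infinitely many such
      \<open>l\<close>. Its cells are counted from 1, those of \<open>grid_cell\<close> from
      0.\<close>
    define L where "L = {l::nat. l > 0 \<and>
          (\<forall>j\<in>{1..l}. {0 + (1 - 0) * (real j - 1) / real l ..< 0 + (1 - 0) * real j / real l} \<in> \<I>)}"
    have "{0..<1::real} \<in> \<I>" using I unfolding interval_basis_def by blast
    then have Linf: "infinite L"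
    proof -
      have "\<forall>a b. a < b \<and> {a..<b} \<in> \<I> \<longrightarrow> infinite {l::nat. l > 0 \<and>
          (\<forall>j\<in>{1..l}. {a + (b - a) * (real j - 1) / real l ..< a + (b - a) * real j / real l} \<in> \<I>)}"
        using I unfolding interval_basis_def by (elim conjE)
      from this[rule_format, of 0 1] show ?thesis
        unfolding L_def using \<open>{0..<1} \<in> \<I>\<close> by simp
    qed
    have cell: "grid_cell m j \<in> \<I>" if "m \<in> L" "j < m" for m j
    proof -
      have "Suc j \<in> {1..m}" using that by auto
      then have "{0 + (1 - 0) * (real (Suc j) - 1) / real m ..< 0 + (1 - 0) * real (Suc j) / real m} \<in> \<I>"
        using that(1) unfolding L_def by blast
      then show ?thesis unfolding grid_cell_def by (simp add: add.commute)
    qed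
    have "correction_sets U G (\<alpha> * e) e \<beta> L True"
    proof
      fix m j t l assume mj: "m \<in> L" "j < m" and t: "(0::real) < t"
      have "integrable unit_leb (indicat_real (G l \<inter> grid_cell m j))"
        using finite_interval_set_sets[OF G(1)[of l]] by (intro integrable_indicat_unit_leb) auto
      then have "max_set t (indicat_real (G l \<inter> grid_cell m j)) \<in> sets unit_leb" by (rule sets_max_set)
      then show "t * measure unit_leb (max_set t (indicat_real (G l \<inter> grid_cell m j))) \<le> \<beta> * measure lebesgue (G l \<inter> grid_cell m j)"
        using mx[OF cell[OF mj] t, of l] unfolding max_set_eq by (simp only: measure_unit_leb)
    qed (use G C Linf \<alpha> \<beta> e in auto)
    then show ?thesis by blast
  qed
  then show ?thesis using \<beta> by (intro exI[of _ \<beta>]) auto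
qed

end

theorem theorem1:
  fixes p \<epsilon> :: real
    and U :: "nat \<Rightarrow> (real \<Rightarrow> real) \<Rightarrow> real \<Rightarrow> real"
  assumes "1 < p"
    and "\<And>n. bounded_op_L1_Linf (U n)"
    and "prop_A U"
    and "prop_B p U"
    and "\<epsilon> > 0"
  shows "(\<exists>G. open G \<and> G \<subseteq> {0<..<1} \<and> measure lebesgue G < \<epsilon> \<and>
            (\<forall>f\<in>Lp_space 1. \<exists>g\<in>Lp_space 1.
               {x \<in> {0<..<1}. f x \<noteq> g x} \<subseteq> G \<and>
               (\<lambda>n. Lp_norm 1 (\<lambda>x. U n g x - g x)) \<longlonglongrightarrow> 0)) \<and>
         (prop_C U \<and> prop_D U \<longrightarrow>
          (\<exists>G. open G \<and> G \<subseteq> {0<..<1} \<and> measure lebesgue G < \<epsilon> \<and>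
            (\<forall>f\<in>Lp_space 1. \<exists>g\<in>Lp_space 1.
               {x \<in> {0<..<1}. f x \<noteq> g x} \<subseteq> G \<and>
               (\<lambda>n. Lp_norm 1 (\<lambda>x. U n g x - g x)) \<longlonglongrightarrow> 0 \<and>
               (AE x in unit_leb. (\<lambda>n. U n g x) \<longlonglongrightarrow> g x))))"
proof -
  interpret compact_approximation U
    using assms(1-4) by (rule compact_approximationI)
  show ?thesis
  proof (intro conjI impI)
    obtain G where G: "open G" "G \<subseteq> {0<..<1}" "measure lebesgue G < \<epsilon>"
      and g: "\<And>f. integrable unit_leb f \<Longrightarrow> \<exists>g. integrable unit_leb g \<and> {x \<in> {0<..<1}. f x \<noteq> g x} \<subseteq> G
       \<and> (\<lambda>n. LINT x|unit_leb. \<bar>U n g x - g x\<bar>) \<longlonglongrightarrow> 0"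
    proof -
      \<comment> \<open>Taking \<open>order_refl\<close> for the condition on \<beta> instantiates
        it to 0, the value in \<open>correction_sets_grid\<close>.\<close>
      have "\<exists>G. open G \<and> G \<subseteq> {0<..<1} \<and> measure lebesgue G < \<epsilon> \<and>
        (\<forall>f. integrable unit_leb f \<longrightarrow> (\<exists>g. integrable unit_leb g \<and> {x \<in> {0<..<1}. f x \<noteq> g x} \<subseteq> G
           \<and> (\<lambda>n. LINT x|unit_leb. \<bar>U n g x - g x\<bar>) \<longlonglongrightarrow> 0 \<and> (False \<longrightarrow> conv_ae g)))"
        using order_refl \<open>\<epsilon> > 0\<close> by (rule correction_theorem) (blast intro: correction_sets_grid)
      then show ?thesis using that by (elim exE conjE) simp
    qed
    show "\<exists>G. open G \<and> G \<subseteq> {0<..<1} \<and> measure lebesgue G < \<epsilon> \<and>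
            (\<forall>f\<in>Lp_space 1. \<exists>g\<in>Lp_space 1.
               {x \<in> {0<..<1}. f x \<noteq> g x} \<subseteq> G \<and>
               (\<lambda>n. Lp_norm 1 (\<lambda>x. U n g x - g x)) \<longlonglongrightarrow> 0)"
      unfolding Lp_norm_1 Bex_def Ball_def Lp_space_1 using G g by blast
  next
    assume "prop_C U \<and> prop_D U"
    then obtain \<beta> where \<beta>: "\<beta> \<ge> 0" "\<And>e. 0 < e \<Longrightarrow> e < 1 \<Longrightarrow> (\<exists>G \<gamma> L. correction_sets U G \<gamma> e \<beta> L True)"
      using correction_sets_prop_D by blast
    obtain G where G: "open G" "G \<subseteq> {0<..<1}" "measure lebesgue G < \<epsilon>"
      and g: "\<And>f. integrable unit_leb f \<Longrightarrow> \<exists>g. integrable unit_leb g \<and> {x \<in> {0<..<1}. f x \<noteq> g x} \<subseteq> G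
       \<and> (\<lambda>n. LINT x|unit_leb. \<bar>U n g x - g x\<bar>) \<longlonglongrightarrow> 0 \<and> conv_ae g"
    proof -
      have "\<exists>G. open G \<and> G \<subseteq> {0<..<1} \<and> measure lebesgue G < \<epsilon> \<and>
        (\<forall>f. integrable unit_leb f \<longrightarrow> (\<exists>g. integrable unit_leb g \<and> {x \<in> {0<..<1}. f x \<noteq> g x} \<subseteq> G
           \<and> (\<lambda>n. LINT x|unit_leb. \<bar>U n g x - g x\<bar>) \<longlonglongrightarrow> 0 \<and> (True \<longrightarrow> conv_ae g)))"
        using \<beta>(1) \<open>\<epsilon> > 0\<close> \<beta>(2) by (rule correction_theorem)
      then show ?thesis using that by (elim exE conjE) simp
    qed
    show "\<exists>G. open G \<and> G \<subseteq> {0<..<1} \<and> measure lebesgue G < \<epsilon> \<and>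
            (\<forall>f\<in>Lp_space 1. \<exists>g\<in>Lp_space 1.
               {x \<in> {0<..<1}. f x \<noteq> g x} \<subseteq> G \<and>
               (\<lambda>n. Lp_norm 1 (\<lambda>x. U n g x - g x)) \<longlonglongrightarrow> 0 \<and>
               (AE x in unit_leb. (\<lambda>n. U n g x) \<longlonglongrightarrow> g x))"
      unfolding Lp_norm_1 Bex_def Ball_def Lp_space_1 using G g[unfolded conv_ae_def] by blast
  qed
qed

end
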